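(* Let $n,m$ be positive integers with $\gcd(n,m)=1$, let $a,b\in\mathbb{C}\setminus\{0\}$, let $P(w)=w^n+aw^m+b$, and let $S=\{w\in\mathbb{C}:P(w)=0\}$. Suppose that $S$ has exactly $n-1$ distinct elements, and write $S=\{\alpha_1,\alpha_2,\ldots,\alpha_{n-1}\}$, where $\alpha_1$ is the multiple zero of $P$ and $\alpha_2,\ldots,\alpha_{n-1}$ are the simple zeros of $P$. Let $f$ be a non-constant meromorphic function in $\mathbb{C}$ having finitely many poles, and let $\mathcal{L}$ be a non-constant $L$-function. Suppose that either (i) $f$ and $\mathcal{L}$ share $(S,1)^*=\{(\alpha_1,1),(\{\alpha_2,\ldots,\alpha_{n-1}\},2)\}$ and $n>2m+4$; or (ii) $f$ and $\mathcal{L}$ share $(S,0)^*=\{(\alpha_1,0),(\{\alpha_2,\ldots,\alpha_{n-1}\},1)\}$ and $n>2m+5$. Then $f\equiv\mathcal{L}$.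
   Context: **$L$-functions.** An $L$-function is (the meromorphic continuation to $\mathbb{C}$ of) an element of the Selberg class, i.e. a Dirichlet series $\mathcal{L}(s)=\sum_{j=1}^{\infty}a(j)j^{-s}$ satisfying: (1) $a(j)\ll j^{\varepsilon}$ for every $\varepsilon>0$; (2) there is an integer $k_0\ge 0$ such that $(s-1)^{k_0}\mathcal{L}(s)$ is an entire function of finite order; (3) $\Lambda(s)=\omega\,\overline{\Lambda(1-\overline{s})}$, where $\Lambda(s)=\mathcal{L}(s)Q^{s}\prod_{j=1}^{K}\Gamma(\lambda_j s+\nu_j)$ with positive reals $Q,\lambda_j$ and complex numbers $\nu_j,\omega$ with $\mathrm{Re}\,\nu_j\ge 0$, $|\omega|=1$; (4) $\log\mathcal{L}(s)=\sum_{j=1}^{\infty}b(j)j^{-s}$, where $b(j)=0$ unless $j$ is a positive power of a prime, and $b(j)\ll j^{\theta}$ for some $\theta<1/2$. **Weighted sharing.** For $k$ a non-negative integer or $\infty$, and $\alpha\in\mathbb{C}\cup\{\infty\}$, $E_k(\alpha;f)$ is the set of all $\alpha$-points of $f$ in $\mathbb{C}$, where an $\alpha$-point of multiplicity $p$ is counted $p$ times if $p\le k$ and $k+1$ times if $p>k$. For a set $T\subset\mathbb{C}\cup\{\infty\}$, $E_f(T,k)=\bigcup_{\alpha\in T}E_k(\alpha;f)$ (points with counts). We say $f,g$ share $(T,k)$ if $E_f(T,k)=E_g(T,k)$; for $T=\{\alpha\}$ we write $(\alpha,k)$. **Restricted sharing.** If $\hat S\subset\mathbb{C}$ is a finite set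 that is a disjoint union $\hat S=S_1\cup\cdots\cup S_r$, then $f$ and $g$ (non-constant meromorphic in $\mathbb{C}$) share $(\hat S,k)^*=\{(S_1,k_1),\ldots,(S_r,k_r)\}$ means that $f,g$ share $(S_i,k_i)$ for each $i=1,\ldots,r$, where $k=\min\{k_1,\ldots,k_r\}$. *)

theory Defs
  imports
    "HOL-Complex_Analysis.Complex_Analysis"
    "HOL-Number_Theory.Prime_Powers"
    "HOL-Library.Landau_Symbols"
    "HOL-Library.Extended_Nat"
    "HOL-Library.Disjoint_Sets"
begin

text \<open>
  Meromorphic functions on the plane are represented by functions that are
  \<open>nicely_meromorphic_on UNIV\<close>, i.e. removable singularities are removed and the value
  at a pole is the dummy value 0. Hence two of them agree as meromorphic functions iff
  they are equal, and a pole must not be mistaken for a zero.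
\<close>

section \<open>L-functions\<close>

definition entire_finite_order :: "(complex \<Rightarrow> complex) \<Rightarrow> bool" where
  "entire_finite_order G \<longleftrightarrow>
     G holomorphic_on UNIV \<and>
     (\<exists>\<rho>::real. (\<lambda>s. norm (G s)) \<in> O[at_infinity](\<lambda>s. exp (norm s powr \<rho>)))"

text \<open>\<open>\<Sum>j\<ge>1. a(j) j\<^sup>-\<^sup>s\<close> converges with sum \<open>v\<close>; the summation index is shifted by one.\<close>

definition dirichlet_sums :: "(nat \<Rightarrow> complex) \<Rightarrow> complex \<Rightarrow> complex \<Rightarrow> bool" where
  "dirichlet_sums a s v \<longleftrightarrow> (\<lambda>j. a (Suc j) * of_nat (Suc j) powr (- s)) sums v"

definition completed_L ::
    "(complex \<Rightarrow> complex) \<Rightarrow> real \<Rightarrow> nat \<Rightarrow> (nat \<Rightarrow> real) \<Rightarrow> (nat \<Rightarrow> complex) \<Rightarrow> complex \<Rightarrow> complex"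
  where
  "completed_L L Q K lam nu s =
     L s * of_real Q powr s * (\<Prod>j=1..K. Gamma (of_real (lam j) * s + nu j))"

text \<open>
  In the second axiom, the entire function agrees with \<open>(s - 1)^k0 * L s\<close> away from 1; at 1 it
  takes the limit value, which the literal product does not (there \<open>L\<close> may have a pole).
  The functional equation is an identity of meromorphic functions, hence required
  outside a closed discrete set (\<open>Gamma\<close> and \<open>L\<close> have dummy values at their poles).
  The logarithm in the last axiom is the holomorphic branch in the half-plane \<open>Re s > 1\<close> given by
  the series itself, not the principal value; its vanishing as \<open>Re s\<close> tends to infinity follows
  from \<open>b 1 = 0\<close>.
\<close>

definition L_function :: "(complex \<Rightarrow> complex) \<Rightarrow> bool" where
  "L_function L \<longleftrightarrow>
     L nicely_meromorphic_on UNIV \<and>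
     (\<exists>a::nat \<Rightarrow> complex.
        (\<forall>s. Re s > 1 \<longrightarrow> dirichlet_sums a s (L s)) \<and>
        (\<forall>\<epsilon>>0. (\<lambda>j. norm (a j)) \<in> O(\<lambda>j. real j powr \<epsilon>))) \<and>
     (\<exists>(k0::nat) G. entire_finite_order G \<and> (\<forall>s. s \<noteq> 1 \<longrightarrow> G s = (s - 1) ^ k0 * L s)) \<and>
     (\<exists>(Q::real) (K::nat) (lam::nat \<Rightarrow> real) (nu::nat \<Rightarrow> complex) (\<omega>::complex).
        Q > 0 \<and> (\<forall>j\<in>{1..K}. lam j > 0 \<and> Re (nu j) \<ge> 0) \<and> norm \<omega> = 1 \<and>
        eventually (\<lambda>s. completed_L L Q K lam nu s =
                        \<omega> * cnj (completed_L L Q K lam nu (1 - cnj s))) (cosparse UNIV)) \<and>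
     (\<exists>(b::nat \<Rightarrow> complex) (\<theta>::real).
        (\<forall>j\<ge>1. \<not> primepow j \<longrightarrow> b j = 0) \<and>
        \<theta> < 1/2 \<and> (\<lambda>j. norm (b j)) \<in> O(\<lambda>j. real j powr \<theta>) \<and>
        (\<forall>s. Re s > 1 \<longrightarrow> (\<exists>v. dirichlet_sums b s v \<and> exp v = L s)))"


section \<open>Weighted and restricted sharing\<close>

text \<open>
  Only finite values \<open>\<alpha>\<close> are treated. A set of points with counts is encoded as a set of
  pairs (point, count); for distinct values \<open>\<alpha>\<close> the point sets are disjoint, so the plain union
  loses no counts. The multiplicity is meaningful only if \<open>f\<close> is not identically \<open>\<alpha>\<close>.
\<close>

definition value_point :: "(complex \<Rightarrow> complex) \<Rightarrow> complex \<Rightarrow> complex \<Rightarrow> bool" where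
  "value_point f \<alpha> z \<longleftrightarrow> \<not> is_pole f z \<and> f z = \<alpha>"

definition value_mult :: "(complex \<Rightarrow> complex) \<Rightarrow> complex \<Rightarrow> complex \<Rightarrow> nat" where
  "value_mult f \<alpha> z = nat (zorder (\<lambda>w. f w - \<alpha>) z)"

definition weighted_count :: "enat \<Rightarrow> nat \<Rightarrow> enat" where
  "weighted_count k p = (if enat p \<le> k then enat p else k + 1)"

definition E_point :: "enat \<Rightarrow> complex \<Rightarrow> (complex \<Rightarrow> complex) \<Rightarrow> (complex \<times> enat) set" where
  "E_point k \<alpha> f = {(z, weighted_count k (value_mult f \<alpha> z)) | z. value_point f \<alpha> z}"

definition E_set :: "(complex \<Rightarrow> complex) \<Rightarrow> complex set \<Rightarrow> enat \<Rightarrow> (complex \<times> enat) set" where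
  "E_set f T k = (\<Union>\<alpha>\<in>T. E_point k \<alpha> f)"

definition shares :: "(complex \<Rightarrow> complex) \<Rightarrow> (complex \<Rightarrow> complex) \<Rightarrow> complex set \<Rightarrow> enat \<Rightarrow> bool"
  where "shares f g T k \<longleftrightarrow> E_set f T k = E_set g T k"

text \<open>\<open>f\<close> and \<open>g\<close> share \<open>(S, k)\<^sup>* = {(S\<^sub>1, k\<^sub>1), \<dots>, (S\<^sub>r, k\<^sub>r)}\<close>, the right-hand side given as a list.\<close>

definition shares_restricted ::
    "(complex \<Rightarrow> complex) \<Rightarrow> (complex \<Rightarrow> complex) \<Rightarrow> complex set \<Rightarrow> enat \<Rightarrow>
     (complex set \<times> enat) list \<Rightarrow> bool" where
  "shares_restricted f g S k parts \<longleftrightarrow>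
     finite S \<and>
     S = (\<Union>i<length parts. fst (parts ! i)) \<and>
     disjoint_family_on (\<lambda>i. fst (parts ! i)) {..<length parts} \<and>
     k = Min (snd ` set parts) \<and>
     (\<forall>(T, l)\<in>set parts. shares f g T l)"

end

theory Submission
  imports
    Defs
    "HOL-Computational_Algebra.Fundamental_Theorem_Algebra"
    "HOL-Real_Asymp.Real_Asymp"
begin

text \<open>
  The proof is value distribution theory for meromorphic functions with finitely many poles. For
  such a function the characteristic is the proximity function \<open>prox r f\<close> up to \<open>O(ln r)\<close>, and a
  non-constant L-function \<open>L\<close> is essential at infinity: its only possible pole is \<open>1\<close>, and on the
  positive axis \<open>L - 1\<close> decays exponentially without vanishing identically
  (\<open>L_function_transcendental\<close>). Hence \<open>T r = prox r f + prox r L\<close> outgrows every multiple of \<open>ln r\<close>.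

  Two tools carry the analysis: the formula of Jensen (\<open>jensen\<close>) and the lemma on the logarithmic
  derivative (\<open>logarithmic_derivative_small\<close>). From them follows the second main theorem in the
  form \<open>(q - 1) T(f) \<le> - N(f' / \<Prod>(f - \<beta>)) + o(T)\<close> for \<open>q\<close> values \<open>\<beta>\<close>, where \<open>N\<close> counts zeros minus
  poles (\<open>second_main_theorem\<close>).

  Write \<open>P = w^n + V\<close> with \<open>V = a w^m + b\<close>, and let \<open>P = (w - \<alpha>)^2 Q\<close>, where \<open>\<alpha>\<close> is the multiple root.
  The function \<open>V(f) / P(f)\<close> has derivative \<open>- \<phi> f\<close>, where
  \<open>\<phi> f = f' f^(n-1) \<Delta>(f) / P(f)^2\<close> and \<open>\<Delta> = n P - w P'\<close> has degree at most \<open>m\<close>. Let \<open>\<rho> = \<phi> f / \<phi> L\<close> and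
  \<open>H = \<rho>' / \<rho>\<close>; then \<open>prox r H\<close> is \<open>o(T)\<close>.

  Suppose that \<open>H\<close> is not identically \<open>0\<close>. Apply the second main theorem to \<open>f\<close> and \<open>L\<close> with the \<open>n\<close>
  values \<open>0\<close> and the roots of \<open>P\<close>. The poles of \<open>H\<close> are simple, and \<open>H\<close> vanishes wherever \<open>f\<close> and \<open>L\<close>
  take a root of \<open>Q\<close> with multiplicity one; comparing orders point by point
  (\<open>pointwise_inequality\<close>), and using that the zeros of \<open>H\<close> minus its poles contribute \<open>o(T)\<close>, gives
  \<open>(n - 1) T \<le> ((n - 2)/2 + m + 2 + \<kappa>) T + o(T)\<close>, i.e. \<open>n \<le> 2 m + 4 + 2 \<kappa>\<close>. Here \<open>\<kappa> = 0\<close> if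
  multiplicities at the roots of \<open>Q\<close> agree up to \<open>3\<close>, and \<open>\<kappa> = 1/2\<close> if they agree only up to \<open>2\<close>.
  This contradicts the assumption on \<open>n\<close> (\<open>nondegenerate_impossible\<close>).

  So \<open>H = 0\<close>, and two integrations give \<open>V(f)/P(f) = c V(L)/P(L) + d\<close> with \<open>c \<noteq> 0\<close>
  (\<open>degenerate_relation\<close>). Unless \<open>(c, d)\<close> is \<open>(1, 0)\<close> or \<open>(-1, 1)\<close>, there are at least \<open>m + 3\<close> values
  that \<open>f\<close> takes only where \<open>V(L)\<close> or \<open>L\<close> vanishes, and likewise with \<open>f\<close> and \<open>L\<close> exchanged; if \<open>(c, d) = (-1, 1)\<close>, then
  \<open>(f L)^n = V(f) V(L)\<close>, which makes multiplicities too high. The second main theorem forbids both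
  (\<open>related_imp_trivial\<close>).
  In the remaining case \<open>V(f) L^n = V(L) f^n\<close>. With \<open>h = f / L\<close> this reads
  \<open>a L^m (h^m - h^n) = b (h^n - 1)\<close>, and since \<open>gcd(n, m) = 1\<close>, \<open>h\<close> omits near infinity the roots of
  unity of order \<open>n - m\<close> other than \<open>1\<close>. By the great theorem of Picard \<open>h\<close> is meromorphic at
  infinity. If \<open>h \<noteq> 1\<close>, then so is \<open>L^m\<close>, although \<open>L\<close> is essential there; hence \<open>f = L\<close>
  (\<open>trivially_related_imp_eq\<close>).
\<close>

section \<open>Means over circles\<close>

definition cmean :: "real \<Rightarrow> (complex \<Rightarrow> real) \<Rightarrow> real" where
  "cmean r u = integral {0..1} (\<lambda>t. u (circlepath 0 r t))"

lemma circlepath_in_sphere: "r \<ge> 0 \<Longrightarrow> circlepath 0 r t \<in> sphere 0 r"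
  by (simp add: circlepath norm_mult)

lemma cmean_integrable:
  fixes u :: "complex \<Rightarrow> 'a::euclidean_space"
  assumes "continuous_on (sphere 0 r) u" "r \<ge> 0"
  shows "(\<lambda>t. u (circlepath 0 r t)) integrable_on {0..1}"
proof (rule integrable_continuous_real)
  show "continuous_on {0..1} (\<lambda>t. u (circlepath 0 r t))"
  proof (rule continuous_on_compose2[OF assms(1)])
    show "continuous_on {0..1} (circlepath 0 r)"
      using path_circlepath path_def by blast
    show "circlepath 0 r ` {0..1} \<subseteq> sphere 0 r"
      using circlepath_in_sphere[OF assms(2)] by blast
  qed
qed

lemma cmean_mono:
  assumes "continuous_on (sphere 0 r) u" "continuous_on (sphere 0 r) v" "r \<ge> 0"
    "\<And>z. norm z = r \<Longrightarrow> u z \<le> v z"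
  shows "cmean r u \<le> cmean r v"
  unfolding cmean_def using circlepath_in_sphere[OF assms(3)]
  by (intro integral_le cmean_integrable assms) (auto simp: dist_norm)

lemma cmean_cong: "r \<ge> 0 \<Longrightarrow> (\<And>z. norm z = r \<Longrightarrow> u z = v z) \<Longrightarrow> cmean r u = cmean r v"
  unfolding cmean_def using circlepath_in_sphere[of r] by (intro Henstock_Kurzweil_Integration.integral_cong) auto

lemma cmean_add:
  assumes "continuous_on (sphere 0 r) u" "continuous_on (sphere 0 r) v" "r \<ge> 0"
  shows "cmean r (\<lambda>z. u z + v z) = cmean r u + cmean r v"
  unfolding cmean_def by (intro Henstock_Kurzweil_Integration.integral_add cmean_integrable assms)

lemma cmean_cmult: "cmean r (\<lambda>z. c * u z) = c * cmean r u"
  unfolding cmean_def by simp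

lemma cmean_const: "cmean r (\<lambda>z. c) = c"
  unfolding cmean_def by simp

lemma cmean_sum:
  assumes "\<And>i. i \<in> I \<Longrightarrow> continuous_on (sphere 0 r) (u i)" "r \<ge> 0" "finite I"
  shows "cmean r (\<lambda>z. \<Sum>i\<in>I. u i z) = (\<Sum>i\<in>I. cmean r (u i))"
  unfolding cmean_def by (intro Henstock_Kurzweil_Integration.integral_sum cmean_integrable assms)

lemma cmean_bounds:
  assumes "continuous_on (sphere 0 r) u" "r \<ge> 0" "\<And>z. norm z = r \<Longrightarrow> u z \<le> c"
  shows "cmean r u \<le> c"
  using cmean_mono[OF assms(1) continuous_on_const assms(2,3)] by (simp add: cmean_const)

lemma cmean_nonneg:
  assumes "continuous_on (sphere 0 r) u" "r \<ge> 0" "\<And>z. norm z = r \<Longrightarrow> 0 \<le> u z"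
  shows "0 \<le> cmean r u"
  using cmean_mono[OF continuous_on_const assms] by (simp add: cmean_const)

text \<open>
  Jensen's inequality for the concave logarithm: \<open>ln\<close> lies below its tangent at \<open>c\<close>, the mean of
  \<open>1 + u\<close>.
\<close>
lemma cmean_ln_le:
  assumes "continuous_on (sphere 0 r) u" "r \<ge> 0" "\<And>z. norm z = r \<Longrightarrow> 0 \<le> u z"
  shows "cmean r (\<lambda>z. ln (1 + u z)) \<le> ln (1 + cmean r u)"
proof -
  define c where "c = 1 + cmean r u"
  have c: "c \<ge> 1" using cmean_nonneg[OF assms] by (simp add: c_def)
  have "cmean r (\<lambda>z. ln (1 + u z)) \<le> cmean r (\<lambda>z. (ln c + 1 / c - 1) + 1 / c * u z)"
  proof (rule cmean_mono)
    fix z :: complex assume z: "norm z = r"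
    have "ln ((1 + u z) / c) \<le> (1 + u z) / c - 1"
      using c assms(3)[OF z] by (intro ln_le_minus_one) auto
    moreover have "ln ((1 + u z) / c) = ln (1 + u z) - ln c"
      using c assms(3)[OF z] by (simp add: ln_div)
    ultimately show "ln (1 + u z) \<le> (ln c + 1 / c - 1) + 1 / c * u z"
      by (simp add: add_divide_distrib)
  next
    have *: "1 + u z \<noteq> 0" if "norm z = r" for z
      using assms(3)[OF that] by linarith
    show "continuous_on (sphere 0 r) (\<lambda>z. ln (1 + u z))"
      by (intro continuous_intros assms(1)) (use * in auto)
  qed (intro continuous_intros assms)+
  also have "\<dots> = (ln c + 1 / c - 1) + 1 / c * (c - 1)"
    by (subst cmean_add) (auto intro!: continuous_intros assms simp only: cmean_const cmean_cmult, simp add: c_def)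
  also have "\<dots> = ln c" using c by (simp add: field_simps)
  finally show ?thesis by (simp add: c_def)
qed

lemma circle_mean_value:
  assumes "E analytic_on cball 0 r" "r > 0"
  shows "((\<lambda>t. E (circlepath 0 r t)) has_integral E 0) {0..1}"
proof -
  have "((\<lambda>u. E u/(u-0)) has_contour_integral (2 * of_real pi * \<i> * E 0)) (circlepath 0 r)"
    using assms
    by (intro Cauchy_integral_circlepath holomorphic_on_imp_continuous_on)
      (auto intro!: analytic_imp_holomorphic elim: analytic_on_subset)
  hence "((\<lambda>t. E (circlepath 0 r t) / circlepath 0 r t * (2 * pi * \<i> * r * exp (2 * pi * \<i> * t)))
      has_integral 2 * of_real pi * \<i> * E 0) {0..1}"
    unfolding has_contour_integral_def
    by (rule has_integral_eq[rotated]) (simp add: vector_derivative_circlepath01)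
  hence "((\<lambda>t. (2 * pi * \<i>) * E (circlepath 0 r t)) has_integral (2 * of_real pi * \<i>) * E 0) {0..1}"
    by (rule has_integral_eq[rotated]) (use assms(2) in \<open>simp add: circlepath mult_ac\<close>)
  from has_integral_mult_right[OF this, of "inverse (2 * of_real pi * \<i>)"]
  have "((\<lambda>t. inverse (2 * of_real pi * \<i>) * ((2 * of_real pi * \<i>) * E (circlepath 0 r t)))
      has_integral inverse (2 * of_real pi * \<i>) * ((2 * of_real pi * \<i>) * E 0)) {0..1}" by simp
  moreover have "inverse (2 * of_real pi * \<i>) * ((2 * of_real pi * \<i>) * x) = x" for x
    by (simp add: field_simps)
  ultimately show ?thesis by (simp only:)
qed

lemma cmean_Re_mean_value:
  assumes "E analytic_on cball 0 r" "r > 0"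
  shows "cmean r (\<lambda>z. Re (E z)) = Re (E 0)"
  unfolding cmean_def
  by (rule integral_unique, rule has_integral_Re[OF circle_mean_value[OF assms], unfolded o_def])

text \<open>
  This is the derivative of the Schwarz integral formula. Cauchy's formula for \<open>E'(z)\<close> has the kernel
  \<open>u / (u - z)^2\<close>; by reflection in the circle the same kernel integrates the conjugate of \<open>E\<close> to \<open>0\<close>.
  Adding the two formulas leaves only the real part of \<open>E\<close>.
\<close>
lemma deriv_bound_by_real_part:
  assumes E: "E analytic_on cball 0 R" and z: "norm z < R"
  shows "norm (deriv E z) \<le> 2 * R / (R - norm z)^2 * cmean R (\<lambda>w. \<bar>Re (E w)\<bar>)"
proof -
  have R: "R > 0" using z norm_ge_zero[of z] by linarith
  let ?g = "circlepath 0 R"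
  have cont: "continuous_on (cball 0 R) E" and hol: "E holomorphic_on ball 0 R"
    using E by (auto intro!: holomorphic_on_imp_continuous_on analytic_imp_holomorphic elim: analytic_on_subset)
  have contS: "continuous_on (sphere 0 R) E"
    using cont by (rule continuous_on_subset) auto
  have zb: "z \<in> ball 0 R" using z by simp
  have gz: "?g t - z \<noteq> 0" for t
    using circlepath_in_sphere[of R t] z R by auto
  have g0: "?g t \<noteq> 0" for t using R by (simp add: circlepath)
  have D: "deriv E z = 1 / (2 * of_real pi * \<i>) * contour_integral ?g (\<lambda>u. E u / (u-z)^2)"
    using Cauchy_derivative_integral_circlepath(2)[OF cont hol zb] DERIV_imp_deriv by blast
  have "((\<lambda>u. E u / (u-z)^2) has_contour_integral (2 * of_real pi * \<i> * deriv E z)) ?g"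
    using Cauchy_derivative_integral_circlepath(1)[OF cont hol zb] unfolding D
    by (simp add: has_contour_integral_integral)
  hence "((\<lambda>t. E (?g t) / (?g t - z)^2 * (2 * pi * \<i> * R * exp (2 * pi * \<i> * t)))
      has_integral 2 * of_real pi * \<i> * deriv E z) {0..1}"
    unfolding has_contour_integral_def
    by (rule has_integral_eq[rotated]) (simp add: vector_derivative_circlepath01)
  from has_integral_mult_right[OF this, of "inverse (2 * of_real pi * \<i>)"]
  have "((\<lambda>t. inverse (2 * of_real pi * \<i>) * ((2 * of_real pi * \<i>) * (E (?g t) * (?g t / (?g t - z)^2))))
      has_integral inverse (2 * of_real pi * \<i>) * ((2 * of_real pi * \<i>) * deriv E z)) {0..1}"
    by (rule has_integral_eq[rotated]) (simp add: circlepath mult_ac)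
  moreover have "inverse (2 * of_real pi * \<i>) * ((2 * of_real pi * \<i>) * x) = x" for x
    by (simp add: field_simps)
  ultimately have I1: "((\<lambda>t. E (?g t) * (?g t / (?g t - z)^2)) has_integral deriv E z) {0..1}"
    by (simp only:)
  let ?F = "\<lambda>u. E u * u * R^2 / (R^2 - cnj z * u)^2"
  have nz: "R^2 - cnj z * u \<noteq> 0" if "u \<in> cball 0 R" for u
  proof
    assume "R^2 - cnj z * u = 0"
    hence "norm (cnj z * u) = R^2" by (metis eq_iff_diff_eq_0 norm_of_real power2_abs abs_power2 of_real_power)
    hence "norm z * norm u = R * R" by (simp add: norm_mult power2_eq_square)
    moreover have "norm z * norm u \<le> norm z * R" using that by (intro mult_left_mono) auto
    moreover have "norm z * R < R * R" using z R by simp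
    ultimately show False by simp
  qed
  have "((\<lambda>t. ?F (?g t)) has_integral ?F 0) {0..1}"
    using nz by (intro circle_mean_value analytic_intros E R) auto
  hence "(cnj \<circ> (\<lambda>t. ?F (?g t)) has_integral cnj 0) {0..1}"
    by (subst has_integral_cnj) simp
  moreover have "cnj (?F (?g t)) = cnj (E (?g t)) * (?g t / (?g t - z)^2)" for t
  proof -
    have "?g t * cnj (?g t) = R^2"
      using circlepath_in_sphere[of R t] R by (simp add: complex_norm_square[symmetric])
    hence c: "cnj (?g t) = R^2 / ?g t" using g0[of t] by (simp add: field_simps)
    have "R^2 - z * cnj (?g t) = R^2 * (?g t - z) / ?g t" unfolding c using g0[of t] by (simp add: field_simps)
    hence "cnj (?F (?g t)) = cnj (E (?g t)) * (R^2 / ?g t) * R^2 / (R^2 * (?g t - z) / ?g t)^2"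
      by (simp add: c)
    also have "\<dots> = cnj (E (?g t)) * (?g t / (?g t - z)^2)"
    proof -
      have alg: "C * (\<rho> / g) * \<rho> / (\<rho> * d / g)^2 = C * (g / d^2)"
        if "g \<noteq> 0" "d \<noteq> 0" "\<rho> \<noteq> 0" for C \<rho> g d :: complex
        using that by (simp add: power_divide power_mult_distrib) (simp add: field_simps power2_eq_square)
      show ?thesis by (rule alg) (use g0[of t] gz[of t] R in auto)
    qed
    finally show ?thesis .
  qed
  ultimately have I2: "((\<lambda>t. cnj (E (?g t)) * (?g t / (?g t - z)^2)) has_integral 0) {0..1}"
    by (simp add: o_def)
  have I: "((\<lambda>t. 2 * Re (E (?g t)) * (?g t / (?g t - z)^2)) has_integral deriv E z) {0..1}"
  proof -
    have eq: "E (?g t) * (?g t / (?g t - z)^2) + cnj (E (?g t)) * (?g t / (?g t - z)^2)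
        = 2 * Re (E (?g t)) * (?g t / (?g t - z)^2)" for t
      by (simp only: distrib_right[symmetric] complex_add_cnj of_real_mult of_real_numeral)
    show ?thesis using has_integral_add[OF I1 I2] unfolding eq by simp
  qed
  have J: "(\<lambda>t. 2 * R / (R - norm z)^2 * \<bar>Re (E (?g t))\<bar>) integrable_on {0..1}"
    by (rule cmean_integrable) (use R z in \<open>auto intro!: continuous_intros contS\<close>)
  have "norm (deriv E z) = norm (integral {0..1} (\<lambda>t. 2 * Re (E (?g t)) * (?g t / (?g t - z)^2)))"
    using I by (simp add: integral_unique)
  also have "\<dots> \<le> integral {0..1} (\<lambda>t. 2 * R / (R - norm z)^2 * \<bar>Re (E (?g t))\<bar>)"
  proof (rule integral_norm_bound_integral)
    show "(\<lambda>t. 2 * Re (E (?g t)) * (?g t / (?g t - z)^2)) integrable_on {0..1}" using I by blast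
    fix t
    have nR: "norm (?g t) = R" using circlepath_in_sphere[of R t] R by simp
    have "(R - norm z)^2 \<le> norm (?g t - z)^2"
      using norm_triangle_ineq2[of "?g t" z] nR z by (intro power_mono) auto
    hence "R / norm (?g t - z)^2 \<le> R / (R - norm z)^2"
      using z R gz[of t] by (intro divide_left_mono) auto
    hence "2 * \<bar>Re (E (?g t))\<bar> * (R / norm (?g t - z)^2) \<le> 2 * \<bar>Re (E (?g t))\<bar> * (R / (R - norm z)^2)"
      by (intro mult_left_mono) auto
    thus "norm (2 * Re (E (?g t)) * (?g t / (?g t - z)^2)) \<le> 2 * R / (R - norm z)^2 * \<bar>Re (E (?g t))\<bar>"
      by (simp add: norm_mult norm_divide norm_power nR mult_ac)
  qed (rule J)
  also have "\<dots> = 2 * R / (R - norm z)^2 * cmean R (\<lambda>w. \<bar>Re (E w)\<bar>)"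
    unfolding cmean_def by (rule integral_mult_right)
  finally show ?thesis .
qed

lemma analytic_nonzero_log:
  assumes e: "e analytic_on cball 0 R" and nz: "\<And>z. norm z \<le> R \<Longrightarrow> e z \<noteq> 0" and R: "R > 0"
  obtains E where "E analytic_on cball 0 R" "\<And>z. norm z \<le> R \<Longrightarrow> e z = exp (E z)"
    "\<And>z. norm z \<le> R \<Longrightarrow> deriv E z = deriv e z / e z"
proof -
  obtain U where U: "open U" "cball 0 R \<subseteq> U" "e holomorphic_on U"
    using e unfolding analytic_on_holomorphic by blast
  have "open (U \<inter> e -` (-{0}))"
    using U holomorphic_on_imp_continuous_on[OF U(3)] by (intro continuous_open_preimage) auto
  moreover have "cball 0 R \<subseteq> U \<inter> e -` (-{0})" using U nz by auto
  ultimately obtain \<epsilon> where \<epsilon>: "\<epsilon> > 0" "(\<Union>x\<in>cball 0 R. cball x \<epsilon>) \<subseteq> U \<inter> e -` (-{0})"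
    using compact_subset_open_imp_cball_epsilon_subset[of "cball 0 R"] by (metis compact_cball)
  have sub: "ball 0 (R + \<epsilon>) \<subseteq> U \<inter> e -` (-{0})"
  proof
    fix x :: complex assume x: "x \<in> ball 0 (R + \<epsilon>)"
    show "x \<in> U \<inter> e -` (-{0})"
    proof (cases "norm x \<le> R")
      case True thus ?thesis using \<open>cball 0 R \<subseteq> U \<inter> e -` (-{0})\<close> by auto
    next
      case False
      define y where "y = (R / norm x) *\<^sub>R x"
      have "x \<noteq> 0" using False R by auto
      have "norm y = R" using R \<open>x \<noteq> 0\<close> by (simp add: y_def)
      have "x - y = (1 - R / norm x) *\<^sub>R x" by (simp add: y_def algebra_simps)
      hence "norm (x - y) = \<bar>1 - R / norm x\<bar> * norm x" by simp
      also have "\<dots> = norm x - R" using False R \<open>x \<noteq> 0\<close> by (simp add: abs_if field_simps)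
      finally have "dist y x \<le> \<epsilon>" using x by (simp add: dist_norm norm_minus_commute)
      hence "x \<in> (\<Union>x\<in>cball 0 R. cball x \<epsilon>)" using \<open>norm y = R\<close> by (intro UN_I[of y]) auto
      thus ?thesis using \<epsilon> by blast
    qed
  qed
  have nzb: "e z \<noteq> 0" if "z \<in> ball 0 (R + \<epsilon>)" for z using sub that by auto
  have hol: "e holomorphic_on ball 0 (R + \<epsilon>)" by (rule holomorphic_on_subset[OF U(3)]) (use sub in auto)
  have con: "contractible (ball (0::complex) (R + \<epsilon>))" by (simp add: convex_imp_contractible)
  obtain E where E: "E holomorphic_on ball 0 (R + \<epsilon>)" "\<And>z. z \<in> ball 0 (R + \<epsilon>) \<Longrightarrow> e z = exp (E z)"
    using contractible_imp_holomorphic_log[OF hol con nzb] by blast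
  have an: "E analytic_on cball 0 R" unfolding analytic_on_holomorphic
    using E(1) \<epsilon>(1) by (intro exI[of _ "ball 0 (R+\<epsilon>)"]) auto
  have "deriv E z = deriv e z / e z" if "norm z \<le> R" for z
  proof -
    have zb: "z \<in> ball 0 (R + \<epsilon>)" using that \<epsilon>(1) by simp
    have "(E has_field_derivative deriv E z) (at z)"
      using E(1) zb holomorphic_derivI open_ball by blast
    hence "((\<lambda>z. exp (E z)) has_field_derivative exp (E z) * deriv E z) (at z)"
      by (auto intro!: derivative_eq_intros)
    hence "(e has_field_derivative exp (E z) * deriv E z) (at z)"
      by (rule has_field_derivative_transform_within_open[OF _ open_ball zb]) (use E(2) in auto)
    hence "deriv e z = exp (E z) * deriv E z" by (rule DERIV_imp_deriv)
    thus ?thesis using E(2)[OF zb] by simp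
  qed
  thus thesis using that[of E] an E(2) \<epsilon>(1) by auto
qed

lemma cmean_ln_nonzero:
  assumes e: "e analytic_on cball 0 r" and nz: "\<And>z. norm z \<le> r \<Longrightarrow> e z \<noteq> 0" and r: "r > 0"
  shows "cmean r (\<lambda>z. ln (norm (e z))) = ln (norm (e 0))"
proof -
  obtain E where E: "E analytic_on cball 0 r" "\<And>z. norm z \<le> r \<Longrightarrow> e z = exp (E z)"
    using analytic_nonzero_log[OF assms] by metis
  have "cmean r (\<lambda>z. ln (norm (e z))) = cmean r (\<lambda>z. Re (E z))"
    using r E(2) by (intro cmean_cong) auto
  also have "\<dots> = Re (E 0)" by (rule cmean_Re_mean_value[OF E(1) r])
  also have "\<dots> = ln (norm (e 0))" using E(2)[of 0] r by simp
  finally show ?thesis .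
qed

text \<open>Reflection in the circle: it moves the zero of \<open>z - a\<close> out of the disc, without changing
  the modulus on the circle.\<close>
lemma reflected_factor:
  assumes "norm a < r" "norm z = r"
  shows "norm (z - a) = norm (r - cnj a * z / r)"
proof -
  have r: "r > 0" using assms norm_ge_zero[of a] by linarith
  have z0: "z \<noteq> 0" using r assms by auto
  have zz: "z * cnj z = r^2" using assms by (simp add: complex_norm_square[symmetric])
  have "r - cnj a * z / r = (z / r) * cnj (z - a)"
    using r zz by (simp add: field_simps power2_eq_square)
  hence "norm (r - cnj a * z / r) = norm (z / r) * norm (cnj (z - a))"
    by (metis norm_mult)
  thus ?thesis using r assms by (simp only: complex_mod_cnj) (simp add: norm_divide)
qed

lemma reflected_factor_nonzero:
  assumes "norm a < r" "norm z \<le> r"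
  shows "of_real r - cnj a * z / of_real r \<noteq> 0" "norm (cnj a * z / (of_real r)^2) < 1"
proof -
  have r: "r > 0" using assms norm_ge_zero[of a] by linarith
  have "norm a * norm z \<le> norm a * r" using assms by (intro mult_left_mono) auto
  also have "\<dots> < r * r" using assms r by simp
  finally show *: "norm (cnj a * z / (of_real r)^2) < 1"
    using r by (simp add: norm_mult norm_divide norm_power power2_eq_square)
  show "of_real r - cnj a * z / of_real r \<noteq> 0"
  proof
    assume "of_real r - cnj a * z / of_real r = 0"
    hence eq: "cnj a * z / of_real r = of_real r" by simp
    have "cnj a * z / (of_real r)^2 = (cnj a * z / of_real r) / of_real r"
      by (simp add: power2_eq_square)
    also have "\<dots> = 1" unfolding eq using r by simp
    finally have "cnj a * z / (of_real r)^2 = 1" .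
    thus False using * by simp
  qed
qed

lemma cmean_ln_linear:
  assumes "norm a \<noteq> r" "r > 0"
  shows "cmean r (\<lambda>z. ln (norm (z - a))) = ln (max r (norm a))"
proof (cases "norm a < r")
  case True
  have "cmean r (\<lambda>z. ln (norm (z - a))) = cmean r (\<lambda>z. ln (norm (r - cnj a * z / r)))"
    using reflected_factor[OF True] assms by (intro cmean_cong) auto
  also have "\<dots> = ln (norm (r - cnj a * 0 / r))"
    using assms reflected_factor_nonzero[OF True] by (intro cmean_ln_nonzero analytic_intros) auto
  finally show ?thesis using True assms by simp
next
  case False
  hence "cmean r (\<lambda>z. ln (norm (z - a))) = ln (norm (0 - a))"
    using assms by (intro cmean_ln_nonzero analytic_intros) auto
  thus ?thesis using False by simp
qed

text \<open>
  The condition says that \<open>s\<close> lies within 45 degrees of the positive axis.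
\<close>
lemma norm_le_Re_right_sector:
  assumes "Re (s^2) > 0" "Re s \<ge> 0"
  shows "norm s \<le> sqrt 2 * Re s"
proof -
  have "(Im s)\<^sup>2 \<le> (Re s)\<^sup>2" using assms(1) by (simp add: Re_power2)
  hence "(Re s)\<^sup>2 + (Im s)\<^sup>2 \<le> 2 * (Re s)\<^sup>2" by linarith
  hence "norm s \<le> sqrt (2 * (Re s)\<^sup>2)" unfolding cmod_def by (rule real_sqrt_le_mono)
  also have "\<dots> = sqrt 2 * Re s" using assms(2) by (simp add: real_sqrt_mult)
  finally show ?thesis .
qed

text \<open>
  \<open>1 / csqrt (1 - c z)\<close> is holomorphic on the disc with values in a sector around the positive axis, so its
  modulus is at most \<open>sqrt 2\<close> times its real part, and the mean value property applies to the latter.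
\<close>
lemma cmean_inverse_sqrt_one_minus:
  assumes "r > 0" "\<And>z. norm z \<le> r \<Longrightarrow> norm (c * z) < 1"
  shows "cmean r (\<lambda>z. 1 / sqrt (norm (1 - c * z))) \<le> sqrt 2"
proof -
  have Re0: "Re (1 - c * z) > 0" if "norm z \<le> r" for z
    using assms(2)[OF that] complex_Re_le_cmod[of "c * z"] by simp
  have ne: "1 - c * z \<noteq> 0" if "norm z \<le> r" for z using assms(2)[OF that] by auto
  let ?E = "\<lambda>z. 1 / csqrt (1 - c * z)"
  have nonpos: "1 - c * z \<notin> \<real>\<^sub>\<le>\<^sub>0" if "norm z \<le> r" for z
    using Re0[OF that] by (auto simp: complex_nonpos_Reals_iff)
  have E: "?E analytic_on cball 0 r"
    using nonpos ne by (intro analytic_intros) auto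
  have key: "1 / sqrt (norm (1 - c * z)) \<le> sqrt 2 * Re (?E z)" if z: "norm z = r" for z
  proof -
    define s where "s = csqrt (1 - c * z)"
    have s2: "s^2 = 1 - c * z" by (simp add: s_def)
    have "Re s \<ge> 0" unfolding s_def using csqrt_principal[of "1 - c*z"] by linarith
    have "Re (s^2) > 0" unfolding s2 by (rule Re0) (use z in simp)
    hence le: "norm s \<le> sqrt 2 * Re s" using \<open>Re s \<ge> 0\<close> by (rule norm_le_Re_right_sector)
    have "s \<noteq> 0" using ne[of z] z s2 by auto
    have "norm (1 - c * z) = (norm s)^2" unfolding s2[symmetric] by (rule norm_power)
    hence ns: "sqrt (norm (1 - c * z)) = norm s" by simp
    have "Re (1 / s) = Re s / (norm s)^2" by (simp add: Re_divide cmod_power2)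
    hence eq: "sqrt 2 * Re (1 / s) = (sqrt 2 * Re s) / (norm s)^2" by (simp only: times_divide_eq_right)
    have "1 / norm s = norm s / (norm s)^2" using \<open>s \<noteq> 0\<close> by (simp add: power2_eq_square)
    also have "\<dots> \<le> (sqrt 2 * Re s) / (norm s)^2" using le by (intro divide_right_mono) auto
    finally show ?thesis unfolding ns s_def[symmetric] eq .
  qed
  have "cmean r (\<lambda>z. 1 / sqrt (norm (1 - c * z))) \<le> cmean r (\<lambda>z. sqrt 2 * Re (?E z))"
  proof (rule cmean_mono)
    show "continuous_on (sphere 0 r) (\<lambda>z. 1 / sqrt (norm (1 - c * z)))"
      using ne by (intro continuous_intros) auto
    show "continuous_on (sphere 0 r) (\<lambda>z. sqrt 2 * Re (?E z))"
      by (intro continuous_intros continuous_on_subset[OF holomorphic_on_imp_continuous_on[OF analytic_imp_holomorphic[OF E]]]) auto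
  qed (use assms key in auto)
  also have "\<dots> = sqrt 2 * Re (?E 0)"
    unfolding cmean_cmult cmean_Re_mean_value[OF E assms(1)] ..
  finally show ?thesis by simp
qed

text \<open>
  The bound does not depend on how close \<open>a\<close> is to the circle. This uniformity, which fails for
  \<open>1 / norm (z - a)\<close>, is the reason for the square roots in the estimate of the logarithmic derivative.
\<close>
lemma cmean_inverse_sqrt_linear:
  assumes "norm a \<noteq> r" "r \<ge> 1"
  shows "cmean r (\<lambda>z. 1 / sqrt (norm (z - a))) \<le> 2"
proof -
  have s2: "sqrt 2 \<le> (2::real)" using sqrt2_less_2 by simp
  \<comment> \<open>On the circle, \<open>z - a\<close> is a multiple of a linear factor without zeros in the disc: by reflection
    if \<open>a\<close> is inside, and trivially if it is outside.\<close>
  obtain c k where ck: "\<And>z. norm z \<le> r \<Longrightarrow> norm (c * z) < 1" "k \<ge> 1"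
    "\<And>z. norm z = r \<Longrightarrow> norm (z - a) = k * norm (1 - c * z)"
  proof -
    consider "norm a < r" | "norm a > r" using assms by linarith
    thus thesis
    proof cases
    case 1
    show ?thesis
    proof (rule that[of "cnj a / (of_real r)^2" r])
      show "norm (cnj a / (of_real r)^2 * z) < 1" if "norm z \<le> r" for z
        using reflected_factor_nonzero(2)[OF 1 that] by simp
      fix z :: complex assume z: "norm z = r"
      have "r - cnj a * z / r = r * (1 - cnj a / (of_real r)^2 * z)" using assms by (simp add: field_simps power2_eq_square)
      hence "norm (r - cnj a * z / r) = r * norm (1 - cnj a / (of_real r)^2 * z)" using assms
        by (metis norm_mult norm_of_real abs_of_nonneg order_trans zero_le_one)
      thus "norm (z - a) = r * norm (1 - cnj a / (of_real r)^2 * z)" using reflected_factor[OF 1 z] by simp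
    qed (use assms in auto)
  next
    case 2
    show ?thesis
    proof (rule that[of "1 / a" "norm a"])
      have "a \<noteq> 0" using 2 assms by auto
      show "norm (1 / a * z) < 1" if "norm z \<le> r" for z using that 2 assms \<open>a \<noteq> 0\<close> by (simp add: norm_divide)
      fix z :: complex assume z: "norm z = r"
      have "z - a = - a * (1 - 1 / a * z)" using \<open>a \<noteq> 0\<close> by (simp add: field_simps)
      thus "norm (z - a) = norm a * norm (1 - 1 / a * z)" by (metis norm_minus_cancel norm_mult)
    qed (use 2 assms in auto)
  qed
  qed
  have nz: "1 - c * z \<noteq> 0" if "norm z = r" for z using ck(1)[of z] that by auto
  have "cmean r (\<lambda>z. 1 / sqrt (norm (z - a))) \<le> cmean r (\<lambda>z. 1 / sqrt (norm (1 - c * z)))"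
  proof (rule cmean_mono)
    fix z :: complex assume z: "norm z = r"
    have "norm (1 - c * z) \<le> norm (z - a)"
      using ck(2) ck(3)[OF z] mult_right_mono[of 1 k "norm (1 - c * z)"] by simp
    moreover have "norm (1 - c * z) > 0" using nz[OF z] by simp
    ultimately show "1 / sqrt (norm (z - a)) \<le> 1 / sqrt (norm (1 - c * z))" by (simp add: frac_le)
  next
    have "z \<noteq> a" if "norm z = r" for z using that assms by auto
    thus "continuous_on (sphere 0 r) (\<lambda>z. 1 / sqrt (norm (z - a)))"
      by (intro continuous_intros) auto
    show "continuous_on (sphere 0 r) (\<lambda>z. 1 / sqrt (norm (1 - c * z)))"
      using nz by (intro continuous_intros) auto
  qed (use assms in auto)
  also have "\<dots> \<le> sqrt 2" using assms ck(1) by (intro cmean_inverse_sqrt_one_minus) auto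
  finally show ?thesis using s2 by simp
qed

section \<open>Zeros, poles and the formula of Jensen\<close>

text \<open>
  Meromorphic on the plane and not identically zero, so that orders are defined everywhere.
\<close>
definition mero :: "(complex \<Rightarrow> complex) \<Rightarrow> bool" where
  "mero X \<longleftrightarrow> X meromorphic_on UNIV \<and> eventually (\<lambda>z. X z \<noteq> 0) (cosparse UNIV)"

text \<open>
  The circle of radius \<open>r\<close> carries no zero and no singularity. All but countably many radii have this
  property; removable singularities count as singularities, because values at them are arbitrary.
\<close>
definition good :: "(complex \<Rightarrow> complex) \<Rightarrow> real \<Rightarrow> bool" where
  "good X r \<longleftrightarrow> (\<forall>z. norm z = r \<longrightarrow> X analytic_on {z} \<and> X z \<noteq> 0)"

abbreviation ord :: "(complex \<Rightarrow> complex) \<Rightarrow> complex \<Rightarrow> real" where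
  "ord X z \<equiv> of_int (zorder X z)"

lemma meroI:
  assumes "X meromorphic_on UNIV" "\<not> eventually (\<lambda>z. X z = 0) (cosparse UNIV)"
  shows "mero X"
  using meromorphic_imp_constant_or_avoid[OF assms(1), of 0] assms by (auto simp: mero_def)

lemma mero_at:
  assumes "mero X"
  shows "X meromorphic_on {z}" "eventually (\<lambda>z. X z \<noteq> 0) (at z)" "frequently (\<lambda>z. X z \<noteq> 0) (at z)"
proof -
  show 1: "X meromorphic_on {z}" using assms unfolding mero_def by (meson meromorphic_on_subset subset_UNIV)
  show 2: "eventually (\<lambda>z. X z \<noteq> 0) (at z)"
    using assms unfolding mero_def by (auto intro: eventually_cosparse_imp_eventually_at)
  show "frequently (\<lambda>z. X z \<noteq> 0) (at z)" using 2 by (simp add: eventually_frequently)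
qed

lemma mero_meromorphic: "mero X \<Longrightarrow> X meromorphic_on UNIV" by (simp add: mero_def)

lemma mero_const: "c \<noteq> 0 \<Longrightarrow> mero (\<lambda>_. c)"
  by (auto simp: mero_def intro: meromorphic_intros)

lemma mero_mult: "mero X \<Longrightarrow> mero Y \<Longrightarrow> mero (\<lambda>z. X z * Y z)"
  unfolding mero_def by (auto intro!: meromorphic_intros elim: eventually_elim2)

lemma mero_divide: "mero X \<Longrightarrow> mero Y \<Longrightarrow> mero (\<lambda>z. X z / Y z)"
  unfolding mero_def by (auto intro!: meromorphic_intros elim: eventually_elim2)

lemma mero_power: "mero X \<Longrightarrow> mero (\<lambda>z. X z ^ n)"
proof -
  assume X: "mero X"
  have "eventually (\<lambda>z. X z ^ n \<noteq> 0) (cosparse UNIV)"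
    by (rule eventually_mono[of "\<lambda>z. X z \<noteq> 0"]) (use X in \<open>auto simp: mero_def\<close>)
  thus "mero (\<lambda>z. X z ^ n)" using X meromorphic_on_power[of X UNIV n] by (simp add: mero_def)
qed

lemma mero_prod: "finite A \<Longrightarrow> (\<And>a. a \<in> A \<Longrightarrow> mero (X a)) \<Longrightarrow> mero (\<lambda>z. \<Prod>a\<in>A. X a z)"
  by (induction A rule: finite_induct) (auto intro: mero_const mero_mult)

lemma mero_powi: "mero X \<Longrightarrow> mero (\<lambda>z. X z powi n)"
proof -
  assume X: "mero X"
  have "eventually (\<lambda>z. X z powi n \<noteq> 0) (cosparse UNIV)"
    by (rule eventually_mono[of "\<lambda>z. X z \<noteq> 0"]) (use X in \<open>auto simp: mero_def\<close>)
  thus "mero (\<lambda>z. X z powi n)" using X meromorphic_on_powi[of X UNIV n] by (simp add: mero_def)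
qed

lemma mero_linear: "mero (\<lambda>z. z - a)"
proof -
  have "eventually (\<lambda>z::complex. z - a \<noteq> 0) (cosparse UNIV)"
    using eventually_not_in_cosparse[of "{a}" UNIV] by simp
  thus ?thesis unfolding mero_def by (auto intro: meromorphic_intros)
qed

lemma ord_mult: "mero X \<Longrightarrow> mero Y \<Longrightarrow> zorder (\<lambda>z. X z * Y z) z = zorder X z + zorder Y z"
  by (intro zorder_mult mero_at)

lemma ord_divide: "mero X \<Longrightarrow> mero Y \<Longrightarrow> zorder (\<lambda>z. X z / Y z) z = zorder X z - zorder Y z"
  by (intro zorder_divide mero_at)

lemma ord_power: "mero X \<Longrightarrow> zorder (\<lambda>z. X z ^ n) z = n * zorder X z"
  by (intro zorder_power mero_at)

lemma ord_prod:
  assumes "finite A" "\<And>a. a \<in> A \<Longrightarrow> mero (X a)"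
  shows "zorder (\<lambda>z. \<Prod>a\<in>A. X a z) z = (\<Sum>a\<in>A. zorder (X a) z)"
  by (rule zorder_prod) (use mero_at(1) mero_at(2)[OF mero_prod[OF assms]] assms in auto)

lemma ord_eq_0:
  assumes "X analytic_on {z}" "X z \<noteq> 0" shows "zorder X z = 0"
  using assms by (rule zorder_eq_0I)

lemma ord_nonneg: "mero X \<Longrightarrow> X analytic_on {z} \<Longrightarrow> zorder X z \<ge> 0"
  by (intro zorder_ge_0 mero_at)

lemma ord_pos: "mero X \<Longrightarrow> X analytic_on {z} \<Longrightarrow> X z = 0 \<Longrightarrow> zorder X z > 0"
  using zorder_pos_iff'[of X z] mero_at(3)[of X z] by simp

lemma ord_linear_powi: "zorder (\<lambda>z. (z - a) powi k) z = (if z = a then k else 0)"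
proof (cases "z = a")
  case True thus ?thesis using zorder_eqI[of UNIV z "\<lambda>_. 1" "\<lambda>z. (z - a) powi k" k] by simp
next
  case False
  hence "(\<lambda>z. (z - a) powi k) analytic_on {z}" by (intro analytic_intros) auto
  thus ?thesis using False ord_eq_0[of "\<lambda>z. (z - a) powi k" z] by simp
qed

lemma nonregular_sparse:
  assumes "mero X" shows "{z. \<not> (X analytic_on {z} \<and> X z \<noteq> 0)} sparse_in UNIV"
proof -
  have "eventually (\<lambda>z. X analytic_on {z} \<and> X z \<noteq> 0) (cosparse UNIV)"
    using assms meromorphic_on_imp_analytic_cosparse[of X UNIV] unfolding mero_def
    by (auto intro: eventually_conj)
  thus ?thesis by (simp only: eventually_cosparse)
qed

lemma countable_bad_radii: "mero X \<Longrightarrow> countable {r. \<not> good X r}"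
proof -
  assume X: "mero X"
  have "countable {z. \<not> (X analytic_on {z} \<and> X z \<noteq> 0)}"
    using sparse_imp_countable[OF open_UNIV nonregular_sparse[OF X]] by simp
  hence "countable (norm ` {z. \<not> (X analytic_on {z} \<and> X z \<noteq> 0)})" by (rule countable_image)
  moreover have "{r. \<not> good X r} \<subseteq> norm ` {z. \<not> (X analytic_on {z} \<and> X z \<noteq> 0)}"
    by (auto simp: good_def)
  ultimately show ?thesis by (rule countable_subset[rotated])
qed

lemma exists_good_radius:
  assumes "mero X" "countable U" "a < b" shows "\<exists>r. a < r \<and> r < b \<and> good X r \<and> r \<notin> U"
proof (rule ccontr)
  assume "\<not> ?thesis"
  hence "{a<..<b} \<subseteq> {r. \<not> good X r} \<union> U" by auto
  hence "countable {a<..<b}" using countable_Un[OF countable_bad_radii[OF assms(1)] assms(2)] countable_subset by blast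
  thus False using assms(3) uncountable_open_interval by blast
qed

lemma finite_ord_support:
  assumes "mero X" shows "finite {z \<in> ball 0 r. zorder X z \<noteq> 0}"
proof -
  have "finite (cball 0 r \<inter> {z. \<not> (X analytic_on {z} \<and> X z \<noteq> 0)})"
    by (rule sparse_in_compact_finite[OF sparse_in_subset[OF nonregular_sparse[OF assms]]]) auto
  thus ?thesis by (rule finite_subset[rotated]) (auto dest: ord_eq_0)
qed

lemma good_continuous:
  assumes "good X r"
  shows "continuous_on (sphere 0 r) X"
proof -
  have "X analytic_on sphere 0 r" using assms unfolding good_def
    by (subst analytic_on_analytic_at) auto
  thus ?thesis using analytic_imp_holomorphic holomorphic_on_imp_continuous_on by blast
qed

lemma good_nz: "good X r \<Longrightarrow> norm z = r \<Longrightarrow> X z \<noteq> 0" by (simp add: good_def)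

lemma good_ln_continuous:
  assumes "good X r" shows "continuous_on (sphere 0 r) (\<lambda>z. ln (norm (X z)))"
  using good_continuous[OF assms] good_nz[OF assms] by (intro continuous_intros) auto

lemma remove_sings_ord_0:
  assumes "mero g" "zorder g z = 0"
  shows "remove_sings g analytic_on {z}" "remove_sings g z \<noteq> 0"
proof -
  have iso: "isolated_singularity_at g z" and ne: "not_essential g z"
    using mero_at(1)[OF assms(1)] by (auto simp: meromorphic_at_iff)
  obtain h r where h: "h z \<noteq> 0" "r > 0" "h holomorphic_on cball z r"
    "\<And>w. w \<in> cball z r - {z} \<Longrightarrow> g w = h w * (w - z) powi 0"
    using zorder_exist[OF iso ne mero_at(3)[OF assms(1)]] assms(2) by metis
  have "h \<midarrow>z\<rightarrow> h z"
  proof -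
    have "h holomorphic_on ball z r" using h(3) by (rule holomorphic_on_subset) auto
    hence "continuous_on (ball z r) h" by (rule holomorphic_on_imp_continuous_on)
    moreover have "z \<in> ball z r" using h(2) by simp
    ultimately have "isCont h z" using continuous_on_eq_continuous_at[OF open_ball] by blast
    thus ?thesis by (rule isContD)
  qed
  have "eventually (\<lambda>w. w \<in> ball z r - {z}) (at z)"
    using h(2) by (intro eventually_at_in_open) auto
  hence "eventually (\<lambda>w. h w = g w) (at z)" by eventually_elim (use h(4) in auto)
  with \<open>h \<midarrow>z\<rightarrow> h z\<close> have lim: "g \<midarrow>z\<rightarrow> h z" by (rule Lim_transform_eventually)
  show "remove_sings g analytic_on {z}" using remove_sings_analytic_at[OF iso lim] .
  show "remove_sings g z \<noteq> 0" using remove_sings_eqI[OF lim] h(1) by simp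
qed

text \<open>
  Dividing by the product of the linear factors leaves a function of order \<open>0\<close> everywhere, whose
  removable singularities are then removed; hence the hypotheses in the last conclusion.
\<close>
lemma meromorphic_factorization:
  assumes X: "mero X" and R: "R > 0" "good X R"
  defines "D \<equiv> {z \<in> ball 0 R. zorder X z \<noteq> 0}"
  obtains e where "e analytic_on cball 0 R" "\<And>z. norm z \<le> R \<Longrightarrow> e z \<noteq> 0"
    "\<And>z. norm z \<le> R \<Longrightarrow> X analytic_on {z} \<Longrightarrow> X z \<noteq> 0 \<Longrightarrow> X z = e z * (\<Prod>a\<in>D. (z - a) powi zorder X a)"
proof -
  have D: "finite D" unfolding D_def by (rule finite_ord_support[OF X])
  define p where "p z = (\<Prod>a\<in>D. (z - a) powi zorder X a)" for z
  have mp: "mero p" unfolding p_def by (intro mero_prod D mero_powi mero_linear)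
  have op: "zorder p z = (if z \<in> D then zorder X z else 0)" for z
    unfolding p_def by (subst ord_prod) (auto intro!: D mero_powi mero_linear simp: ord_linear_powi D)
  define g where "g z = X z / p z" for z
  have mg: "mero g" unfolding g_def by (intro mero_divide X mp)
  have og: "zorder g z = 0" if "norm z \<le> R" for z
  proof -
    have "zorder g z = zorder X z - zorder p z" unfolding g_def by (rule ord_divide[OF X mp])
    moreover have "zorder X z = 0" if "z \<notin> D"
    proof (cases "norm z = R")
      case True thus ?thesis using R(2) by (auto simp: good_def intro: ord_eq_0)
    next
      case False thus ?thesis using that \<open>norm z \<le> R\<close> by (auto simp: D_def)
    qed
    ultimately show ?thesis by (simp add: op)
  qed
  show thesis
  proof (rule that[of "remove_sings g"])
    show "remove_sings g analytic_on cball 0 R"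
      by (subst analytic_on_analytic_at) (use remove_sings_ord_0[OF mg] og in auto)
    show "remove_sings g z \<noteq> 0" if "norm z \<le> R" for z using remove_sings_ord_0[OF mg og[OF that]] by simp
    fix z assume z: "norm z \<le> R" "X analytic_on {z}" "X z \<noteq> 0"
    have "z \<notin> D" using ord_eq_0[OF z(2,3)] by (auto simp: D_def)
    hence zD: "z - a \<noteq> 0" if "a \<in> D" for a using that by auto
    have "p analytic_on {z}" unfolding p_def using zD by (intro analytic_intros) auto
    moreover have "p z \<noteq> 0" unfolding p_def using zD D by auto
    ultimately have "g analytic_on {z}" unfolding g_def using z by (intro analytic_intros) auto
    hence "remove_sings g z = g z" by simp
    thus "X z = remove_sings g z * (\<Prod>a\<in>D. (z - a) powi zorder X a)"
      using \<open>p z \<noteq> 0\<close> by (simp add: g_def p_def)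
  qed
qed

text \<open>
  Divisors with real multiplicities: the combinations needed below have coefficients such as \<open>1/2\<close> and
  \<open>\<kappa>\<close>.
\<close>
definition locfin :: "(complex \<Rightarrow> real) \<Rightarrow> bool" where
  "locfin k \<longleftrightarrow> (\<forall>r. finite {z \<in> ball 0 r. k z \<noteq> 0})"

text \<open>
  The integrated counting function of a divisor. The weight \<open>ln (r / max 1 (norm z))\<close> in place of
  \<open>ln (r / norm z)\<close> avoids the singularity at \<open>0\<close>; the difference is the same for all \<open>r \<ge> 1\<close> and
  is absorbed into the constant of Jensen's formula.
\<close>
definition Ncount :: "(complex \<Rightarrow> real) \<Rightarrow> real \<Rightarrow> real" where
  "Ncount k r = (\<Sum>z\<in>{z \<in> ball 0 r. k z \<noteq> 0}. k z * ln (r / max 1 (norm z)))"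

lemma locfin_ord: "mero X \<Longrightarrow> locfin (ord X)"
  unfolding locfin_def using finite_ord_support by simp

lemma locfin_add: "locfin k \<Longrightarrow> locfin l \<Longrightarrow> locfin (\<lambda>z. k z + l z)"
  unfolding locfin_def
proof
  fix r assume a: "\<forall>r. finite {z \<in> ball 0 r. k z \<noteq> 0}" "\<forall>r. finite {z \<in> ball 0 r. l z \<noteq> 0}"
  show "finite {z \<in> ball 0 r. k z + l z \<noteq> 0}"
    by (rule finite_subset[of _ "{z \<in> ball 0 r. k z \<noteq> 0} \<union> {z \<in> ball 0 r. l z \<noteq> 0}"]) (use a in auto)
qed

lemma locfin_comp: "locfin k \<Longrightarrow> h 0 = 0 \<Longrightarrow> locfin (\<lambda>z. h (k z))"
  unfolding locfin_def
proof
  fix r assume a: "\<forall>r. finite {z \<in> ball 0 r. k z \<noteq> 0}" "h 0 = 0"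
  show "finite {z \<in> ball 0 r. h (k z) \<noteq> 0}"
    by (rule finite_subset[of _ "{z \<in> ball 0 r. k z \<noteq> 0}"]) (use a in auto)
qed

lemma locfin_cmult: "locfin k \<Longrightarrow> locfin (\<lambda>z. c * k z)"
  by (rule locfin_comp) auto

lemma locfin_finite: "finite {z. k z \<noteq> 0} \<Longrightarrow> locfin k"
  unfolding locfin_def by (metis (no_types, lifting) Collect_mono_iff finite_subset)

lemma Ncount_eq:
  assumes "finite A" "{z \<in> ball 0 r. k z \<noteq> 0} \<subseteq> A" "A \<subseteq> ball 0 r"
  shows "Ncount k r = (\<Sum>z\<in>A. k z * ln (r / max 1 (norm z)))"
  unfolding Ncount_def by (rule sum.mono_neutral_left) (use assms in auto)

lemma Ncount_add:
  assumes "locfin k" "locfin l"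
  shows "Ncount (\<lambda>z. k z + l z) r = Ncount k r + Ncount l r"
proof -
  define A where "A = {z \<in> ball 0 r. k z \<noteq> 0} \<union> {z \<in> ball 0 r. l z \<noteq> 0}"
  have A: "finite A" "A \<subseteq> ball 0 r" using assms by (auto simp: A_def locfin_def)
  show ?thesis
    by (subst (1 2 3) Ncount_eq[OF A(1)]) (use A in \<open>auto simp: A_def sum.distrib[symmetric] algebra_simps\<close>)
qed

lemma Ncount_cmult: "Ncount (\<lambda>z. c * k z) r = c * Ncount k r"
proof (cases "c = 0")
  case False thus ?thesis by (simp add: Ncount_def sum_distrib_left mult.assoc)
qed (simp add: Ncount_def)

lemma ln_weight_nonneg: "norm z < r \<Longrightarrow> r \<ge> 1 \<Longrightarrow> ln (r / max 1 (norm z)) \<ge> 0"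
  by (intro ln_ge_zero) (auto simp: le_divide_eq)

lemma Ncount_mono:
  assumes "locfin k" "locfin l" "\<And>z. k z \<le> l z" "r \<ge> 1"
  shows "Ncount k r \<le> Ncount l r"
proof -
  define A where "A = {z \<in> ball 0 r. k z \<noteq> 0} \<union> {z \<in> ball 0 r. l z \<noteq> 0}"
  have A: "finite A" "A \<subseteq> ball 0 r" using assms by (auto simp: A_def locfin_def)
  show ?thesis
    by (subst (1 2) Ncount_eq[OF A(1)])
      (use A assms in \<open>auto simp: A_def intro!: sum_mono mult_right_mono ln_weight_nonneg\<close>)
qed

lemma Ncount_finite_le:
  assumes "finite {z. k z \<noteq> 0}"
  shows "\<exists>C\<ge>0. \<forall>r\<ge>1. Ncount k r \<le> C * ln r"
proof (intro exI[of _ "\<Sum>z\<in>{z. k z \<noteq> 0}. \<bar>k z\<bar>"] conjI allI impI sum_nonneg)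
  fix r :: real assume r: "r \<ge> 1"
  have "Ncount k r \<le> (\<Sum>z\<in>{z \<in> ball 0 r. k z \<noteq> 0}. \<bar>k z\<bar> * ln r)"
    unfolding Ncount_def
  proof (rule sum_mono)
    fix z assume z: "z \<in> {z \<in> ball 0 r. k z \<noteq> 0}"
    have w: "0 \<le> ln (r / max 1 (norm z))" using z r by (intro ln_weight_nonneg) auto
    have "r / max 1 (norm z) \<le> r" using r by (simp add: divide_le_eq)
    hence "ln (r / max 1 (norm z)) \<le> ln r" using r by (intro ln_mono) auto
    thus "k z * ln (r / max 1 (norm z)) \<le> \<bar>k z\<bar> * ln r"
      using w by (intro mult_mono) auto
  qed
  also have "\<dots> \<le> (\<Sum>z\<in>{z. k z \<noteq> 0}. \<bar>k z\<bar> * ln r)"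
    using assms r by (intro sum_mono2) auto
  finally show "Ncount k r \<le> (\<Sum>z\<in>{z. k z \<noteq> 0}. \<bar>k z\<bar>) * ln r" by (simp add: sum_distrib_right)
qed auto

lemma ln_norm_factored:
  assumes "finite D" "\<And>a. a \<in> D \<Longrightarrow> z \<noteq> a" "(w::complex) \<noteq> 0"
  shows "ln (norm (w * (\<Prod>a\<in>D. (z - a) powi k a))) = ln (norm w) + (\<Sum>a\<in>D. real_of_int (k a) * ln (norm (z - a)))"
proof -
  have pn: "(\<Prod>a\<in>D. norm (z - a) powi k a) \<noteq> 0" using assms by auto
  have "norm (w * (\<Prod>a\<in>D. (z - a) powi k a)) = norm w * (\<Prod>a\<in>D. norm (z - a) powi k a)"
    by (simp add: norm_mult prod_norm[symmetric] norm_power_int)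
  also have "ln \<dots> = ln (norm w) + (\<Sum>a\<in>D. ln (norm (z - a) powi k a))"
    using pn assms by (simp add: ln_mult ln_prod)
  also have "(\<Sum>a\<in>D. ln (norm (z - a) powi k a)) = (\<Sum>a\<in>D. real_of_int (k a) * ln (norm (z - a)))"
  proof (rule sum.cong)
    fix a assume a: "a \<in> D"
    have "norm (z - a) powi k a = norm (z - a) powr k a" using assms(2)[OF a] by (intro powr_real_of_int'[symmetric]) auto
    thus "ln (norm (z - a) powi k a) = real_of_int (k a) * ln (norm (z - a))"
      using assms(2)[OF a] by (simp add: ln_powr)
  qed simp
  finally show ?thesis .
qed

text \<open>
  Jensen's formula on a fixed disc: the mean of \<open>ln (norm (z - a))\<close> over the circle of radius \<open>r\<close> is
  \<open>ln (max r (norm a))\<close>, and the zero-free factor contributes a constant.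
\<close>
lemma cmean_ln_meromorphic:
  assumes X: "mero X" and R: "good X R" "0 < r" "r \<le> R" "good X r"
  obtains c where "\<And>r. 0 < r \<Longrightarrow> r \<le> R \<Longrightarrow> good X r \<Longrightarrow>
    cmean r (\<lambda>z. ln (norm (X z))) = c + (\<Sum>a\<in>{z \<in> ball 0 R. zorder X z \<noteq> 0}. ord X a * ln (max r (norm a)))"
proof -
  define D where "D = {z \<in> ball 0 R. zorder X z \<noteq> 0}"
  have D: "finite D" unfolding D_def by (rule finite_ord_support[OF X])
  have R0: "R > 0" using R by simp
  obtain e where e: "e analytic_on cball 0 R" "\<And>z. norm z \<le> R \<Longrightarrow> e z \<noteq> 0"
    "\<And>z. norm z \<le> R \<Longrightarrow> X analytic_on {z} \<Longrightarrow> X z \<noteq> 0 \<Longrightarrow> X z = e z * (\<Prod>a\<in>D. (z - a) powi zorder X a)"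
    using meromorphic_factorization[OF X R0 R(1), folded D_def] by blast
  show thesis
  proof (rule that[of "ln (norm (e 0))"], fold D_def)
    fix r assume r: "0 < r" "r \<le> R" "good X r"
    have Dr: "norm a \<noteq> r" if "a \<in> D" for a
      using that r(3) by (auto simp: D_def good_def dest!: ord_eq_0)
    have er: "e analytic_on cball 0 r" using e(1) by (rule analytic_on_subset) (use r in auto)
    have ce: "continuous_on (sphere 0 r) (\<lambda>z. ln (norm (e z)))"
      by (rule good_ln_continuous) (use er e(2) r in \<open>auto simp: good_def elim!: analytic_on_subset\<close>)
    have cl: "continuous_on (sphere 0 r) (\<lambda>z. ln (norm (z - a)))" if "a \<in> D" for a
      by (intro continuous_intros) (use Dr[OF that] in auto)
    have "cmean r (\<lambda>z. ln (norm (X z))) = cmean r (\<lambda>z. ln (norm (e z)) + (\<Sum>a\<in>D. ord X a * ln (norm (z - a))))"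
    proof (rule cmean_cong)
      fix z :: complex assume z: "norm z = r"
      have "X z = e z * (\<Prod>a\<in>D. (z - a) powi zorder X a)" using z r by (intro e(3)) (auto simp: good_def)
      thus "ln (norm (X z)) = ln (norm (e z)) + (\<Sum>a\<in>D. ord X a * ln (norm (z - a)))"
        using ln_norm_factored[OF D, of z "e z"] Dr z e(2)[of z] r by auto
    qed (use r in auto)
    also have "\<dots> = cmean r (\<lambda>z. ln (norm (e z))) + (\<Sum>a\<in>D. ord X a * cmean r (\<lambda>z. ln (norm (z - a))))"
    proof -
      have cc: "continuous_on (sphere 0 r) (\<lambda>z. ord X a * ln (norm (z - a)))" if "a \<in> D" for a
        by (rule continuous_on_mult[OF continuous_on_const cl[OF that]])
      show ?thesis
        using r cc by (subst cmean_add[OF ce continuous_on_sum[OF cc]])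
          (simp_all add: cmean_sum[OF cc _ D] cmean_cmult)
    qed
    also have "cmean r (\<lambda>z. ln (norm (e z))) = ln (norm (e 0))"
      using r by (intro cmean_ln_nonzero er e(2)) auto
    also have "(\<Sum>a\<in>D. ord X a * cmean r (\<lambda>z. ln (norm (z - a)))) = (\<Sum>a\<in>D. ord X a * ln (max r (norm a)))"
      using Dr r by (intro sum.cong) (auto simp: cmean_ln_linear)
    finally show "cmean r (\<lambda>z. ln (norm (X z))) = ln (norm (e 0)) + (\<Sum>a\<in>D. ord X a * ln (max r (norm a)))" .
  qed
qed

text \<open>
  One constant serves all radii: any two radii lie in a common disc, on which the previous formula has a
  single constant.
\<close>
theorem jensen:
  assumes X: "mero X"
  obtains C where "\<And>r. r \<ge> 1 \<Longrightarrow> good X r \<Longrightarrow> cmean r (\<lambda>z. ln (norm (X z))) = C + Ncount (ord X) r"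
proof -
  have key: "cmean r (\<lambda>z. ln (norm (X z))) - Ncount (ord X) r = cmean R (\<lambda>z. ln (norm (X z))) - Ncount (ord X) R"
    if r: "1 \<le> r" "r \<le> R" "good X r" "good X R" for r R
  proof -
    define D where "D = {z \<in> ball 0 R. zorder X z \<noteq> 0}"
    have D: "finite D" unfolding D_def by (rule finite_ord_support[OF X])
    have R0: "0 < R" using r by simp
    obtain c where c: "\<And>r. 0 < r \<Longrightarrow> r \<le> R \<Longrightarrow> good X r \<Longrightarrow>
      cmean r (\<lambda>z. ln (norm (X z))) = c + (\<Sum>a\<in>D. ord X a * ln (max r (norm a)))"
      using cmean_ln_meromorphic[OF X r(4) R0 order_refl r(4), folded D_def] by blast
    have "cmean s (\<lambda>z. ln (norm (X z))) - Ncount (ord X) s = c + (\<Sum>a\<in>D. ord X a * ln (max 1 (norm a)))"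
      if s: "1 \<le> s" "s \<le> R" "good X s" for s
    proof -
      have "Ncount (ord X) s = (\<Sum>a\<in>{z \<in> ball 0 s. zorder X z \<noteq> 0}. ord X a * (ln (max s (norm a)) - ln (max 1 (norm a))))"
        unfolding Ncount_def using s by (intro sum.cong) (auto simp: max_def ln_div)
      also have "\<dots> = (\<Sum>a\<in>D. ord X a * (ln (max s (norm a)) - ln (max 1 (norm a))))"
        by (rule sum.mono_neutral_left[OF D]) (use s in \<open>auto simp: D_def max_def\<close>)
      finally show ?thesis using c[of s] s by (simp add: sum_subtractf right_diff_distrib)
    qed
    from this[OF r(1-3)] this[OF _ order_refl r(4)] show ?thesis using r by linarith
  qed
  obtain r0 where r0: "1 < r0" "good X r0" using exists_good_radius[OF X, of "{}" 1 2] by auto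
  show thesis
  proof (rule that[of "cmean r0 (\<lambda>z. ln (norm (X z))) - Ncount (ord X) r0"])
    fix r :: real assume r: "1 \<le> r" "good X r"
    have "cmean r (\<lambda>z. ln (norm (X z))) - Ncount (ord X) r = cmean r0 (\<lambda>z. ln (norm (X z))) - Ncount (ord X) r0"
    proof (cases "r \<le> r0")
      case True
      show ?thesis by (rule key[OF r(1) True r(2) r0(2)])
    next
      case False
      hence "1 \<le> r0" "r0 \<le> r" using r0 by auto
      from key[OF this r0(2) r(2)] show ?thesis by (rule sym)
    qed
    thus "cmean r (\<lambda>z. ln (norm (X z))) = cmean r0 (\<lambda>z. ln (norm (X z))) - Ncount (ord X) r0 + Ncount (ord X) r"
      by linarith
  qed
qed

section \<open>The logarithmic derivative on a circle\<close>

definition prox :: "real \<Rightarrow> (complex \<Rightarrow> complex) \<Rightarrow> real" where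
  "prox r X = cmean r (\<lambda>z. ln (max 1 (norm (X z))))"

lemma continuous_lnmax:
  "continuous_on S u \<Longrightarrow> continuous_on S (\<lambda>z. ln (max 1 (u z :: real)))"
  by (rule continuous_on_ln) (auto intro!: continuous_intros)

lemma good_lnmax_continuous:
  "good X r \<Longrightarrow> continuous_on (sphere 0 r) (\<lambda>z. ln (max 1 (norm (X z))))"
  by (intro continuous_lnmax continuous_on_norm good_continuous)

lemma cmean_ln_le_prox:
  assumes "good X r" "r \<ge> 0" shows "cmean r (\<lambda>z. ln (norm (X z))) \<le> prox r X"
  unfolding prox_def
proof (rule cmean_mono)
  fix z :: complex assume "norm z = r"
  thus "ln (norm (X z)) \<le> ln (max 1 (norm (X z)))" using good_nz[OF assms(1)] by (intro ln_mono) auto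
qed (use assms in \<open>auto intro: good_lnmax_continuous good_ln_continuous\<close>)

text \<open>
  \<open>\<bar>ln x\<bar> = 2 * ln (max 1 x) - ln x\<close>.
\<close>
lemma cmean_abs_ln:
  assumes "good X r" "r \<ge> 0"
  shows "cmean r (\<lambda>z. \<bar>ln (norm (X z))\<bar>) = 2 * prox r X - cmean r (\<lambda>z. ln (norm (X z)))"
proof -
  have "cmean r (\<lambda>z. \<bar>ln (norm (X z))\<bar>) = cmean r (\<lambda>z. 2 * ln (max 1 (norm (X z))) + (-1) * ln (norm (X z)))"
  proof (rule cmean_cong)
    fix z :: complex assume "norm z = r"
    hence "X z \<noteq> 0" using good_nz[OF assms(1)] by blast
    thus "\<bar>ln (norm (X z))\<bar> = 2 * ln (max 1 (norm (X z))) + (-1) * ln (norm (X z))"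
      by (cases "norm (X z) \<ge> 1") (auto simp: max_def abs_if)
  qed fact
  also have "\<dots> = cmean r (\<lambda>z. 2 * ln (max 1 (norm (X z)))) + cmean r (\<lambda>z. (-1) * ln (norm (X z)))"
    by (rule cmean_add)
      (auto intro!: continuous_on_mult[OF continuous_on_const] good_lnmax_continuous good_ln_continuous
        continuous_on_minus assms)
  finally show ?thesis by (simp only: cmean_cmult prox_def)
qed

lemma cmean_abs_ln_linear:
  assumes "norm a < R" "R \<ge> 1"
  shows "cmean R (\<lambda>z. \<bar>ln (norm (z - a))\<bar>) \<le> 2 * ln (2 * R)"
proof -
  have g: "good (\<lambda>z. z - a) R" using assms unfolding good_def by (auto intro!: analytic_intros)
  have "prox R (\<lambda>z. z - a) \<le> ln (2 * R)"
    unfolding prox_def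
  proof (rule cmean_bounds[OF good_lnmax_continuous[OF g]])
    fix z :: complex assume "norm z = R"
    hence "norm (z - a) \<le> 2 * R" using norm_triangle_ineq4[of z a] assms by linarith
    thus "ln (max 1 (norm (z - a))) \<le> ln (2 * R)" using assms by (intro ln_mono) auto
  qed (use assms in auto)
  moreover have "cmean R (\<lambda>z. ln (norm (z - a))) = ln R" using cmean_ln_linear[of a R] assms by simp
  moreover have "ln R \<ge> 0" using assms by simp
  moreover have "cmean R (\<lambda>z. \<bar>ln (norm (z - a))\<bar>) = 2 * prox R (\<lambda>z. z - a) - cmean R (\<lambda>z. ln (norm (z - a)))"
    using cmean_abs_ln[OF g] assms by simp
  ultimately show ?thesis by linarith
qed

text \<open>
  Write \<open>X = exp E * \<Prod>(z - a)^k\<close> on the disc of radius \<open>R\<close>. The product contributes the sum over \<open>D\<close>, and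
  \<open>E'\<close> is bounded by the mean of the absolute value of \<open>Re E = ln (norm X) - \<Sum> k ln (norm (z - a))\<close>.
\<close>
lemma log_deriv_pointwise:
  assumes X: "mero X" and R: "good X R" "R \<ge> 1" and z: "norm z < R" "X analytic_on {z}" "X z \<noteq> 0"
  defines "D \<equiv> {z \<in> ball 0 R. zorder X z \<noteq> 0}"
  defines "\<nu> \<equiv> (\<Sum>a\<in>D. \<bar>ord X a\<bar>)"
  shows "norm (deriv X z / X z) \<le> (\<Sum>a\<in>D. \<bar>ord X a\<bar> / norm (z - a))
    + 2 * R / (R - norm z)^2 * (cmean R (\<lambda>w. \<bar>ln (norm (X w))\<bar>) + \<nu> * (2 * ln (2 * R)))"
proof -
  have D: "finite D" unfolding D_def by (rule finite_ord_support[OF X])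
  have R0: "R > 0" using R by simp
  obtain e where e: "e analytic_on cball 0 R" "\<And>z. norm z \<le> R \<Longrightarrow> e z \<noteq> 0"
    "\<And>z. norm z \<le> R \<Longrightarrow> X analytic_on {z} \<Longrightarrow> X z \<noteq> 0 \<Longrightarrow> X z = e z * (\<Prod>a\<in>D. (z - a) powi zorder X a)"
    using meromorphic_factorization[OF X R0 R(1), folded D_def] by blast
  obtain E where E: "E analytic_on cball 0 R" "\<And>z. norm z \<le> R \<Longrightarrow> e z = exp (E z)"
    "\<And>z. norm z \<le> R \<Longrightarrow> deriv E z = deriv e z / e z"
    using analytic_nonzero_log[OF e(1) e(2) R0] by blast
  have zD: "z \<noteq> a" if "a \<in> D" for a
    using that ord_eq_0[OF z(2,3)] by (auto simp: D_def)
  define p where "p w = (\<Prod>a\<in>D. (w - a) powi zorder X a)" for w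
  have "eventually (\<lambda>w. X analytic_on {w}) (nhds z)"
  proof -
    obtain A where A: "open A" "z \<in> A" "X holomorphic_on A" using z(2) by (auto simp: analytic_at)
    have "eventually (\<lambda>w. w \<in> A) (nhds z)" by (rule eventually_nhds_in_open[OF A(1,2)])
    thus ?thesis by eventually_elim (use A in \<open>auto simp: analytic_at\<close>)
  qed
  moreover have "eventually (\<lambda>w. X w \<noteq> 0) (nhds z)"
    using analytic_at_imp_isCont[OF z(2)] z(3)
    by (simp add: continuous_within tendsto_imp_eventually_ne eventually_nhds_conv_at)
  moreover have "eventually (\<lambda>w. w \<in> ball 0 R) (nhds z)" using z(1) by (intro eventually_nhds_in_open) auto
  ultimately have ev: "eventually (\<lambda>w. X w = e w * p w) (nhds z)"
    by eventually_elim (use e(3) in \<open>auto simp: p_def\<close>)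
  have ez: "e field_differentiable (at z)"
    using analytic_on_imp_differentiable_at[OF e(1)] z(1) by auto
  have der_p: "(p has_field_derivative p z * (\<Sum>a\<in>D. ord X a / (z - a))) (at z)"
  proof -
    have "((\<lambda>w. \<Prod>a\<in>D. (w - a) powi zorder X a) has_field_derivative
        (\<Sum>a\<in>D. (of_int (zorder X a) * (z - a) powi (zorder X a - 1)) * (\<Prod>b\<in>D - {a}. (z - b) powi zorder X b))) (at z)"
      by (rule has_field_derivative_prod) (use zD in \<open>auto intro!: derivative_eq_intros\<close>)
    also have "(\<Sum>a\<in>D. (of_int (zorder X a) * (z - a) powi (zorder X a - 1)) * (\<Prod>b\<in>D - {a}. (z - b) powi zorder X b))
       = p z * (\<Sum>a\<in>D. ord X a / (z - a))"
      unfolding sum_distrib_left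
    proof (rule sum.cong)
      fix a assume a: "a \<in> D"
      have za: "z - a \<noteq> 0" using zD[OF a] by simp
      have "p z = (z - a) powi zorder X a * (\<Prod>b\<in>D - {a}. (z - b) powi zorder X b)"
        unfolding p_def by (rule prod.remove[OF D a])
      moreover have "(z - a) powi (zorder X a - 1) = (z - a) powi zorder X a / (z - a)"
        using za by (simp add: power_int_diff)
      ultimately show "(of_int (zorder X a) * (z - a) powi (zorder X a - 1)) * (\<Prod>b\<in>D - {a}. (z - b) powi zorder X b)
         = p z * (ord X a / (z - a))" by simp
    qed simp
    finally show ?thesis by (simp add: p_def[abs_def])
  qed
  have pz: "p z \<noteq> 0" unfolding p_def using zD D by auto
  have "((\<lambda>w. e w * p w) has_field_derivative (deriv e z * p z + p z * (\<Sum>a\<in>D. ord X a / (z - a)) * e z)) (at z)"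
    by (rule DERIV_mult'[OF _ der_p, THEN DERIV_cong]) (use ez in \<open>auto simp: field_differentiable_derivI algebra_simps DERIV_deriv_iff_field_differentiable\<close>)
  hence "deriv X z = deriv e z * p z + p z * (\<Sum>a\<in>D. ord X a / (z - a)) * e z"
    using deriv_cong_ev[OF ev refl] by (simp add: DERIV_imp_deriv)
  moreover have "X z = e z * p z" using ev by (rule eventually_nhds_x_imp_x)
  moreover have "e z \<noteq> 0" using e(2) z(1) by auto
  ultimately have "deriv X z / X z = deriv E z + (\<Sum>a\<in>D. ord X a / (z - a))"
    using pz E(3)[of z] z(1) by (simp add: field_simps)
  hence "norm (deriv X z / X z) \<le> norm (deriv E z) + norm (\<Sum>a\<in>D. complex_of_real (ord X a) / (z - a))"
    by (simp add: norm_triangle_ineq)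
  also have "norm (\<Sum>a\<in>D. complex_of_real (ord X a) / (z - a)) \<le> (\<Sum>a\<in>D. \<bar>ord X a\<bar> / norm (z - a))"
    by (rule norm_sum[THEN order_trans]) (simp add: norm_divide)
  also have "norm (deriv E z) \<le> 2 * R / (R - norm z)^2 * cmean R (\<lambda>w. \<bar>Re (E w)\<bar>)"
    by (rule deriv_bound_by_real_part[OF E(1) z(1)])
  also have "\<dots> \<le> 2 * R / (R - norm z)^2 * (cmean R (\<lambda>w. \<bar>ln (norm (X w))\<bar>) + \<nu> * (2 * ln (2 * R)))"
  proof (rule mult_left_mono)
    have DR: "norm a < R" if "a \<in> D" for a using that by (auto simp: D_def)
    have ca: "continuous_on (sphere 0 R) (\<lambda>w. \<bar>ord X a\<bar> * \<bar>ln (norm (w - a))\<bar>)" if "a \<in> D" for a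
      by (intro continuous_intros) (use DR[OF that] in auto)
    have cX: "continuous_on (sphere 0 R) (\<lambda>w. \<bar>ln (norm (X w))\<bar>)"
      by (intro continuous_intros good_ln_continuous R)
    have "continuous_on (sphere 0 R) E"
      by (rule continuous_on_subset[OF holomorphic_on_imp_continuous_on[OF analytic_imp_holomorphic[OF E(1)]]]) auto
    hence cE: "continuous_on (sphere 0 R) (\<lambda>w. \<bar>Re (E w)\<bar>)" by (intro continuous_intros)
    have "cmean R (\<lambda>w. \<bar>Re (E w)\<bar>) \<le> cmean R (\<lambda>w. \<bar>ln (norm (X w))\<bar> + (\<Sum>a\<in>D. \<bar>ord X a\<bar> * \<bar>ln (norm (w - a))\<bar>))"
    proof (rule cmean_mono)
      fix w :: complex assume w: "norm w = R"
      have "Re (E w) = ln (norm (e w))" using E(2)[of w] w by simp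
      moreover have "X w = e w * (\<Prod>a\<in>D. (w - a) powi zorder X a)"
        using w R(1) by (intro e(3)) (auto simp: good_def)
      moreover have "w \<noteq> a" if "a \<in> D" for a using DR[OF that] w by auto
      ultimately have "Re (E w) = ln (norm (X w)) - (\<Sum>a\<in>D. ord X a * ln (norm (w - a)))"
        using ln_norm_factored[OF D, of w "e w" "zorder X"] e(2)[of w] w by simp
      also have "\<bar>\<dots>\<bar> \<le> \<bar>ln (norm (X w))\<bar> + \<bar>\<Sum>a\<in>D. ord X a * ln (norm (w - a))\<bar>" by (rule abs_triangle_ineq4)
      also have "\<bar>\<Sum>a\<in>D. ord X a * ln (norm (w - a))\<bar> \<le> (\<Sum>a\<in>D. \<bar>ord X a\<bar> * \<bar>ln (norm (w - a))\<bar>)"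
        by (rule sum_abs[THEN order_trans]) (simp add: abs_mult)
      finally show "\<bar>Re (E w)\<bar> \<le> \<bar>ln (norm (X w))\<bar> + (\<Sum>a\<in>D. \<bar>ord X a\<bar> * \<bar>ln (norm (w - a))\<bar>)" by simp
    qed (intro cE continuous_on_add cX continuous_on_sum ca | use R0 in simp)+
    also have "\<dots> = cmean R (\<lambda>w. \<bar>ln (norm (X w))\<bar>) + (\<Sum>a\<in>D. \<bar>ord X a\<bar> * cmean R (\<lambda>w. \<bar>ln (norm (w - a))\<bar>))"
      using R0 by (subst cmean_add[OF cX continuous_on_sum[OF ca]]) (simp_all add: cmean_sum[OF ca _ D] cmean_cmult)
    also have "(\<Sum>a\<in>D. \<bar>ord X a\<bar> * cmean R (\<lambda>w. \<bar>ln (norm (w - a))\<bar>)) \<le> (\<Sum>a\<in>D. \<bar>ord X a\<bar> * (2 * ln (2 * R)))"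
      by (intro sum_mono mult_left_mono cmean_abs_ln_linear DR R) auto
    also have "\<dots> = \<nu> * (2 * ln (2 * R))" by (simp add: \<nu>_def sum_distrib_right)
    finally show "cmean R (\<lambda>w. \<bar>Re (E w)\<bar>) \<le> cmean R (\<lambda>w. \<bar>ln (norm (X w))\<bar>) + \<nu> * (2 * ln (2 * R))" by simp
  qed (use R0 in auto)
  finally show ?thesis by simp
qed

lemma sqrt_sum_le:
  assumes "finite D" "\<And>a. a \<in> D \<Longrightarrow> 0 \<le> f a"
  shows "sqrt (\<Sum>a\<in>D. f a) \<le> (\<Sum>a\<in>D. sqrt (f a))"
  using assms
proof (induction D rule: finite_induct)
  case (insert a D)
  have "sqrt (f a + sum f D) \<le> sqrt (f a) + sqrt (sum f D)"
    using insert.prems by (intro sqrt_add_le_add_sqrt sum_nonneg) auto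
  thus ?case using insert by fastforce
qed simp

lemma sqrt_abs_int_le: "sqrt \<bar>of_int k :: real\<bar> \<le> \<bar>of_int k\<bar>"
proof (cases "k = 0")
  case False
  hence "1 \<le> \<bar>of_int k :: real\<bar>" by linarith
  hence "\<bar>of_int k :: real\<bar> \<le> \<bar>of_int k\<bar> * \<bar>of_int k\<bar>" by (metis mult_le_cancel_right1 abs_ge_zero abs_of_nonneg not_less order_trans zero_le_one)
  thus ?thesis by (intro real_le_lsqrt) (auto simp: power2_eq_square)
qed simp

text \<open>
  The mean of the logarithm is at most twice the logarithm of the mean of the square root
  (\<open>cmean_ln_le\<close>), and the square root of the pointwise bound is at most \<open>sqrt B\<close> plus the sum of the
  \<open>\<bar>k\<bar> / sqrt (norm (z - a))\<close>, each with mean at most \<open>2 \<bar>k\<bar>\<close> whatever the position of \<open>a\<close>.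
\<close>
lemma prox_log_deriv_le:
  assumes X: "mero X" and R: "good X R" "good X r" "1 \<le> r" "r < R"
  defines "D \<equiv> {z \<in> ball 0 R. zorder X z \<noteq> 0}"
  defines "\<nu> \<equiv> (\<Sum>a\<in>D. \<bar>ord X a\<bar>)"
  defines "B \<equiv> 2 * R / (R - r)^2 * (cmean R (\<lambda>w. \<bar>ln (norm (X w))\<bar>) + \<nu> * (2 * ln (2 * R)))"
  shows "B \<ge> 0" "cmean r (\<lambda>z. ln (max 1 (norm (deriv X z / X z)))) \<le> 2 * ln (1 + (sqrt B + 2 * \<nu>))"
proof -
  have D: "finite D" unfolding D_def by (rule finite_ord_support[OF X])
  have \<nu>: "\<nu> \<ge> 0" unfolding \<nu>_def by (intro sum_nonneg) auto
  show B: "B \<ge> 0" unfolding B_def using R \<nu>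
    by (intro mult_nonneg_nonneg add_nonneg_nonneg cmean_nonneg continuous_on_rabs good_ln_continuous) auto
  define u where "u z = sqrt B + (\<Sum>a\<in>D. \<bar>ord X a\<bar> * (1 / sqrt (norm (z - a))))" for z
  have Dr: "norm a \<noteq> r" if "a \<in> D" for a
    using that R(2) by (auto simp: D_def good_def dest!: ord_eq_0)
  have ca: "continuous_on (sphere 0 r) (\<lambda>w. \<bar>ord X a\<bar> * (1 / sqrt (norm (w - a))))" if "a \<in> D" for a
    by (intro continuous_intros) (use Dr[OF that] in auto)
  have cu: "continuous_on (sphere 0 r) u" unfolding u_def
    by (intro continuous_on_add continuous_on_const continuous_on_sum ca)
  have u0: "0 \<le> u z" for z unfolding u_def using B by (intro add_nonneg_nonneg sum_nonneg) auto
  have gd: "(\<lambda>z. deriv X z / X z) analytic_on {z}" if "norm z = r" for z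
    using that R(2) by (intro analytic_intros analytic_deriv) (auto simp: good_def)
  have cont: "continuous_on (sphere 0 r) (\<lambda>z. deriv X z / X z)"
  proof -
    have "(\<lambda>z. deriv X z / X z) analytic_on sphere 0 r" by (subst analytic_on_analytic_at) (use gd in auto)
    thus ?thesis using analytic_imp_holomorphic holomorphic_on_imp_continuous_on by blast
  qed
  have "cmean r (\<lambda>z. ln (max 1 (norm (deriv X z / X z)))) \<le> cmean r (\<lambda>z. 2 * ln (1 + u z))"
  proof (rule cmean_mono)
    fix z :: complex assume z: "norm z = r"
    have "norm (deriv X z / X z) \<le> (\<Sum>a\<in>D. \<bar>ord X a\<bar> / norm (z - a)) + B"
      using log_deriv_pointwise[OF X R(1), of z] z R unfolding B_def \<nu>_def D_def by (auto simp: good_def)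
    hence "sqrt (norm (deriv X z / X z)) \<le> sqrt (B + (\<Sum>a\<in>D. \<bar>ord X a\<bar> / norm (z - a)))" by simp
    also have "\<dots> \<le> sqrt B + sqrt (\<Sum>a\<in>D. \<bar>ord X a\<bar> / norm (z - a))"
      using B by (intro sqrt_add_le_add_sqrt sum_nonneg) auto
    also have "sqrt (\<Sum>a\<in>D. \<bar>ord X a\<bar> / norm (z - a)) \<le> (\<Sum>a\<in>D. sqrt (\<bar>ord X a\<bar> / norm (z - a)))"
      by (intro sqrt_sum_le D) auto
    also have "\<dots> \<le> (\<Sum>a\<in>D. \<bar>ord X a\<bar> * (1 / sqrt (norm (z - a))))"
    proof (rule sum_mono)
      fix a
      have "sqrt \<bar>ord X a\<bar> * (1 / sqrt (norm (z - a))) \<le> \<bar>ord X a\<bar> * (1 / sqrt (norm (z - a)))"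
        by (intro mult_right_mono sqrt_abs_int_le) auto
      thus "sqrt (\<bar>ord X a\<bar> / norm (z - a)) \<le> \<bar>ord X a\<bar> * (1 / sqrt (norm (z - a)))"
        by (simp add: real_sqrt_divide)
    qed
    finally have su: "sqrt (norm (deriv X z / X z)) \<le> u z" by (simp add: u_def)
    define x where "x = norm (deriv X z / X z)"
    have "x = (sqrt x)^2" by (simp add: x_def)
    also have "\<dots> \<le> (1 + u z)^2" using su u0[of z] unfolding x_def by (intro power_mono) auto
    finally have "max 1 x \<le> (1 + u z)^2" using u0[of z] by (simp add: one_le_power)
    hence "ln (max 1 x) \<le> ln ((1 + u z)^2)" by (intro ln_mono) auto
    also have "\<dots> = 2 * ln (1 + u z)" by (simp add: ln_realpow)
    finally show "ln (max 1 (norm (deriv X z / X z))) \<le> 2 * ln (1 + u z)" by (simp add: x_def)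
  next
    show "continuous_on (sphere 0 r) (\<lambda>z. ln (max 1 (norm (deriv X z / X z))))"
      by (intro continuous_lnmax continuous_on_norm cont)
    have "1 + u z \<noteq> 0" for z using u0[of z] by linarith
    thus "continuous_on (sphere 0 r) (\<lambda>z. 2 * ln (1 + u z))"
      by (intro continuous_intros cu) auto
  qed (use R in simp)
  also have "\<dots> = 2 * cmean r (\<lambda>z. ln (1 + u z))" by (rule cmean_cmult)
  also have "cmean r (\<lambda>z. ln (1 + u z)) \<le> ln (1 + cmean r u)"
    using R u0 by (intro cmean_ln_le cu) auto
  also have "ln (1 + cmean r u) \<le> ln (1 + (sqrt B + 2 * \<nu>))"
  proof -
    have "cmean r u = sqrt B + (\<Sum>a\<in>D. \<bar>ord X a\<bar> * cmean r (\<lambda>z. 1 / sqrt (norm (z - a))))"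
      unfolding u_def using R by (subst cmean_add[OF continuous_on_const continuous_on_sum[OF ca]])
        (simp_all add: cmean_sum[OF ca _ D] cmean_cmult cmean_const del: times_divide_eq_right mult_1_right)
    also have "\<dots> \<le> sqrt B + (\<Sum>a\<in>D. \<bar>ord X a\<bar> * 2)"
      using R Dr by (intro add_left_mono sum_mono mult_left_mono cmean_inverse_sqrt_linear) auto
    also have "\<dots> = sqrt B + 2 * \<nu>" by (simp add: \<nu>_def sum_distrib_right[symmetric])
    finally have "cmean r u \<le> sqrt B + 2 * \<nu>" .
    moreover have "cmean r u \<ge> 0" using R u0 by (intro cmean_nonneg cu) auto
    ultimately show ?thesis by (intro ln_mono) auto
  qed
  finally show "cmean r (\<lambda>z. ln (max 1 (norm (deriv X z / X z)))) \<le> 2 * ln (1 + (sqrt B + 2 * \<nu>))" by simp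
qed

lemma Ncount_neg_part:
  assumes X: "mero X" and fin: "finite {z. zorder X z < 0}"
  obtains q where "q \<ge> 0" "\<And>r. r \<ge> 1 \<Longrightarrow> Ncount (\<lambda>z. max 0 (- ord X z)) r \<le> q * ln r"
proof -
  have "{z. max 0 (- ord X z) \<noteq> 0} = {z. zorder X z < 0}" by (auto simp: max_def)
  hence "finite {z. max 0 (- ord X z) \<noteq> 0}" using fin by simp
  from Ncount_finite_le[OF this] show thesis using that by blast
qed

text \<open>
  Two auxiliary radii \<open>r < R < R' < r + \<delta>\<close> turn the previous bound into one in terms of \<open>prox\<close> alone:
  the pointwise estimate is applied on the disc of radius \<open>R\<close>, and the number \<open>\<nu>\<close> of zeros and poles in
  that disc is bounded by Jensen's formula at \<open>R'\<close>, since each of them has weight at least \<open>ln (R' / R)\<close>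
  there. The poles, finite in number, only cost a multiple of \<open>ln r\<close>.
  
  The countable set \<open>U\<close> of radii where nothing is known about \<open>prox\<close> is avoided by the choice of \<open>R\<close> and
  \<open>R'\<close>; it makes the estimate applicable to derivatives.
\<close>
lemma log_derivative_estimate:
  assumes X: "mero X" and fin: "finite {z. zorder X z < 0}" and U: "countable U"
  obtains C where "C \<ge> 0" "\<And>r \<delta> M. 1 \<le> r \<Longrightarrow> 0 < \<delta> \<Longrightarrow> \<delta> \<le> 1 \<Longrightarrow> good X r \<Longrightarrow> 1 \<le> M \<Longrightarrow>
    (\<And>\<rho>. r \<le> \<rho> \<Longrightarrow> \<rho> \<le> r + \<delta> \<Longrightarrow> good X \<rho> \<Longrightarrow> \<rho> \<notin> U \<Longrightarrow> prox \<rho> X \<le> M) \<Longrightarrow>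
    prox r (\<lambda>z. deriv X z / X z) \<le> C * (1 + ln M + ln (r + 2) + ln (1 / \<delta>))"
proof -
  obtain C0 where C0: "\<And>r. r \<ge> 1 \<Longrightarrow> good X r \<Longrightarrow> cmean r (\<lambda>z. ln (norm (X z))) = C0 + Ncount (ord X) r"
    using jensen[OF X] by blast
  define neg where "neg z = max 0 (- ord X z)" for z
  obtain q where q: "q \<ge> 0" "\<And>r. r \<ge> 1 \<Longrightarrow> Ncount neg r \<le> q * ln r"
    using Ncount_neg_part[OF X fin] unfolding neg_def[abs_def] by blast
  have lfo: "locfin (ord X)" by (rule locfin_ord[OF X])
  have lfn: "locfin neg" unfolding neg_def[abs_def] by (rule locfin_comp[OF lfo]) simp
  define c where "c = 2 + \<bar>C0\<bar> + 2 * q"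
  have c: "c \<ge> 2" using q(1) by (simp add: c_def)
  \<comment> \<open>Below, \<open>B \<le> 32 * 33 * c * Z\<close> and \<open>2 * \<nu> \<le> 8 * c * Z\<close>; the remaining \<open>8\<close> is slack.\<close>
  define K where "K = 2 + 1072 * c"
  have K: "K \<ge> 1" using c by (simp add: K_def)
  show thesis
  proof (rule that[of "2 * (ln K + 4)"])
    show "2 * (ln K + 4) \<ge> 0" using K by simp
    fix r \<delta> M :: real
    assume r: "1 \<le> r" and \<delta>: "0 < \<delta>" "\<delta> \<le> 1" and gr: "good X r" and M: "1 \<le> M"
      and bd: "\<And>\<rho>. r \<le> \<rho> \<Longrightarrow> \<rho> \<le> r + \<delta> \<Longrightarrow> good X \<rho> \<Longrightarrow> \<rho> \<notin> U \<Longrightarrow> prox \<rho> X \<le> M"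
    define x where "x = r + 2"
    define y where "y = 1 / \<delta>"
    have x: "x \<ge> 1" using r by (simp add: x_def)
    have y: "y \<ge> 1" using \<delta> by (simp add: y_def)
    obtain R where R: "r + \<delta>/4 < R" "R < r + \<delta>/2" "good X R" "R \<notin> U"
      using exists_good_radius[OF X U, of "r + \<delta>/4" "r + \<delta>/2"] \<delta> by auto
    obtain R' where R': "r + 3*\<delta>/4 < R'" "R' < r + \<delta>" "good X R'" "R' \<notin> U"
      using exists_good_radius[OF X U, of "r + 3*\<delta>/4" "r + \<delta>"] \<delta> by auto
    have Rx: "R \<le> x" "R' \<le> x" "1 \<le> R" "1 \<le> R'" "r < R" using R R' \<delta> r unfolding x_def by linarith+
    have lnx: "ln s \<le> x" if "1 \<le> s" "s \<le> x" for s using ln_bound[of s] that by linarith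
    have pR: "prox R X \<le> M" "prox R' X \<le> M" using R R' \<delta> by (auto intro!: bd)
    define D where "D = {z \<in> ball 0 R. zorder X z \<noteq> 0}"
    have D: "finite D" unfolding D_def by (rule finite_ord_support[OF X])
    define \<nu> where "\<nu> = (\<Sum>a\<in>D. \<bar>ord X a\<bar>)"
    have \<nu>0: "\<nu> \<ge> 0" unfolding \<nu>_def by (intro sum_nonneg) auto
    define A where "A = cmean R (\<lambda>w. \<bar>ln (norm (X w))\<bar>)"
    have "- Ncount neg R \<le> Ncount (ord X) R"
    proof -
      have "Ncount (\<lambda>z. (-1) * neg z) R \<le> Ncount (ord X) R"
        using Rx by (intro Ncount_mono locfin_cmult lfn lfo) (auto simp: neg_def)
      thus ?thesis by (subst (asm) Ncount_cmult) simp
    qed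
    moreover have "Ncount neg R \<le> q * x"
    proof -
      have "Ncount neg R \<le> q * ln R" using q(2) Rx by blast
      also have "\<dots> \<le> q * x" using lnx Rx q(1) by (intro mult_left_mono) auto
      finally show ?thesis .
    qed
    moreover have "A = 2 * prox R X - (C0 + Ncount (ord X) R)"
      unfolding A_def using cmean_abs_ln[OF R(3)] C0[OF _ R(3)] Rx by simp
    ultimately have "A \<le> 2 * M + \<bar>C0\<bar> + q * x" using pR by linarith
    also have "\<dots> \<le> 2 * (M * x) + \<bar>C0\<bar> * (M * x) + q * (M * x)"
    proof -
      have "M \<le> M * x" "1 \<le> M * x" "x \<le> M * x"
        using M x mult_mono[of 1 M 1 x] mult_left_mono[of 1 x M] mult_right_mono[of 1 M x] by auto
      moreover have "\<bar>C0\<bar> * 1 \<le> \<bar>C0\<bar> * (M * x)" using \<open>1 \<le> M * x\<close> by (intro mult_left_mono) auto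
      moreover have "q * x \<le> q * (M * x)" using \<open>x \<le> M * x\<close> q by (intro mult_left_mono) auto
      ultimately show ?thesis by linarith
    qed
    also have "\<dots> \<le> c * (M * x)"
    proof -
      have "0 \<le> q * (M * x)" using q M x by simp
      thus ?thesis unfolding c_def by (simp add: algebra_simps)
    qed
    finally have A: "A \<le> c * (M * x)" .
    have "\<nu> * ln (R' / R) \<le> Ncount (\<lambda>z. ord X z + 2 * neg z) R'"
    proof -
      have abs: "\<bar>ord X z\<bar> = ord X z + 2 * neg z" for z by (auto simp: neg_def)
      have "\<nu> * ln (R' / R) = (\<Sum>a\<in>D. \<bar>ord X a\<bar> * ln (R' / R))" by (simp add: \<nu>_def sum_distrib_right)
      also have "\<dots> \<le> (\<Sum>a\<in>D. \<bar>ord X a\<bar> * ln (R' / max 1 (norm a)))"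
      proof (intro sum_mono mult_left_mono)
        fix a assume "a \<in> D"
        hence "max 1 (norm a) \<le> R" using Rx by (auto simp: D_def)
        hence "R' / R \<le> R' / max 1 (norm a)" using Rx by (intro divide_left_mono) auto
        thus "ln (R' / R) \<le> ln (R' / max 1 (norm a))" using Rx by (intro ln_mono) auto
      qed auto
      also have "\<dots> \<le> (\<Sum>a\<in>{z \<in> ball 0 R'. zorder X z \<noteq> 0}. \<bar>ord X a\<bar> * ln (R' / max 1 (norm a)))"
        using R R' Rx \<delta> by (intro sum_mono2 finite_ord_support X mult_nonneg_nonneg ln_weight_nonneg) (auto simp: D_def)
      also have "\<dots> = Ncount (\<lambda>z. \<bar>ord X z\<bar>) R'" by (simp add: Ncount_def)
      finally show ?thesis by (simp only: abs)
    qed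
    also have "\<dots> = (cmean R' (\<lambda>z. ln (norm (X z))) - C0) + 2 * Ncount neg R'"
      using C0[OF _ R'(3)] Rx by (subst Ncount_add[OF lfo locfin_cmult[OF lfn]]) (simp add: Ncount_cmult)
    also have "\<dots> \<le> M + \<bar>C0\<bar> + 2 * (q * x)"
    proof -
      have "Ncount neg R' \<le> q * ln R'" using q(2) Rx by blast
      also have "\<dots> \<le> q * x" using lnx Rx q(1) by (intro mult_left_mono) auto
      finally show ?thesis using cmean_ln_le_prox[OF R'(3)] pR Rx by linarith
    qed
    also have "\<dots> \<le> M * x + \<bar>C0\<bar> * (M * x) + 2 * (q * (M * x))"
    proof -
      have "M \<le> M * x" "1 \<le> M * x" "x \<le> M * x"
        using M x mult_mono[of 1 M 1 x] mult_left_mono[of 1 x M] mult_right_mono[of 1 M x] by auto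
      moreover have "\<bar>C0\<bar> * 1 \<le> \<bar>C0\<bar> * (M * x)" using \<open>1 \<le> M * x\<close> by (intro mult_left_mono) auto
      moreover have "q * x \<le> q * (M * x)" using \<open>x \<le> M * x\<close> q by (intro mult_left_mono) auto
      ultimately show ?thesis by linarith
    qed
    also have "\<dots> \<le> c * (M * x)"
    proof -
      have "0 \<le> M * x" using M x by simp
      thus ?thesis unfolding c_def by (simp add: algebra_simps)
    qed
    finally have \<nu>ln: "\<nu> * ln (R' / R) \<le> c * (M * x)" .
    have "ln (R / R') \<le> R / R' - 1" using Rx by (intro ln_le_minus_one) auto
    hence "ln (R' / R) \<ge> 1 - R / R'" using Rx by (simp add: ln_div)
    moreover have "1 - R / R' = (R' - R) / R'" using Rx by (simp add: field_simps)
    moreover have "(\<delta> / 4) / x \<le> (R' - R) / R'" using R R' Rx \<delta> by (intro frac_le) auto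
    ultimately have "\<delta> / 4 / x \<le> ln (R' / R)" by linarith
    hence "\<nu> * (\<delta> / 4 / x) \<le> c * (M * x)" using \<nu>ln mult_left_mono[of "\<delta>/4/x" "ln (R'/R)" \<nu>] \<nu>0 by linarith
    hence "\<nu> * (\<delta> / 4 / x) * (4 * x * y) \<le> c * (M * x) * (4 * x * y)"
      using x y by (intro mult_right_mono) auto
    moreover have "\<nu> * (\<delta> / 4 / x) * (4 * x * y) = \<nu>" using x \<delta> by (simp add: y_def)
    ultimately have \<nu>: "\<nu> \<le> 4 * c * M * x^2 * y" by (simp add: power2_eq_square mult_ac)
    define B where "B = 2 * R / (R - r)^2 * (A + \<nu> * (2 * ln (2 * R)))"
    have B0: "B \<ge> 0" and P: "prox r (\<lambda>z. deriv X z / X z) \<le> 2 * ln (1 + (sqrt B + 2 * \<nu>))"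
      using prox_log_deriv_le[OF X R(3) gr r Rx(5)] unfolding prox_def A_def B_def \<nu>_def D_def by auto
    define Z where "Z = M * x^4 * y^3"
    have pw: "M * x^i * y^j \<le> Z" if "i \<le> 4" "j \<le> 3" for i j
      unfolding Z_def using that M x y by (intro mult_mono power_increasing) auto
    have Z1: "1 \<le> Z" using pw[of 0 0] M by simp
    have B: "B \<le> 1056 * c * Z"
    proof -
      have l4: "2 * ln (2 * R) \<le> 4 * x" using ln_bound[of "2 * R"] Rx by linarith
      have "\<nu> * (2 * ln (2 * R)) \<le> (4 * c * M * x^2 * y) * (4 * x)"
        by (rule mult_mono[OF \<nu> l4]) (use c M x y Rx in auto)
      also have "\<dots> = 16 * c * (M * x^3 * y)" by (simp add: power_numeral_reduce)
      finally have 1: "\<nu> * (2 * ln (2 * R)) \<le> 16 * c * (M * x^3 * y)" .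
      have "M * x \<le> M * x^3 * y"
      proof -
        have "M * x^1 * y^0 \<le> M * x^3 * y^1" using M x y by (intro mult_mono power_increasing) auto
        thus ?thesis by simp
      qed
      hence "c * (M * x) \<le> c * (M * x^3 * y)" using c by (intro mult_left_mono) auto
      hence 2: "A + \<nu> * (2 * ln (2 * R)) \<le> 33 * c * (M * x^3 * y)"
      proof -
        have "0 \<le> c * (M * x^3 * y)" using c M x y by simp
        thus ?thesis using \<open>c * (M * x) \<le> c * (M * x^3 * y)\<close> A 1 by linarith
      qed
      have "2 * R / (R - r)^2 \<le> 2 * x / (\<delta> / 4)^2"
        using Rx R \<delta> by (intro frac_le power_mono) auto
      also have "\<dots> = 32 * x * y^2" using \<delta> by (simp add: y_def field_simps)
      finally have 3: "2 * R / (R - r)^2 \<le> 32 * x * y^2" .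
      have A0: "0 \<le> A" unfolding A_def using Rx by (intro cmean_nonneg continuous_on_rabs good_ln_continuous R) auto
      have "B \<le> (32 * x * y^2) * (33 * c * (M * x^3 * y))"
        unfolding B_def using 2 3 x y A0 \<nu>0 Rx by (intro mult_mono add_nonneg_nonneg mult_nonneg_nonneg) auto
      also have "\<dots> = 1056 * c * Z" by (simp add: Z_def power_numeral_reduce)
      finally show ?thesis .
    qed
    have "\<nu> \<le> 4 * (c * Z)"
    proof -
      have "M * x^2 * y \<le> Z" using pw[of 2 1] by simp
      hence "4 * c * (M * x^2 * y) \<le> 4 * c * Z" using c by (intro mult_left_mono) auto
      thus ?thesis using \<nu> by (simp add: mult.assoc)
    qed
    moreover have "sqrt B \<le> 1 + B" using B0 by (intro real_le_lsqrt) (auto simp: power2_eq_square algebra_simps)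
    ultimately have "1 + (sqrt B + 2 * \<nu>) \<le> 2 + 1064 * (c * Z)" using B by simp
    also have "\<dots> \<le> 2 * Z + 1072 * (c * Z)" using Z1 c mult_nonneg_nonneg[of c Z] by linarith
    also have "\<dots> = K * Z" by (simp add: K_def algebra_simps)
    finally have "1 + (sqrt B + 2 * \<nu>) \<le> K * Z" .
    hence "ln (1 + (sqrt B + 2 * \<nu>)) \<le> ln (K * Z)" using B0 \<nu>0 by (intro ln_mono) (auto intro: add_pos_nonneg)
    also have "\<dots> = ln K + ln M + 4 * ln x + 3 * ln y"
      using K M x y by (simp add: Z_def ln_mult ln_realpow)
    also have "\<dots> \<le> (ln K + 4) * (1 + ln M + ln x + ln y)"
    proof -
      have nn: "0 \<le> ln K" "0 \<le> ln M" "0 \<le> ln x" "0 \<le> ln y" using K M x y by auto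
      have "0 \<le> ln K * (ln M + ln x + ln y)" using nn by simp
      thus ?thesis using nn by (simp add: algebra_simps)
    qed
    finally show "prox r (\<lambda>z. deriv X z / X z) \<le> 2 * (ln K + 4) * (1 + ln M + ln (r + 2) + ln (1 / \<delta>))"
      using P unfolding x_def y_def by (simp only: mult.assoc)
  qed
qed

section \<open>Radii of slow growth\<close>

text \<open>
  \<open>T\<close> is the scale against which error terms are measured; later it is \<open>prox r f + prox r g\<close>. It need not
  be monotone.
\<close>
locale growth =
  fixes T :: "real \<Rightarrow> real" and r0 :: real
  assumes T_cont: "continuous_on {r0..} T"
    and T_nonneg: "\<And>r. r \<ge> r0 \<Longrightarrow> 0 \<le> T r"
    and T_superlog: "\<And>K. eventually (\<lambda>r. K * ln r \<le> T r) at_top"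
begin

lemma T_at_top: "eventually (\<lambda>r. K \<le> T r) at_top"
proof -
  have "eventually (\<lambda>r. \<bar>K\<bar> * ln r \<le> T r) at_top" by (rule T_superlog)
  moreover have "eventually (\<lambda>r::real. r \<ge> exp 1) at_top" by (rule eventually_ge_at_top)
  ultimately show ?thesis
  proof eventually_elim
    case (elim r)
    have "0 < r" using elim(2) exp_gt_zero[of "1::real"] by linarith
    hence "1 \<le> ln r" using elim(2) by (simp add: ln_ge_iff)
    hence "\<bar>K\<bar> * 1 \<le> \<bar>K\<bar> * ln r" by (intro mult_left_mono) auto
    thus ?case using elim(1) by linarith
  qed
qed

text \<open>
  The logarithmic derivative at \<open>s\<close> is controlled through radii slightly beyond \<open>s\<close>, so radii are needed
  at which \<open>T\<close> does not grow too much over a distance of order \<open>1 / T s\<close>.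
\<close>
definition slow :: "real set" where
  "slow = {s. r0 \<le> s \<and> (\<forall>\<rho>. s \<le> \<rho> \<longrightarrow> \<rho> \<le> s + 1 / (2 * T s) \<longrightarrow> T \<rho> \<le> 4 * T s)}"

text \<open>
  This is Borel's growth lemma. If from some radius on the running maximum \<open>Ts\<close> doubled over each step
  \<open>2 / Ts r\<close>, the steps would sum to at most \<open>4\<close>, and \<open>Ts\<close> would be unbounded on a bounded interval. So there is a step over
  which it does not double, and continuity at a point where the maximum is attained gives a whole interval
  of slow radii. An interval, rather than a single radius, is needed because countably many radii are
  discarded later.
\<close>
lemma slow_unbounded: "\<exists>a b. K \<le> a \<and> a < b \<and> {a<..<b} \<subseteq> slow"
proof -
  define Ts where "Ts r = Sup (T ` {r0..r})" for r
  have cont': "continuous_on {r0..r} T" for r by (rule continuous_on_subset[OF T_cont]) auto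
  have bdd: "bdd_above (T ` {r0..r})" for r
    by (intro bounded_imp_bdd_above compact_imp_bounded compact_continuous_image[OF cont']) auto
  have le_Ts: "T s \<le> Ts r" if "r0 \<le> s" "s \<le> r" for s r
    unfolding Ts_def using that by (intro cSup_upper bdd) auto
  have Ts_attained: "\<exists>s. r0 \<le> s \<and> s \<le> r \<and> T s = Ts r" if "r0 \<le> r" for r
  proof -
    have "{r0..r} \<noteq> {}" using that by simp
    then obtain s where s: "s \<in> {r0..r}" "\<forall>t\<in>{r0..r}. T t \<le> T s"
      using continuous_attains_sup[OF compact_Icc _ cont', of r] by blast
    have "Ts r \<le> T s" unfolding Ts_def using s that by (intro cSup_least) auto
    thus ?thesis using le_Ts[of s r] s by (intro exI[of _ s]) auto
  qed
  have Ts_mono: "Ts r \<le> Ts r'" if rr': "r0 \<le> r" "r \<le> r'" for r r'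
  proof -
    obtain s where s: "r0 \<le> s" "s \<le> r" "T s = Ts r" using Ts_attained[OF rr'(1)] by blast
    thus ?thesis using le_Ts[of s r'] rr' by simp
  qed
  define K' where "K' = max K r0"
  have "eventually (\<lambda>r. max (Ts K' + 1) 1 \<le> T r) at_top" by (rule T_at_top)
  then obtain r1 where r1: "\<And>r. r \<ge> r1 \<Longrightarrow> max (Ts K' + 1) 1 \<le> T r" by (auto simp: eventually_at_top_linorder)
  define R where "R = max r1 K'"
  have R: "R \<ge> r0" "R \<ge> K'" "T R \<ge> 1" "T R > Ts K'" using r1[of R] by (auto simp: R_def K'_def)
  \<comment> \<open>\<open>R\<close> is so large that the maximum up to any \<open>r \<ge> R\<close> is attained beyond \<open>K'\<close>.\<close>
  have "\<exists>r\<ge>R. Ts (r + 2 / Ts r) < 2 * Ts r"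
  proof (rule ccontr)
    assume "\<not> ?thesis"
    hence dbl: "2 * Ts r \<le> Ts (r + 2 / Ts r)" if "r \<ge> R" for r using that by force
    define s where "s = rec_nat R (\<lambda>_ r. r + 2 / Ts r)"
    have s0: "s 0 = R" and sS: "s (Suc k) = s k + 2 / Ts (s k)" for k by (simp_all add: s_def)
    have inv: "R \<le> s k \<and> s k \<le> R + 4 * (1 - 1 / 2 ^ k) \<and> 2 ^ k \<le> Ts (s k)" for k
    proof (induction k)
      case 0 thus ?case using R le_Ts[of R R] s0 by auto
    next
      case (Suc k)
      have p: "(0::real) < 2 ^ k" by simp
      have q: "0 < Ts (s k)" using Suc p by linarith
      have "2 / Ts (s k) \<le> 2 / 2 ^ k" using Suc p by (intro divide_left_mono mult_pos_pos p q) auto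
      moreover have "0 \<le> 2 / Ts (s k)" using q by simp
      moreover have "4 * (1 - 1 / 2 ^ Suc k) = 4 * (1 - 1 / 2 ^ k) + 2 / (2::real) ^ k" by (simp add: field_simps)
      ultimately have "R \<le> s (Suc k)" "s (Suc k) \<le> R + 4 * (1 - 1 / 2 ^ Suc k)" using Suc unfolding sS by linarith+
      moreover have "2 ^ Suc k \<le> Ts (s (Suc k))" using dbl[of "s k"] Suc unfolding sS by simp
      ultimately show ?case by blast
    qed
    have "2 ^ k \<le> Ts (R + 4)" for k :: nat
    proof -
      have "s k \<le> R + 4 * (1 - 1 / 2 ^ k)" using inv[of k] by blast
      moreover have "4 * (1 - 1 / 2 ^ k) \<le> (4::real)" by simp
      ultimately have "s k \<le> R + 4" by linarith
      hence "Ts (s k) \<le> Ts (R + 4)" using inv[of k] R by (intro Ts_mono) auto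
      thus ?thesis using inv[of k] by linarith
    qed
    moreover obtain k where "Ts (R + 4) < 2 ^ k" using real_arch_pow[of 2 "Ts (R+4)"] by auto
    ultimately show False using not_le by blast
  qed
  then obtain r where r: "r \<ge> R" "Ts (r + 2 / Ts r) < 2 * Ts r" by blast
  define \<tau> where "\<tau> = Ts r"
  have \<tau>: "\<tau> \<ge> 1" "\<tau> > Ts K'" using r R Ts_mono[of R r] le_Ts[of R R] by (auto simp: \<tau>_def)
  obtain s0 where s0: "r0 \<le> s0" "s0 \<le> r" "T s0 = \<tau>" using Ts_attained[of r] r R by (auto simp: \<tau>_def)
  have "s0 > K'"
  proof (rule ccontr)
    assume "\<not> s0 > K'"
    hence "T s0 \<le> Ts K'" using s0 by (intro le_Ts) auto
    thus False using s0 \<tau> by simp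
  qed
  have "\<exists>d>0. \<forall>s\<in>{r0..}. dist s s0 < d \<longrightarrow> dist (T s) (T s0) < \<tau> / 2"
  proof -
    have "s0 \<in> {r0..}" "0 < \<tau> / 2" using s0 \<tau> by auto
    thus ?thesis using T_cont unfolding continuous_on_iff by blast
  qed
  then obtain d where d: "d > 0" "\<And>s. r0 \<le> s \<Longrightarrow> dist s s0 < d \<Longrightarrow> dist (T s) (T s0) < \<tau> / 2" by auto
  show ?thesis
  proof (intro exI conjI)
    show "K \<le> s0" using \<open>s0 > K'\<close> by (simp add: K'_def)
    show "s0 < s0 + min d (1 / \<tau>)" using d \<tau> by simp
    show "{s0<..<s0 + min d (1 / \<tau>)} \<subseteq> slow"
    proof
      fix s assume s: "s \<in> {s0<..<s0 + min d (1 / \<tau>)}"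
      have "dist (T s) (T s0) < \<tau> / 2" using s s0 by (intro d) (auto simp: dist_real_def)
      hence Ts2: "T s > \<tau> / 2" using s0 unfolding dist_real_def by linarith
      have "T \<rho> \<le> 4 * T s" if \<rho>: "s \<le> \<rho>" "\<rho> \<le> s + 1 / (2 * T s)" for \<rho>
      proof -
        have "1 / (2 * T s) \<le> 1 / \<tau>" using Ts2 \<tau> by (intro divide_left_mono) auto
        hence "\<rho> \<le> r + 2 / \<tau>" using \<rho> s s0 by auto
        hence "T \<rho> \<le> Ts (r + 2 / \<tau>)" using \<rho> s s0 by (intro le_Ts) auto
        thus ?thesis using r(2) Ts2 unfolding \<tau>_def by linarith
      qed
      thus "s \<in> slow" using s s0 by (auto simp: slow_def)
    qed
  qed
qed

text \<open>
  Large radii of slow growth, up to countable sets. Working along this filter takes the place of the usual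
  exceptional sets of finite measure: finitely many asymptotic inequalities hold simultaneously, and all
  that matters in the end is that the filter is proper (\<open>radii_nontrivial\<close>).
\<close>
definition radii :: "real filter" where
  "radii = Abs_filter (\<lambda>P. \<exists>B K. countable B \<and> (\<forall>s\<in>slow. K \<le> s \<longrightarrow> s \<notin> B \<longrightarrow> P s))"

lemma eventually_radii:
  "eventually P radii \<longleftrightarrow> (\<exists>B K. countable B \<and> (\<forall>s\<in>slow. K \<le> s \<longrightarrow> s \<notin> B \<longrightarrow> P s))"
  unfolding radii_def
proof (rule eventually_Abs_filter, standard, goal_cases)
  case 1 thus ?case by (intro exI[of _ "{}"]) auto
next
  case (2 P Q)
  then obtain B K B' K' where "countable B" "\<forall>s\<in>slow. K \<le> s \<longrightarrow> s \<notin> B \<longrightarrow> P s"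
    "countable B'" "\<forall>s\<in>slow. K' \<le> s \<longrightarrow> s \<notin> B' \<longrightarrow> Q s" by blast
  thus ?case by (intro exI[of _ "B \<union> B'"] exI[of _ "max K K'"]) auto
next
  case (3 P Q) thus ?case by blast
qed

lemma radii_nontrivial: "\<not> eventually (\<lambda>_. False) radii"
proof
  assume "eventually (\<lambda>_. False) radii"
  then obtain B K where B: "countable B" "\<And>s. s \<in> slow \<Longrightarrow> K \<le> s \<Longrightarrow> s \<in> B" unfolding eventually_radii by blast
  obtain a b where ab: "K \<le> a" "a < b" "{a<..<b} \<subseteq> slow" using slow_unbounded by blast
  hence "{a<..<b} \<subseteq> B" using B(2) by force
  hence "countable {a<..<b}" using B(1) countable_subset by blast
  thus False using ab(2) uncountable_open_interval by blast
qed

lemma radii_at_top: "eventually P at_top \<Longrightarrow> eventually P radii"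
  unfolding eventually_radii eventually_at_top_linorder by (rule exI[of _ "{}"]) auto

lemma radii_cocountable: "countable {r. \<not> P r} \<Longrightarrow> eventually P radii"
  unfolding eventually_radii by (intro exI[of _ "{r. \<not> P r}"]) auto

lemma radii_slow: "eventually (\<lambda>s. s \<in> slow) radii"
  unfolding eventually_radii by (intro exI[of _ "{}"]) auto

lemma radii_good: "mero X \<Longrightarrow> eventually (good X) radii"
  by (intro radii_cocountable countable_bad_radii)

lemma radii_ge: "eventually (\<lambda>s. K \<le> s) radii"
  by (intro radii_at_top eventually_ge_at_top)

lemma radii_T_ge: "eventually (\<lambda>s. K \<le> T s) radii"
  by (intro radii_at_top T_at_top)

text \<open>Upper bounds suffice, so \<open>u\<close> may be arbitrarily negative.\<close>
definition small :: "(real \<Rightarrow> real) \<Rightarrow> bool" where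
  "small u \<longleftrightarrow> (\<forall>\<epsilon>>0. eventually (\<lambda>r. u r \<le> \<epsilon> * T r) radii)"

lemma smallD: "small u \<Longrightarrow> \<epsilon> > 0 \<Longrightarrow> eventually (\<lambda>r. u r \<le> \<epsilon> * T r) radii"
  unfolding small_def by blast

lemma small_mono: "small v \<Longrightarrow> eventually (\<lambda>r. u r \<le> v r) radii \<Longrightarrow> small u"
  unfolding small_def
proof (intro allI impI)
  fix \<epsilon> :: real
  assume "\<forall>\<epsilon>>0. eventually (\<lambda>r. v r \<le> \<epsilon> * T r) radii" "eventually (\<lambda>r. u r \<le> v r) radii" "\<epsilon> > 0"
  hence "eventually (\<lambda>r. v r \<le> \<epsilon> * T r) radii" "eventually (\<lambda>r. u r \<le> v r) radii" by auto
  thus "eventually (\<lambda>r. u r \<le> \<epsilon> * T r) radii" by eventually_elim simp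
qed

lemma small_add:
  assumes "small u" "small v" shows "small (\<lambda>r. u r + v r)"
  unfolding small_def
proof (intro allI impI)
  fix \<epsilon> :: real assume \<epsilon>: "\<epsilon> > 0"
  have "eventually (\<lambda>r. u r \<le> \<epsilon>/2 * T r) radii" "eventually (\<lambda>r. v r \<le> \<epsilon>/2 * T r) radii"
    by (rule smallD[OF assms(1)] smallD[OF assms(2)], use \<epsilon> in simp)+
  thus "eventually (\<lambda>r. u r + v r \<le> \<epsilon> * T r) radii" by eventually_elim (simp add: field_simps)
qed

lemma small_cmult:
  assumes "small u" "c \<ge> 0" shows "small (\<lambda>r. c * u r)"
  unfolding small_def
proof (intro allI impI)
  fix \<epsilon> :: real assume \<epsilon>: "\<epsilon> > 0"
  have "eventually (\<lambda>r. u r \<le> \<epsilon> / (c + 1) * T r) radii"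
    by (rule smallD[OF assms(1)]) (use \<epsilon> assms in simp)
  with radii_T_ge[of 0] show "eventually (\<lambda>r. c * u r \<le> \<epsilon> * T r) radii"
  proof eventually_elim
    case (elim r)
    have "c * u r \<le> c * (\<epsilon> / (c + 1) * T r)" using elim assms by (intro mult_left_mono) auto
    also have "\<dots> = c / (c + 1) * (\<epsilon> * T r)" by simp
    also have "\<dots> \<le> 1 * (\<epsilon> * T r)" using elim \<epsilon> assms by (intro mult_right_mono) auto
    finally show ?case by simp
  qed
qed

lemma small_const: "small (\<lambda>_. c)"
  unfolding small_def
proof (intro allI impI)
  fix \<epsilon> :: real assume "\<epsilon> > 0"
  with radii_T_ge[of "c / \<epsilon>"] show "eventually (\<lambda>r. c \<le> \<epsilon> * T r) radii"
    by (auto elim!: eventually_mono simp: field_simps)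
qed

lemma small_ln: "small (\<lambda>r. c * ln r)"
  unfolding small_def
proof (intro allI impI)
  fix \<epsilon> :: real assume "\<epsilon> > 0"
  with radii_at_top[OF T_superlog[of "c / \<epsilon>"]] show "eventually (\<lambda>r. c * ln r \<le> \<epsilon> * T r) radii"
    by (auto elim!: eventually_mono simp: field_simps)
qed

lemma small_ln_T: "small (\<lambda>r. ln (T r))"
  unfolding small_def
proof (intro allI impI)
  fix \<epsilon> :: real assume \<epsilon>: "\<epsilon> > 0"
  have "eventually (\<lambda>x::real. ln x \<le> \<epsilon> * x) at_top"
  proof -
    have "((\<lambda>x::real. ln x / x) \<longlongrightarrow> 0) at_top" by (rule ln_x_over_x_tendsto_0)
    hence "eventually (\<lambda>x::real. ln x / x < \<epsilon>) at_top" using \<epsilon> by (rule order_tendstoD)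
    with eventually_gt_at_top[of 0] show ?thesis by eventually_elim (simp add: field_simps)
  qed
  then obtain K where K: "\<And>x. x \<ge> K \<Longrightarrow> ln x \<le> \<epsilon> * x" by (auto simp: eventually_at_top_linorder)
  show "eventually (\<lambda>r. ln (T r) \<le> \<epsilon> * T r) radii"
    using radii_T_ge[of K] by eventually_elim (rule K)
qed

lemma small_contradiction:
  assumes "small u" "c > 0" "eventually (\<lambda>r. c * T r \<le> u r) radii"
  shows False
proof -
  have "eventually (\<lambda>r. u r \<le> c / 2 * T r) radii"
    by (rule smallD[OF assms(1)]) (use assms in simp)
  with assms(3) radii_T_ge[of 1] have "eventually (\<lambda>r. False) radii"
  proof eventually_elim
    case (elim r)
    have "c * T r \<le> c / 2 * T r" using elim by linarith
    hence "c * T r \<le> 0" by simp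
    moreover have "c * 1 \<le> c * T r" using elim assms(2) by (intro mult_left_mono) auto
    ultimately show ?case using assms(2) by simp
  qed
  thus False using radii_nontrivial by simp
qed

end

section \<open>The lemma on the logarithmic derivative\<close>

text \<open>
  Stronger than having finitely many poles: removable singularities count as well, so that the class is
  closed under composition with polynomials and under derivatives for trivial reasons.
\<close>
definition fin_sing :: "(complex \<Rightarrow> complex) \<Rightarrow> bool" where
  "fin_sing X \<longleftrightarrow> finite {z. \<not> X analytic_on {z}}"

lemma fin_sing_neg_ord: "mero X \<Longrightarrow> fin_sing X \<Longrightarrow> finite {z. zorder X z < 0}"
proof -
  assume a: "mero X" "fin_sing X"
  have "{z. zorder X z < 0} \<subseteq> {z. \<not> X analytic_on {z}}"
    using ord_nonneg[OF a(1)] by (auto simp: not_le[symmetric])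
  thus "finite {z. zorder X z < 0}" using a(2) unfolding fin_sing_def by (rule finite_subset)
qed

lemma analytic_on_poly_comp: "X analytic_on S \<Longrightarrow> (\<lambda>z. poly A (X z)) analytic_on S"
  by (induction A) (auto intro!: analytic_intros)

lemma fin_sing_deriv: "fin_sing X \<Longrightarrow> fin_sing (deriv X)"
  unfolding fin_sing_def by (rule finite_subset[rotated]) (auto intro: analytic_deriv)

lemma fin_sing_poly: "fin_sing X \<Longrightarrow> fin_sing (\<lambda>z. poly A (X z))"
  unfolding fin_sing_def by (rule finite_subset[rotated]) (auto intro: analytic_on_poly_comp)

lemma fin_sing_diff_const: "fin_sing X \<Longrightarrow> fin_sing (\<lambda>z. X z - c)"
  unfolding fin_sing_def by (rule finite_subset[rotated]) (auto intro: analytic_intros)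

text \<open>
  Finitely many points, such as poles, may be disregarded at the price of \<open>O(ln r)\<close>, which is negligible.
\<close>
lemma Ncount_mono_finite:
  assumes k: "locfin k" and l: "locfin l" and P: "finite P" "\<And>z. z \<notin> P \<Longrightarrow> k z \<le> l z"
  obtains C where "\<And>r. r \<ge> 1 \<Longrightarrow> Ncount k r \<le> Ncount l r + C * ln r"
proof -
  define d where "d z = (if z \<in> P then \<bar>k z - l z\<bar> else 0)" for z
  have fd: "finite {z. d z \<noteq> 0}" by (rule finite_subset[OF _ P(1)]) (auto simp: d_def)
  obtain C where C: "\<forall>r\<ge>1. Ncount d r \<le> C * ln r" using Ncount_finite_le[OF fd] by blast
  have "Ncount k r \<le> Ncount l r + C * ln r" if r: "r \<ge> 1" for r
  proof -
    have "Ncount k r \<le> Ncount (\<lambda>z. l z + d z) r"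
      using k l locfin_finite[OF fd] P(2) r by (intro Ncount_mono locfin_add) (auto simp: d_def)
    also have "\<dots> = Ncount l r + Ncount d r" by (rule Ncount_add[OF l locfin_finite[OF fd]])
    finally show ?thesis using C r by force
  qed
  thus thesis by (rule that)
qed

text \<open>
  The first main theorem, in the only direction needed: zeros minus poles are bounded by the proximity
  function.
\<close>
lemma Ncount_ord_le_prox:
  assumes X: "mero X"
  obtains C where "\<And>r. r \<ge> 1 \<Longrightarrow> good X r \<Longrightarrow> Ncount (ord X) r \<le> prox r X + C"
proof -
  obtain C where C: "\<And>r. r \<ge> 1 \<Longrightarrow> good X r \<Longrightarrow> cmean r (\<lambda>z. ln (norm (X z))) = C + Ncount (ord X) r"
    using jensen[OF X] by blast
  show thesis
  proof (rule that[of "- C"])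
    fix r :: real assume r: "r \<ge> 1" "good X r"
    show "Ncount (ord X) r \<le> prox r X + - C" using cmean_ln_le_prox[OF r(2)] C[OF r] r by linarith
  qed
qed

lemma prox_le_two:
  assumes "good X r" "good Y r" "good Z r" "r \<ge> 0" "a \<ge> 0" "b \<ge> 0"
    "\<And>z. norm z = r \<Longrightarrow> ln (max 1 (norm (Z z))) \<le> c + a * ln (max 1 (norm (X z))) + b * ln (max 1 (norm (Y z)))"
  shows "prox r Z \<le> c + a * prox r X + b * prox r Y"
proof -
  have cX: "continuous_on (sphere 0 r) (\<lambda>z. c + a * ln (max 1 (norm (X z))))"
    by (intro continuous_on_add continuous_on_mult continuous_on_const good_lnmax_continuous assms)
  have cX': "continuous_on (sphere 0 r) (\<lambda>z. a * ln (max 1 (norm (X z))))"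
    by (intro continuous_on_mult continuous_on_const good_lnmax_continuous assms)
  have cY: "continuous_on (sphere 0 r) (\<lambda>z. b * ln (max 1 (norm (Y z))))"
    by (intro continuous_on_mult continuous_on_const good_lnmax_continuous assms)
  have "prox r Z \<le> cmean r (\<lambda>z. (c + a * ln (max 1 (norm (X z)))) + b * ln (max 1 (norm (Y z))))"
    unfolding prox_def by (rule cmean_mono[OF good_lnmax_continuous[OF assms(3)] continuous_on_add[OF cX cY]])
      (use assms in auto)
  also have "\<dots> = c + a * prox r X + b * prox r Y"
    unfolding prox_def cmean_add[OF cX cY assms(4)] cmean_add[OF continuous_on_const cX' assms(4)]
    by (simp add: cmean_cmult cmean_const)
  finally show ?thesis .
qed

lemma ln_max_mult_le:
  assumes "(x::real) \<ge> 0" "y \<ge> 0"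
  shows "ln (max 1 (x * y)) \<le> ln (max 1 x) + ln (max 1 y)"
proof -
  have "x * y \<le> max 1 x * max 1 y" using assms by (intro mult_mono) auto
  moreover have "1 * 1 \<le> max 1 x * max 1 y" by (intro mult_mono) auto
  ultimately have "ln (max 1 (x * y)) \<le> ln (max 1 x * max 1 y)" by (intro ln_mono) auto
  also have "\<dots> = ln (max 1 x) + ln (max 1 y)" by (rule ln_mult_pos) auto
  finally show ?thesis .
qed

lemma prox_mult_le:
  assumes "good X r" "good Y r" "r \<ge> 0"
  shows "prox r (\<lambda>z. X z * Y z) \<le> prox r X + prox r Y"
proof -
  have g: "good (\<lambda>z. X z * Y z) r" using assms by (auto simp: good_def intro!: analytic_intros)
  have "prox r (\<lambda>z. X z * Y z) \<le> 0 + 1 * prox r X + 1 * prox r Y"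
    by (rule prox_le_two[OF assms(1,2) g assms(3)]) (auto simp: norm_mult ln_max_mult_le)
  thus ?thesis by simp
qed

lemma prox_cong:
  "r \<ge> 0 \<Longrightarrow> (\<And>z. norm z = r \<Longrightarrow> X z = Y z) \<Longrightarrow> prox r X = prox r Y"
  unfolding prox_def by (rule cmean_cong) auto

lemma poly_growth:
  fixes A :: "complex poly"
  obtains C where "C \<ge> 0" "\<And>w. ln (max 1 (norm (poly A w))) \<le> degree A * ln (max 1 (norm w)) + C"
proof -
  define c where "c = max 1 (\<Sum>i\<le>degree A. norm (coeff A i))"
  show thesis
  proof (rule that[of "ln c"])
    show "ln c \<ge> 0" by (simp add: c_def)
    fix w :: complex
    define x where "x = max 1 (norm w)"
    have x: "x \<ge> 1" by (simp add: x_def)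
    have "norm (poly A w) \<le> (\<Sum>i\<le>degree A. norm (coeff A i * w ^ i))"
      unfolding poly_altdef by (rule norm_sum)
    also have "\<dots> \<le> (\<Sum>i\<le>degree A. norm (coeff A i) * x ^ degree A)"
    proof (rule sum_mono)
      fix i assume i: "i \<in> {..degree A}"
      have "norm w ^ i \<le> x ^ i" by (intro power_mono) (auto simp: x_def)
      also have "\<dots> \<le> x ^ degree A" using x i by (intro power_increasing) auto
      finally show "norm (coeff A i * w ^ i) \<le> norm (coeff A i) * x ^ degree A"
        unfolding norm_mult norm_power by (intro mult_left_mono) auto
    qed
    also have "\<dots> = (\<Sum>i\<le>degree A. norm (coeff A i)) * x ^ degree A" by (simp add: sum_distrib_right)
    also have "\<dots> \<le> c * x ^ degree A" using x by (intro mult_right_mono) (auto simp: c_def)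
    finally have "norm (poly A w) \<le> c * x ^ degree A" .
    moreover have "1 * 1 \<le> c * x ^ degree A" using x by (intro mult_mono one_le_power) (auto simp: c_def)
    ultimately have "ln (max 1 (norm (poly A w))) \<le> ln (c * x ^ degree A)" by (intro ln_mono) auto
    also have "\<dots> = degree A * ln x + ln c" using x by (simp add: ln_mult ln_realpow c_def)
    finally show "ln (max 1 (norm (poly A w))) \<le> degree A * ln (max 1 (norm w)) + ln c" by (simp add: x_def)
  qed
qed

lemma prox_poly_le:
  fixes A :: "complex poly"
  obtains C where "C \<ge> 0" "\<And>X r. r \<ge> 0 \<Longrightarrow> good X r \<Longrightarrow> good (\<lambda>z. poly A (X z)) r \<Longrightarrow>
    prox r (\<lambda>z. poly A (X z)) \<le> degree A * prox r X + C"
proof -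
  obtain C where C: "C \<ge> 0" "\<And>w. ln (max 1 (norm (poly A w))) \<le> degree A * ln (max 1 (norm w)) + C"
    using poly_growth[of A] by blast
  show thesis
  proof (rule that[of C])
    fix X r assume r: "(r::real) \<ge> 0" "good X r" "good (\<lambda>z. poly A (X z)) r"
    have "prox r (\<lambda>z. poly A (X z)) \<le> C + degree A * prox r X + 0 * prox r X"
      by (rule prox_le_two[OF r(2,2,3,1)]) (use C(2) in \<open>auto simp: algebra_simps\<close>)
    thus "prox r (\<lambda>z. poly A (X z)) \<le> degree A * prox r X + C" by simp
  qed (rule C)
qed

context growth
begin

text \<open>
  \<open>prox \<rho> X\<close> is at most a multiple of \<open>T s\<close> for all \<open>\<rho>\<close> in a window of length \<open>\<theta> / T s\<close> after \<open>s\<close>. A bound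
  at \<open>s\<close> alone would not do, because the estimate of the logarithmic derivative at \<open>s\<close> looks at larger radii.
  Constants \<open>\<theta>\<close>, \<open>c\<close> and a countable set \<open>U\<close> are left free, so that the class is closed under derivatives
  and polynomials, although each of these operations shrinks the window or enlarges \<open>c\<close> or \<open>U\<close>.
\<close>
definition tame :: "(complex \<Rightarrow> complex) \<Rightarrow> bool" where
  "tame X \<longleftrightarrow> mero X \<and> fin_sing X \<and>
    (\<exists>\<theta> c U. 0 < \<theta> \<and> \<theta> \<le> 1/2 \<and> 1 \<le> c \<and> countable U \<and>
      eventually (\<lambda>s. \<forall>\<rho>. s \<le> \<rho> \<longrightarrow> \<rho> \<le> s + \<theta> / T s \<longrightarrow> good X \<rho> \<longrightarrow> \<rho> \<notin> U \<longrightarrow> prox \<rho> X \<le> c * T s) radii)"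

text \<open>
  For \<open>\<rho>\<close> in the first half of the window, \<open>\<delta> = \<theta> / (2 T s)\<close> is admissible in
  \<open>log_derivative_estimate\<close>, and the bound obtained is \<open>O(ln s + ln (T s))\<close>.
\<close>
lemma tame_log_deriv_window:
  assumes "tame X"
  shows "\<exists>\<theta> L. 0 < \<theta> \<and> \<theta> \<le> 1/2 \<and> small L \<and>
    eventually (\<lambda>s. \<forall>\<rho>. s \<le> \<rho> \<longrightarrow> \<rho> \<le> s + \<theta> / T s \<longrightarrow> good X \<rho> \<longrightarrow> prox \<rho> (\<lambda>z. deriv X z / X z) \<le> L s) radii"
proof -
  from assms obtain \<theta> c U where X: "mero X" and fs: "fin_sing X" and \<theta>: "0 < \<theta>" "\<theta> \<le> 1/2" and c: "1 \<le> c"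
    and U: "countable U"
    and ev: "eventually (\<lambda>s. \<forall>\<rho>. s \<le> \<rho> \<longrightarrow> \<rho> \<le> s + \<theta> / T s \<longrightarrow> good X \<rho> \<longrightarrow> \<rho> \<notin> U \<longrightarrow> prox \<rho> X \<le> c * T s) radii"
    unfolding tame_def by blast
  obtain C where C: "C \<ge> 0" "\<And>r \<delta> M. 1 \<le> r \<Longrightarrow> 0 < \<delta> \<Longrightarrow> \<delta> \<le> 1 \<Longrightarrow> good X r \<Longrightarrow> 1 \<le> M \<Longrightarrow>
    (\<And>\<rho>. r \<le> \<rho> \<Longrightarrow> \<rho> \<le> r + \<delta> \<Longrightarrow> good X \<rho> \<Longrightarrow> \<rho> \<notin> U \<Longrightarrow> prox \<rho> X \<le> M) \<Longrightarrow>
    prox r (\<lambda>z. deriv X z / X z) \<le> C * (1 + ln M + ln (r + 2) + ln (1 / \<delta>))"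
    using log_derivative_estimate[OF X fin_sing_neg_ord[OF X fs] U] by blast
  define L where "L s = C * ((1 + ln c + ln 4 + ln (2/\<theta>)) + 1 * ln s + 2 * ln (T s))" for s
  have "small L" unfolding L_def
    by (intro small_cmult small_add small_const small_ln small_ln_T) (use C in auto)
  moreover have "eventually (\<lambda>s. \<forall>\<rho>. s \<le> \<rho> \<longrightarrow> \<rho> \<le> s + (\<theta>/2) / T s \<longrightarrow> good X \<rho> \<longrightarrow> prox \<rho> (\<lambda>z. deriv X z / X z) \<le> L s) radii"
    using ev radii_T_ge[of 1] radii_ge[of 1]
  proof eventually_elim
    case (elim s)
    show ?case
    proof (intro allI impI)
      fix \<rho> assume \<rho>: "s \<le> \<rho>" "\<rho> \<le> s + (\<theta>/2) / T s" "good X \<rho>"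
      define \<delta> where "\<delta> = \<theta> / 2 / T s"
      have \<delta>: "0 < \<delta>" using \<theta> elim(2) by (simp add: \<delta>_def)
      have "\<delta> \<le> \<theta> / 2 / 1" unfolding \<delta>_def using \<theta> elim(2) by (intro divide_left_mono) auto
      hence \<delta>1: "\<delta> \<le> 1" using \<theta> by simp
      have "\<delta> + \<delta> = \<theta> / T s" by (simp add: \<delta>_def)
      hence "prox \<rho> (\<lambda>z. deriv X z / X z) \<le> C * (1 + ln (c * T s) + ln (\<rho> + 2) + ln (1 / \<delta>))"
        using \<rho> elim \<delta> \<delta>1 c mult_mono[of 1 c 1 "T s"]
        by (intro C(2)) (auto simp: \<delta>_def[symmetric])
      also have "\<dots> \<le> L s" unfolding L_def
      proof (rule mult_left_mono[OF _ C(1)])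
        have "ln (\<rho> + 2) \<le> ln (4 * s)" using \<rho> \<delta>1 elim(3) by (intro ln_mono) (auto simp: \<delta>_def)
        also have "\<dots> = ln 4 + ln s" using elim(3) by (simp add: ln_mult)
        finally have 1: "ln (\<rho> + 2) \<le> ln 4 + ln s" .
        have 2: "ln (c * T s) = ln c + ln (T s)" using c elim(2) by (simp add: ln_mult)
        have "1 / \<delta> = (2/\<theta>) * T s" by (simp add: \<delta>_def)
        moreover have "ln ((2/\<theta>) * T s) = ln (2/\<theta>) + ln (T s)" by (rule ln_mult_pos) (use \<theta> elim(2) in auto)
        ultimately have 3: "ln (1 / \<delta>) = ln (2/\<theta>) + ln (T s)" by simp
        show "1 + ln (c * T s) + ln (\<rho> + 2) + ln (1 / \<delta>) \<le> (1 + ln c + ln 4 + ln (2/\<theta>)) + 1 * ln s + 2 * ln (T s)"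
          using 1 2 3 by linarith
      qed
      finally show "prox \<rho> (\<lambda>z. deriv X z / X z) \<le> L s" .
    qed
  qed
  ultimately show ?thesis using \<theta> by (intro exI[of _ "\<theta>/2"] exI[of _ L]) auto
qed

theorem logarithmic_derivative_small:
  assumes "tame X" shows "small (\<lambda>r. prox r (\<lambda>z. deriv X z / X z))"
proof -
  obtain \<theta> L where L: "0 < \<theta>" "small L"
    "eventually (\<lambda>s. \<forall>\<rho>. s \<le> \<rho> \<longrightarrow> \<rho> \<le> s + \<theta> / T s \<longrightarrow> good X \<rho> \<longrightarrow> prox \<rho> (\<lambda>z. deriv X z / X z) \<le> L s) radii"
    using tame_log_deriv_window[OF assms] by blast
  have X: "mero X" using assms by (simp add: tame_def)
  show ?thesis
  proof (rule small_mono[OF L(2)])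
    show "eventually (\<lambda>s. prox s (\<lambda>z. deriv X z / X z) \<le> L s) radii"
      using L(3) radii_T_ge[of 1] radii_good[OF X]
    proof eventually_elim
      case (elim s)
      have "s \<le> s + \<theta> / T s" using L(1) elim(2) by simp
      thus ?case using elim(1,3) by blast
    qed
  qed
qed

text \<open>
  \<open>X' = (X' / X) * X\<close>, and the first factor is even negligible.
\<close>
lemma tame_deriv:
  assumes X: "tame X" and X': "mero (deriv X)"
  shows "tame (deriv X)"
proof -
  from X obtain \<theta> c U where mX: "mero X" and fs: "fin_sing X" and \<theta>: "0 < \<theta>" "\<theta> \<le> 1/2" and c: "1 \<le> c"
    and U: "countable U"
    and ev: "eventually (\<lambda>s. \<forall>\<rho>. s \<le> \<rho> \<longrightarrow> \<rho> \<le> s + \<theta> / T s \<longrightarrow> good X \<rho> \<longrightarrow> \<rho> \<notin> U \<longrightarrow> prox \<rho> X \<le> c * T s) radii"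
    unfolding tame_def by blast
  obtain \<theta>' L where L: "0 < \<theta>'" "small L"
    "eventually (\<lambda>s. \<forall>\<rho>. s \<le> \<rho> \<longrightarrow> \<rho> \<le> s + \<theta>' / T s \<longrightarrow> good X \<rho> \<longrightarrow> prox \<rho> (\<lambda>z. deriv X z / X z) \<le> L s) radii"
    using tame_log_deriv_window[OF X] by blast
  define \<theta>'' where "\<theta>'' = min \<theta> \<theta>'"
  have "eventually (\<lambda>s. \<forall>\<rho>. s \<le> \<rho> \<longrightarrow> \<rho> \<le> s + \<theta>'' / T s \<longrightarrow> good (deriv X) \<rho> \<longrightarrow>
      \<rho> \<notin> U \<union> {r. \<not> good X r} \<longrightarrow> prox \<rho> (deriv X) \<le> (c + 1) * T s) radii"
    using ev L(3) smallD[OF L(2) zero_less_one] radii_T_ge[of 1] radii_ge[of 0]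
  proof eventually_elim
    case (elim s)
    show ?case
    proof (intro allI impI)
      fix \<rho> assume \<rho>: "s \<le> \<rho>" "\<rho> \<le> s + \<theta>'' / T s" "good (deriv X) \<rho>" "\<rho> \<notin> U \<union> {r. \<not> good X r}"
      have gX: "good X \<rho>" using \<rho> by simp
      have gq: "good (\<lambda>z. deriv X z / X z) \<rho>"
        using gX \<rho>(3) by (auto simp: good_def intro!: analytic_intros)
      have "\<theta>'' / T s \<le> \<theta> / T s" "\<theta>'' / T s \<le> \<theta>' / T s"
        using elim(4) by (auto simp: \<theta>''_def intro!: divide_right_mono)
      hence b: "\<rho> \<le> s + \<theta> / T s" "\<rho> \<le> s + \<theta>' / T s" using \<rho> by linarith+
      have "prox \<rho> (deriv X) = prox \<rho> (\<lambda>z. deriv X z / X z * X z)"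
        using elim \<rho> good_nz[OF gX] by (intro prox_cong) auto
      also have "\<dots> \<le> prox \<rho> (\<lambda>z. deriv X z / X z) + prox \<rho> X"
        using elim \<rho> by (intro prox_mult_le gq gX) auto
      also have "\<dots> \<le> L s + c * T s"
        using elim(1,2) b \<rho> gX by (intro add_mono) auto
      also have "\<dots> \<le> (c + 1) * T s" using elim(3) by (simp add: algebra_simps)
      finally show "prox \<rho> (deriv X) \<le> (c + 1) * T s" .
    qed
  qed
  moreover have "countable (U \<union> {r. \<not> good X r})" using U countable_bad_radii[OF mX] by simp
  moreover have "0 < \<theta>''" "\<theta>'' \<le> 1/2" using \<theta> L(1) by (auto simp: \<theta>''_def)
  moreover have "1 \<le> c + 1" using c by simp
  ultimately show ?thesis unfolding tame_def using X' fin_sing_deriv[OF fs] by blast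
qed

lemma tame_poly:
  assumes X: "tame X" and m: "mero (\<lambda>z. poly A (X z))"
  shows "tame (\<lambda>z. poly A (X z))"
proof -
  from X obtain \<theta> c U where mX: "mero X" and fs: "fin_sing X" and \<theta>: "0 < \<theta>" "\<theta> \<le> 1/2" and c: "1 \<le> c"
    and U: "countable U"
    and ev: "eventually (\<lambda>s. \<forall>\<rho>. s \<le> \<rho> \<longrightarrow> \<rho> \<le> s + \<theta> / T s \<longrightarrow> good X \<rho> \<longrightarrow> \<rho> \<notin> U \<longrightarrow> prox \<rho> X \<le> c * T s) radii"
    unfolding tame_def by blast
  obtain C where C: "C \<ge> 0" "\<And>X r. r \<ge> 0 \<Longrightarrow> good X r \<Longrightarrow> good (\<lambda>z. poly A (X z)) r \<Longrightarrow>
    prox r (\<lambda>z. poly A (X z)) \<le> degree A * prox r X + C"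
    using prox_poly_le[of A] by blast
  define c' where "c' = degree A * c + C + 1"
  have "eventually (\<lambda>s. \<forall>\<rho>. s \<le> \<rho> \<longrightarrow> \<rho> \<le> s + \<theta> / T s \<longrightarrow> good (\<lambda>z. poly A (X z)) \<rho> \<longrightarrow>
      \<rho> \<notin> U \<union> {r. \<not> good X r} \<longrightarrow> prox \<rho> (\<lambda>z. poly A (X z)) \<le> c' * T s) radii"
    using ev radii_T_ge[of 1] radii_ge[of 0]
  proof eventually_elim
    case (elim s)
    show ?case
    proof (intro allI impI)
      fix \<rho> assume \<rho>: "s \<le> \<rho>" "\<rho> \<le> s + \<theta> / T s" "good (\<lambda>z. poly A (X z)) \<rho>" "\<rho> \<notin> U \<union> {r. \<not> good X r}"
      have "prox \<rho> (\<lambda>z. poly A (X z)) \<le> degree A * prox \<rho> X + C"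
        using \<rho> elim by (intro C) auto
      also have "\<dots> \<le> degree A * (c * T s) + C * T s"
        using elim \<rho> C(1) mult_left_mono[of 1 "T s" C] by (intro add_mono mult_left_mono) auto
      also have "\<dots> \<le> c' * T s" using elim by (simp add: c'_def algebra_simps)
      finally show "prox \<rho> (\<lambda>z. poly A (X z)) \<le> c' * T s" .
    qed
  qed
  moreover have "countable (U \<union> {r. \<not> good X r})" using U countable_bad_radii[OF mX] by simp
  moreover have "1 \<le> c'" using c C by (simp add: c'_def)
  ultimately show ?thesis unfolding tame_def using m fin_sing_poly[OF fs] \<theta> by blast
qed

end

section \<open>Meromorphic functions with finitely many poles\<close>

definition admissible :: "(complex \<Rightarrow> complex) \<Rightarrow> bool" where
  "admissible f \<longleftrightarrow> f nicely_meromorphic_on UNIV \<and> \<not> f constant_on UNIV \<and> finite {z. is_pole f z}"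

lemma admissible_analytic: "admissible f \<Longrightarrow> \<not> is_pole f z \<Longrightarrow> f analytic_on {z}"
  unfolding admissible_def using nicely_meromorphic_on_imp_analytic_at[of f UNIV z] by simp

lemma admissible_meromorphic: "admissible f \<Longrightarrow> f meromorphic_on UNIV"
  unfolding admissible_def nicely_meromorphic_on_def by simp

lemma admissible_fin_sing: "admissible f \<Longrightarrow> fin_sing f"
proof -
  assume f: "admissible f"
  have "{z. \<not> f analytic_on {z}} \<subseteq> {z. is_pole f z}" using admissible_analytic[OF f] by blast
  thus ?thesis using f unfolding fin_sing_def admissible_def by (meson finite_subset)
qed

lemma admissible_avoids:
  assumes "admissible f" shows "eventually (\<lambda>z. f z \<noteq> c) (cosparse UNIV)"
proof -
  have "\<not> (\<forall>x. f x = c)" using assms unfolding admissible_def constant_on_def by blast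
  thus ?thesis using nicely_meromorphic_imp_constant_or_avoid[of f UNIV c] assms
    unfolding admissible_def by auto
qed

lemma mero_diff_const:
  assumes "admissible f" shows "mero (\<lambda>z. f z - c)"
  using admissible_avoids[OF assms, of c] admissible_meromorphic[OF assms]
  by (auto simp: mero_def intro: meromorphic_intros)

lemma mero_admissible: "admissible f \<Longrightarrow> mero f"
  using mero_diff_const[of f 0] by simp

lemma mero_poly:
  assumes f: "admissible f" and A: "A \<noteq> 0" shows "mero (\<lambda>z. poly A (f z))"
proof -
  have "eventually (\<lambda>z. \<forall>c\<in>{c. poly A c = 0}. f z \<noteq> c) (cosparse UNIV)"
    using poly_roots_finite[OF A] admissible_avoids[OF f] by (intro eventually_ball_finite) auto
  hence "eventually (\<lambda>z. poly A (f z) \<noteq> 0) (cosparse UNIV)" by (rule eventually_mono) auto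
  moreover have "(\<lambda>z. poly A (f z)) meromorphic_on UNIV"
    by (induction A) (use admissible_meromorphic[OF f] in \<open>auto intro!: meromorphic_intros\<close>)
  ultimately show ?thesis by (simp add: mero_def)
qed

text \<open>
  A derivative that vanishes off a sparse set would make the function constant.
\<close>
lemma mero_deriv_admissible:
  assumes f: "admissible f" shows "mero (deriv f)"
proof (rule meroI)
  show "deriv f meromorphic_on UNIV" using admissible_meromorphic[OF f] by (rule meromorphic_on_deriv)
  show "\<not> eventually (\<lambda>z. deriv f z = 0) (cosparse UNIV)"
  proof
    assume ev: "eventually (\<lambda>z. deriv f z = 0) (cosparse UNIV)"
    define P where "P = {z. is_pole f z}"
    have P: "finite P" using f by (simp add: P_def admissible_def)
    have an: "f analytic_on {z}" if "z \<in> UNIV - P" for z using admissible_analytic[OF f] that by (simp add: P_def)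
    have d0: "deriv f z = 0" if z: "z \<in> UNIV - P" for z
    proof -
      have "isCont (deriv f) z" using analytic_at_imp_isCont[OF analytic_deriv[OF an[OF z]]] .
      hence "(deriv f \<longlongrightarrow> deriv f z) (at z)" by (simp add: isContD)
      moreover have "eventually (\<lambda>w. deriv f w = 0) (at z)"
        using eventually_cosparse_imp_eventually_at[OF ev] by simp
      hence "(deriv f \<longlongrightarrow> 0) (at z)" by (rule tendsto_eventually)
      ultimately show ?thesis using tendsto_unique[of "at z"] by auto
    qed
    have op: "open (UNIV - P)" using P by (simp add: open_Diff finite_imp_closed)
    have con: "connected (UNIV - P)"
      using P by (intro connected_open_diff_countable countable_finite) (auto simp: connected_UNIV)
    have der: "(f has_field_derivative 0) (at z)" if "z \<in> UNIV - P" for z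
      using analytic_on_imp_differentiable_at[OF an[OF that]] d0[OF that]
      by (metis DERIV_deriv_iff_field_differentiable insertI1)
    have "continuous_on (UNIV - P) f"
      using der by (meson DERIV_isCont continuous_at_imp_continuous_on)
    then obtain c where c: "\<And>z. z \<in> UNIV - P \<Longrightarrow> f z = c"
      using DERIV_zero_connected_constant[OF con op finite.emptyI] der by (metis Diff_empty)
    have "eventually (\<lambda>z. z \<notin> P) (cosparse UNIV)" by (rule eventually_not_in_cosparse[OF finite_imp_sparse[OF P]])
    with admissible_avoids[OF f, of c] have "eventually (\<lambda>z. False) (cosparse (UNIV :: complex set))"
      by eventually_elim (use c in auto)
    thus False by (simp add: trivial_limit_def[symmetric])
  qed
qed

lemma deriv_diff_const_at: "f analytic_on {z} \<Longrightarrow> deriv (\<lambda>w. f w - c) z = deriv f z"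
  by (subst deriv_diff) (auto intro: analytic_on_imp_differentiable_at)

lemma ord_poly_comp:
  assumes f: "admissible f" and A: "A \<noteq> 0" and z: "\<not> is_pole f z"
  shows "zorder (\<lambda>w. poly A (f w)) z = order (f z) A * zorder (\<lambda>w. f w - f z) z"
proof -
  obtain B where B: "A = [:- f z, 1:] ^ order (f z) A * B" "\<not> [:- f z, 1:] dvd B"
    using order_decomp[OF A] by blast
  have B0: "B \<noteq> 0" using A B(1) by auto
  have Bz: "poly B (f z) \<noteq> 0" using B(2) by (simp add: poly_eq_0_iff_dvd)
  have eq: "(\<lambda>w. poly A (f w)) = (\<lambda>w. (f w - f z) ^ order (f z) A * poly B (f w))"
    by (subst B(1)) (simp add: poly_mult poly_power)
  have "zorder (\<lambda>w. poly A (f w)) z = zorder (\<lambda>w. (f w - f z) ^ order (f z) A) z + zorder (\<lambda>w. poly B (f w)) z"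
    unfolding eq by (rule ord_mult) (intro mero_power mero_diff_const mero_poly f B0)+
  also have "zorder (\<lambda>w. poly B (f w)) z = 0"
    using Bz admissible_analytic[OF f z] by (intro ord_eq_0 analytic_on_poly_comp) auto
  also have "zorder (\<lambda>w. (f w - f z) ^ order (f z) A) z = order (f z) A * zorder (\<lambda>w. f w - f z) z"
    by (intro ord_power mero_diff_const f)
  finally show ?thesis by simp
qed

lemma ord_value_pos:
  assumes f: "admissible f" and z: "\<not> is_pole f z"
  shows "zorder (\<lambda>w. f w - f z) z \<ge> 1"
proof -
  have "zorder (\<lambda>w. f w - f z) z > 0"
    by (rule ord_pos[OF mero_diff_const[OF f]]) (use admissible_analytic[OF f z] in \<open>auto intro: analytic_intros\<close>)
  thus ?thesis by simp
qed

lemma ord_deriv: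
  assumes f: "admissible f" and z: "\<not> is_pole f z"
  shows "zorder (deriv f) z = zorder (\<lambda>w. f w - f z) z - 1"
proof -
  let ?h = "\<lambda>w. f w - f z"
  have mh: "mero ?h" by (rule mero_diff_const[OF f])
  have iso: "isolated_singularity_at ?h z" and ne: "not_essential ?h z"
    using mero_at(1)[OF mh] by (auto simp: meromorphic_at_iff)
  have "zorder (deriv ?h) z = zorder ?h z - 1"
    using ord_value_pos[OF f z] by (intro zorder_deriv_minus_1 iso ne mero_at(3)[OF mh]) simp
  moreover have "zorder (deriv ?h) z = zorder (deriv f) z"
  proof (rule zorder_cong)
    have "eventually (\<lambda>w. f analytic_on {w}) (cosparse UNIV)"
      using meromorphic_on_imp_analytic_cosparse[OF admissible_meromorphic[OF f]] .
    hence "eventually (\<lambda>w. f analytic_on {w}) (at z)" by (rule eventually_cosparse_imp_eventually_at) simp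
    thus "eventually (\<lambda>w. deriv ?h w = deriv f w) (at z)" by eventually_elim (rule deriv_diff_const_at)
  qed simp
  ultimately show ?thesis by simp
qed

text \<open>
  This replaces partial fractions: the induction step uses only
  \<open>1 / ((w - \<gamma>)(w - \<beta>)) = (1 / (w - \<gamma>) - 1 / (w - \<beta>)) / (\<gamma> - \<beta>)\<close>.
\<close>
lemma partial_fraction_bound:
  fixes B :: "complex set"
  assumes "finite B" "B \<noteq> {}"
  shows "\<exists>C\<ge>0. \<forall>w. w \<notin> B \<longrightarrow> 1 / norm (\<Prod>\<beta>\<in>B. w - \<beta>) \<le> C * (\<Sum>\<beta>\<in>B. 1 / norm (w - \<beta>))"
  using assms
proof (induction B rule: finite_ne_induct)
  case (singleton \<beta>)
  show ?case by (intro exI[of _ 1]) auto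
next
  case (insert \<gamma> B)
  then obtain C where C: "C \<ge> 0" "\<And>w. w \<notin> B \<Longrightarrow> 1 / norm (\<Prod>\<beta>\<in>B. w - \<beta>) \<le> C * (\<Sum>\<beta>\<in>B. 1 / norm (w - \<beta>))"
    by blast
  define M where "M = (\<Sum>\<beta>\<in>B. 1 / norm (\<gamma> - \<beta>))"
  have M: "M \<ge> 0" unfolding M_def by (intro sum_nonneg) auto
  show ?case
  proof (intro exI[of _ "C * M"] conjI allI impI)
    show "0 \<le> C * M" using C M by simp
    fix w assume w: "w \<notin> insert \<gamma> B"
    define S where "S = (\<Sum>\<beta>\<in>insert \<gamma> B. 1 / norm (w - \<beta>))"
    have "1 / norm (\<Prod>\<beta>\<in>insert \<gamma> B. w - \<beta>) = 1 / norm (w - \<gamma>) * (1 / norm (\<Prod>\<beta>\<in>B. w - \<beta>))"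
      using insert by (simp add: norm_mult)
    also have "\<dots> \<le> 1 / norm (w - \<gamma>) * (C * (\<Sum>\<beta>\<in>B. 1 / norm (w - \<beta>)))"
      using C(2)[of w] w by (intro mult_left_mono) auto
    also have "\<dots> = C * (\<Sum>\<beta>\<in>B. 1 / norm (w - \<gamma>) * (1 / norm (w - \<beta>)))"
      by (simp add: sum_distrib_left mult_ac)
    also have "\<dots> \<le> C * (\<Sum>\<beta>\<in>B. 1 / norm (\<gamma> - \<beta>) * S)"
    proof (intro mult_left_mono sum_mono C)
      fix \<beta> assume \<beta>: "\<beta> \<in> B"
      have ne: "\<gamma> - \<beta> \<noteq> 0" "w - \<gamma> \<noteq> 0" "w - \<beta> \<noteq> 0" using \<beta> insert w by auto
      have "1 / (w - \<gamma>) * (1 / (w - \<beta>)) = 1 / (\<gamma> - \<beta>) * (1 / (w - \<gamma>) - 1 / (w - \<beta>))"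
        using ne by (simp add: field_simps)
      hence "norm (1 / (w - \<gamma>) * (1 / (w - \<beta>))) = norm (1 / (\<gamma> - \<beta>)) * norm (1 / (w - \<gamma>) - 1 / (w - \<beta>))"
        by (metis norm_mult)
      also have "\<dots> \<le> norm (1 / (\<gamma> - \<beta>)) * (norm (1 / (w - \<gamma>)) + norm (1 / (w - \<beta>)))"
        by (intro mult_left_mono norm_triangle_ineq4) auto
      also have "norm (1 / (w - \<gamma>)) + norm (1 / (w - \<beta>)) \<le> S"
      proof -
        have "1 / norm (w - \<beta>) \<le> (\<Sum>\<beta>\<in>B. 1 / norm (w - \<beta>))"
          using insert \<beta> by (intro member_le_sum[of \<beta> B "\<lambda>\<beta>. 1 / norm (w - \<beta>)"]) auto
        thus ?thesis using insert by (simp add: S_def norm_divide)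
      qed
      finally show "1 / norm (w - \<gamma>) * (1 / norm (w - \<beta>)) \<le> 1 / norm (\<gamma> - \<beta>) * S"
        by (simp add: norm_mult norm_divide divide_right_mono mult_left_mono)
    qed
    also have "\<dots> = C * M * S" by (simp add: M_def sum_distrib_right)
    finally show "1 / norm (\<Prod>\<beta>\<in>insert \<gamma> B. w - \<beta>) \<le> C * M * (\<Sum>\<beta>\<in>insert \<gamma> B. 1 / norm (w - \<beta>))"
      by (simp add: S_def)
  qed
qed

lemma ln_max_sum_le:
  fixes x :: "'b \<Rightarrow> real"
  assumes "finite B" "B \<noteq> {}" "\<And>b. b \<in> B \<Longrightarrow> 0 \<le> x b" "C \<ge> 0"
  shows "ln (max 1 (C * (\<Sum>b\<in>B. x b))) \<le> ln (max 1 (C * card B)) + (\<Sum>b\<in>B. ln (max 1 (x b)))"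
proof -
  define p where "p = (\<Prod>b\<in>B. max 1 (x b))"
  have p1: "p \<ge> 1" unfolding p_def by (intro prod_ge_1) auto
  have "x b \<le> p" if "b \<in> B" for b
  proof -
    have "x b \<le> max 1 (x b) * 1" by simp
    also have "\<dots> \<le> max 1 (x b) * (\<Prod>b\<in>B - {b}. max 1 (x b))" by (intro mult_left_mono prod_ge_1) auto
    also have "\<dots> = p" unfolding p_def using assms(1) that by (rule prod.remove[symmetric])
    finally show ?thesis .
  qed
  hence "(\<Sum>b\<in>B. x b) \<le> card B * p" using sum_bounded_above[of B x p] by simp
  hence "C * (\<Sum>b\<in>B. x b) \<le> C * (card B * p)" using assms(4) by (intro mult_left_mono) auto
  also have "\<dots> \<le> max 1 (C * card B) * p" using p1 by (simp add: mult.assoc[symmetric])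
  finally have "C * (\<Sum>b\<in>B. x b) \<le> max 1 (C * card B) * p" .
  moreover have "1 * 1 \<le> max 1 (C * card B) * p" using p1 by (intro mult_mono) auto
  ultimately have "ln (max 1 (C * (\<Sum>b\<in>B. x b))) \<le> ln (max 1 (C * card B) * p)" by (intro ln_mono) auto
  also have "\<dots> = ln (max 1 (C * card B)) + ln p" using p1 by (intro ln_mult_pos) auto
  also have "ln p = (\<Sum>b\<in>B. ln (max 1 (x b)))" unfolding p_def using assms(1) by (intro ln_prod) auto
  finally show ?thesis .
qed

text \<open>
  With \<open>d = f'\<close> and \<open>w = f\<close>: for large \<open>w\<close> the product is comparable to \<open>w^q\<close>, where \<open>q\<close> is the cardinality of \<open>B\<close>,
  so \<open>w^(q-1)\<close> is at most a constant times \<open>(\<Prod> / d) * (d / w)\<close>; for bounded \<open>w\<close> the constant suffices.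
\<close>
lemma inverse_growth:
  fixes B :: "complex set"
  assumes B: "finite B" "B \<noteq> {}"
  obtains C where "\<And>w d. w \<noteq> 0 \<Longrightarrow> d \<noteq> 0 \<Longrightarrow> w \<notin> B \<Longrightarrow>
    (card B - 1) * ln (max 1 (norm w)) \<le> C + ln (max 1 (norm ((\<Prod>\<beta>\<in>B. w - \<beta>) / d))) + ln (max 1 (norm (d / w)))"
proof -
  define q where "q = card B"
  have q: "q \<ge> 1" using B by (simp add: q_def Suc_le_eq card_gt_0_iff)
  define R where "R = 1 + 2 * (\<Sum>\<beta>\<in>B. norm \<beta>)"
  have Rb: "2 * norm \<beta> \<le> R" if "\<beta> \<in> B" for \<beta>
    using member_le_sum[of \<beta> B norm] B(1) that by (simp add: R_def)
  have R1: "R \<ge> 1" by (simp add: R_def sum_nonneg)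
  show thesis
  proof (rule that[of "q * ln 2 + q * ln R"])
    fix w d :: complex assume w: "w \<noteq> 0" "d \<noteq> 0" "w \<notin> B"
    define y where "y = norm ((\<Prod>\<beta>\<in>B. w - \<beta>) / d)"
    define v where "v = norm (d / w)"
    have y0: "y > 0" using w B by (simp add: y_def)
    have v0: "v > 0" using w by (simp add: v_def)
    have nn: "0 \<le> ln (max 1 y)" "0 \<le> ln (max 1 v)" "0 \<le> q * ln 2" "0 \<le> q * ln R" using R1 by auto
    show "(card B - 1) * ln (max 1 (norm w)) \<le> q * ln 2 + q * ln R + ln (max 1 (norm ((\<Prod>\<beta>\<in>B. w - \<beta>) / d))) + ln (max 1 (norm (d / w)))"
    proof (cases "norm w \<le> R")
      case True
      hence "ln (max 1 (norm w)) \<le> ln R" using R1 by (intro ln_mono) auto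
      hence "(q - 1) * ln (max 1 (norm w)) \<le> q * ln R" using R1 by (intro mult_mono) auto
      thus ?thesis using nn unfolding q_def[symmetric] y_def[symmetric] v_def[symmetric] by linarith
    next
      case False
      have "(norm w / 2) ^ q = (\<Prod>\<beta>\<in>B. norm w / 2)" by (simp add: q_def)
      also have "\<dots> \<le> (\<Prod>\<beta>\<in>B. norm (w - \<beta>))"
      proof (rule prod_mono, intro conjI)
        fix \<beta> assume "\<beta> \<in> B"
        thus "norm w / 2 \<le> norm (w - \<beta>)" using Rb[of \<beta>] False norm_triangle_ineq2[of w \<beta>] by linarith
      qed auto
      also have "\<dots> = y * norm d" using w by (simp add: y_def norm_divide prod_norm)
      also have "\<dots> = y * v * norm w" using w by (simp add: v_def norm_divide)
      finally have "(norm w / 2) ^ q \<le> y * v * norm w" .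
      hence "(norm w) ^ q \<le> 2 ^ q * (y * v * norm w)" by (simp add: power_divide field_simps)
      moreover have "norm w ^ q = norm w ^ (q - 1) * norm w" using q by (cases q) auto
      ultimately have "norm w ^ (q - 1) * norm w \<le> (2 ^ q * (y * v)) * norm w" by (simp add: mult_ac)
      hence "norm w ^ (q - 1) \<le> 2 ^ q * (y * v)" using w by (simp add: mult_le_cancel_right)
      hence "ln (norm w ^ (q - 1)) \<le> ln (2 ^ q * (y * v))" using w by (intro ln_mono) auto
      hence "(q - 1) * ln (norm w) \<le> q * ln 2 + ln y + ln v"
        using y0 v0 by (simp add: ln_realpow ln_mult)
      moreover have "ln y \<le> ln (max 1 y)" "ln v \<le> ln (max 1 v)" using y0 v0 by (auto intro!: ln_mono)
      moreover have "max 1 (norm w) = norm w" using False R1 by simp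
      ultimately show ?thesis using nn unfolding q_def[symmetric] y_def[symmetric] v_def[symmetric] by simp
    qed
  qed
qed

section \<open>The second main theorem\<close>

lemma good_divide: "good X r \<Longrightarrow> good Y r \<Longrightarrow> good (\<lambda>z. X z / Y z) r"
  by (auto simp: good_def intro!: analytic_intros)

lemma prox_inverse:
  assumes "good X r" "r \<ge> 0"
  shows "prox r (\<lambda>z. 1 / X z) = prox r X - cmean r (\<lambda>z. ln (norm (X z)))"
proof -
  have "prox r (\<lambda>z. 1 / X z) = cmean r (\<lambda>z. ln (max 1 (norm (X z))) + (-1) * ln (norm (X z)))"
    unfolding prox_def
  proof (rule cmean_cong[OF assms(2)])
    fix z :: complex assume "norm z = r"
    hence "X z \<noteq> 0" using good_nz[OF assms(1)] by blast
    thus "ln (max 1 (norm (1 / X z))) = ln (max 1 (norm (X z))) + (-1) * ln (norm (X z))"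
      by (cases "norm (X z) \<ge> 1") (auto simp: max_def norm_divide ln_div)
  qed
  also have "\<dots> = cmean r (\<lambda>z. ln (max 1 (norm (X z)))) + cmean r (\<lambda>z. (-1) * ln (norm (X z)))"
    by (rule cmean_add[OF good_lnmax_continuous[OF assms(1)] _ assms(2)])
      (rule continuous_on_mult[OF continuous_on_const good_ln_continuous[OF assms(1)]])
  finally show ?thesis by (simp only: cmean_cmult prox_def)
qed

lemma deriv_diff_const_on_good:
  assumes "good (\<lambda>z. f z - \<beta>) r" "norm z = r"
  shows "deriv (\<lambda>z. f z - \<beta>) z = deriv f z"
proof -
  have "(\<lambda>z. f z - \<beta>) analytic_on {z}" using assms by (simp add: good_def)
  from analytic_on_add[OF this analytic_on_const[of \<beta>]] have "f analytic_on {z}" by simp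
  thus ?thesis by (rule deriv_diff_const_at)
qed

context growth
begin

lemma small_sum:
  assumes "finite I" "\<And>i. i \<in> I \<Longrightarrow> small (u i)"
  shows "small (\<lambda>r. \<Sum>i\<in>I. u i r)"
  using assms
proof (induction I rule: finite_induct)
  case empty thus ?case using small_const[of 0] by simp
next
  case (insert i I)
  have "small (\<lambda>r. u i r + (\<Sum>i\<in>I. u i r))" using insert by (intro small_add) auto
  thus ?case using insert by simp
qed

text \<open>
  This is what slow growth of \<open>T\<close> at the radii of the filter is for.
\<close>
lemma tame_of_prox_le:
  assumes f: "admissible f" and le: "\<And>r. r \<ge> r0 \<Longrightarrow> prox r f \<le> T r"
  shows "tame f"
proof -
  have "eventually (\<lambda>s. \<forall>\<rho>. s \<le> \<rho> \<longrightarrow> \<rho> \<le> s + (1/2) / T s \<longrightarrow> good f \<rho> \<longrightarrow> \<rho> \<notin> {} \<longrightarrow> prox \<rho> f \<le> 4 * T s) radii"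
    using radii_slow
  proof eventually_elim
    case (elim s)
    show ?case
    proof (intro allI impI)
      fix \<rho> assume \<rho>: "s \<le> \<rho>" "\<rho> \<le> s + (1/2) / T s"
      have "T \<rho> \<le> 4 * T s" using elim \<rho> by (auto simp: slow_def)
      moreover have "prox \<rho> f \<le> T \<rho>" using elim \<rho> by (intro le) (auto simp: slow_def)
      ultimately show "prox \<rho> f \<le> 4 * T s" by simp
    qed
  qed
  thus ?thesis unfolding tame_def using mero_admissible[OF f] admissible_fin_sing[OF f]
    by (intro conjI exI[of _ "1/2"] exI[of _ 4] exI[of _ "{}"]) auto
qed

lemma tame_diff_const:
  assumes f: "admissible f" "tame f" shows "tame (\<lambda>z. f z - c)"
proof -
  have "tame (\<lambda>z. poly [:- c, 1:] (f z))"
    by (rule tame_poly[OF f(2)]) (use mero_diff_const[OF f(1), of c] in simp)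
  thus ?thesis by simp
qed

lemma log_deriv_diff_small:
  assumes f: "admissible f" "tame f"
  shows "small (\<lambda>r. prox r (\<lambda>z. deriv f z / (f z - \<beta>)))"
proof (rule small_mono[OF logarithmic_derivative_small[OF tame_diff_const[OF f, of \<beta>]]])
  show "eventually (\<lambda>r. prox r (\<lambda>z. deriv f z / (f z - \<beta>)) \<le>
      prox r (\<lambda>z. deriv (\<lambda>z. f z - \<beta>) z / (f z - \<beta>))) radii"
    using radii_good[OF mero_diff_const[OF f(1), of \<beta>]] radii_ge[of 0]
  proof eventually_elim
    case (elim r)
    have "prox r (\<lambda>z. deriv f z / (f z - \<beta>)) = prox r (\<lambda>z. deriv (\<lambda>z. f z - \<beta>) z / (f z - \<beta>))"
      using elim by (intro prox_cong) (auto simp: deriv_diff_const_on_good)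
    thus ?case by simp
  qed
qed

text \<open>
  Let \<open>\<psi> = f' / \<Prod>(f - \<beta>)\<close>. By \<open>partial_fraction_bound\<close> and the lemma on the logarithmic derivative,
  \<open>prox r \<psi>\<close> is negligible. Jensen's formula then gives \<open>prox r (1 / \<psi>) = - N(\<psi>) + o(T)\<close>, and
  \<open>inverse_growth\<close> bounds \<open>(q - 1) prox r f\<close> by \<open>prox r (1 / \<psi>)\<close> plus the negligible \<open>prox r (f' / f)\<close>.
\<close>
theorem second_main_theorem:
  assumes f: "admissible f" "tame f" and B: "finite B" "B \<noteq> {}"
  obtains u where "small u" "eventually (\<lambda>r. (card B - 1) * prox r f
    \<le> - Ncount (ord (\<lambda>z. deriv f z / (\<Prod>\<beta>\<in>B. f z - \<beta>))) r + u r) radii"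
proof -
  define \<psi> where "\<psi> z = deriv f z / (\<Prod>\<beta>\<in>B. f z - \<beta>)" for z
  have mB: "mero (\<lambda>z. \<Prod>\<beta>\<in>B. f z - \<beta>)" by (intro mero_prod B mero_diff_const f)
  have m\<psi>: "mero \<psi>" unfolding \<psi>_def[abs_def] by (intro mero_divide mero_deriv_admissible mB f)
  obtain C0 where C0: "\<And>r. r \<ge> 1 \<Longrightarrow> good \<psi> r \<Longrightarrow> cmean r (\<lambda>z. ln (norm (\<psi> z))) = C0 + Ncount (ord \<psi>) r"
    using jensen[OF m\<psi>] by blast
  obtain C1 where C1: "C1 \<ge> 0" "\<And>w. w \<notin> B \<Longrightarrow> 1 / norm (\<Prod>\<beta>\<in>B. w - \<beta>) \<le> C1 * (\<Sum>\<beta>\<in>B. 1 / norm (w - \<beta>))"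
    using partial_fraction_bound[OF B] by blast
  obtain C2 where C2: "\<And>w d. w \<noteq> 0 \<Longrightarrow> d \<noteq> 0 \<Longrightarrow> w \<notin> B \<Longrightarrow>
    (card B - 1) * ln (max 1 (norm w)) \<le> C2 + ln (max 1 (norm ((\<Prod>\<beta>\<in>B. w - \<beta>) / d))) + ln (max 1 (norm (d / w)))"
    using inverse_growth[OF B] by blast
  define c1 where "c1 = ln (max 1 (C1 * card B))"
  define u where "u r = (C2 + c1 - C0) + ((\<Sum>\<beta>\<in>B. prox r (\<lambda>z. deriv f z / (f z - \<beta>))) + prox r (\<lambda>z. deriv f z / (f z - 0)))" for r
  have "small u" unfolding u_def
    by (intro small_add small_const small_sum B log_deriv_diff_small f)
  moreover have "eventually (\<lambda>r. (card B - 1) * prox r f \<le> - Ncount (ord \<psi>) r + u r) radii"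
  proof -
    have "eventually (\<lambda>r. \<forall>\<beta>\<in>B. good (\<lambda>z. f z - \<beta>) r) radii"
      using B radii_good[OF mero_diff_const[OF f(1)]] by (intro eventually_ball_finite) auto
    thus ?thesis
      using radii_ge[of 1] radii_good[OF m\<psi>] radii_good[OF mero_admissible[OF f(1)]]
        radii_good[OF mero_deriv_admissible[OF f(1)]]
    proof eventually_elim
      case (elim r)
      hence r: "r \<ge> 1" "r \<ge> 0" and g\<psi>: "good \<psi> r" and gf: "good f r" and gd: "good (deriv f) r"
        and g\<beta>: "\<And>\<beta>. \<beta> \<in> B \<Longrightarrow> good (\<lambda>z. f z - \<beta>) r" by auto
      have gq: "good (\<lambda>z. deriv f z / (f z - \<beta>)) r" if "\<beta> \<in> B" for \<beta>
        by (rule good_divide[OF gd g\<beta>[OF that]])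
      have gi: "good (\<lambda>z. 1 / \<psi> z) r" using g\<psi> by (auto simp: good_def intro!: analytic_intros)
      have gl: "good (\<lambda>z. deriv f z / f z) r" by (rule good_divide[OF gd gf])
      have nB: "f z \<notin> B" if "norm z = r" for z using g\<beta> good_nz[OF _ that] by fastforce
      have "prox r \<psi> \<le> cmean r (\<lambda>z. c1 + (\<Sum>\<beta>\<in>B. ln (max 1 (norm (deriv f z / (f z - \<beta>))))))"
        unfolding prox_def
      proof (rule cmean_mono)
        fix z :: complex assume z: "norm z = r"
        have "norm (\<psi> z) = norm (deriv f z) * (1 / norm (\<Prod>\<beta>\<in>B. f z - \<beta>))" by (simp add: \<psi>_def norm_divide)
        also have "\<dots> \<le> norm (deriv f z) * (C1 * (\<Sum>\<beta>\<in>B. 1 / norm (f z - \<beta>)))"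
          by (intro mult_left_mono C1 nB z) auto
        also have "\<dots> = C1 * (\<Sum>\<beta>\<in>B. norm (deriv f z / (f z - \<beta>)))"
          by (simp add: norm_divide sum_distrib_left mult_ac)
        finally have "norm (\<psi> z) \<le> C1 * (\<Sum>\<beta>\<in>B. norm (deriv f z / (f z - \<beta>)))" .
        hence "ln (max 1 (norm (\<psi> z))) \<le> ln (max 1 (C1 * (\<Sum>\<beta>\<in>B. norm (deriv f z / (f z - \<beta>)))))"
          by (intro ln_mono) auto
        also have "\<dots> \<le> c1 + (\<Sum>\<beta>\<in>B. ln (max 1 (norm (deriv f z / (f z - \<beta>)))))"
          unfolding c1_def by (rule ln_max_sum_le[OF B _ C1(1)]) auto
        finally show "ln (max 1 (norm (\<psi> z))) \<le> c1 + (\<Sum>\<beta>\<in>B. ln (max 1 (norm (deriv f z / (f z - \<beta>)))))" .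
      qed (intro good_lnmax_continuous g\<psi> continuous_on_add continuous_on_const continuous_on_sum gq r | assumption)+
      also have "\<dots> = c1 + (\<Sum>\<beta>\<in>B. prox r (\<lambda>z. deriv f z / (f z - \<beta>)))"
        unfolding prox_def
        by (subst cmean_add[OF continuous_on_const continuous_on_sum[OF good_lnmax_continuous[OF gq]] r(2)])
          (simp_all add: cmean_const cmean_sum[OF good_lnmax_continuous[OF gq] r(2) B(1)])
      finally have 1: "prox r \<psi> \<le> c1 + (\<Sum>\<beta>\<in>B. prox r (\<lambda>z. deriv f z / (f z - \<beta>)))" .
      have 2: "prox r (\<lambda>z. 1 / \<psi> z) = prox r \<psi> - (C0 + Ncount (ord \<psi>) r)"
        using prox_inverse[OF g\<psi> r(2)] C0[OF r(1) g\<psi>] by simp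
      have "(card B - 1) * prox r f = cmean r (\<lambda>z. (card B - 1) * ln (max 1 (norm (f z))))"
        unfolding prox_def cmean_cmult ..
      also have "\<dots> \<le> cmean r (\<lambda>z. (C2 + ln (max 1 (norm (1 / \<psi> z)))) + ln (max 1 (norm (deriv f z / f z))))"
      proof (rule cmean_mono)
        fix z :: complex assume z: "norm z = r"
        have "(card B - 1) * ln (max 1 (norm (f z))) \<le> C2 + ln (max 1 (norm ((\<Prod>\<beta>\<in>B. f z - \<beta>) / deriv f z))) + ln (max 1 (norm (deriv f z / f z)))"
          using good_nz[OF gf z] good_nz[OF gd z] nB[OF z] by (intro C2) auto
        thus "(card B - 1) * ln (max 1 (norm (f z))) \<le> (C2 + ln (max 1 (norm (1 / \<psi> z)))) + ln (max 1 (norm (deriv f z / f z)))"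
          by (simp add: \<psi>_def)
      qed (intro good_lnmax_continuous gi gl gf continuous_on_add continuous_on_mult continuous_on_const r)+
      also have "\<dots> = C2 + prox r (\<lambda>z. 1 / \<psi> z) + prox r (\<lambda>z. deriv f z / f z)"
        unfolding prox_def
        by (simp only: cmean_const
            cmean_add[OF continuous_on_add[OF continuous_on_const good_lnmax_continuous[OF gi]] good_lnmax_continuous[OF gl] r(2)]
            cmean_add[OF continuous_on_const good_lnmax_continuous[OF gi] r(2)])
      finally have "(card B - 1) * prox r f \<le> C2 + prox r (\<lambda>z. 1 / \<psi> z) + prox r (\<lambda>z. deriv f z / f z)" .
      thus ?case using 1 2 unfolding u_def by (simp add: diff_zero)
    qed
  qed
  ultimately show thesis using that unfolding \<psi>_def[abs_def] by blast
qed

end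

section \<open>Orders of a logarithmic derivative\<close>

lemma mero_of_log_deriv:
  assumes "mero (\<lambda>z. deriv \<rho> z / \<rho> z)" "mero \<rho>"
  shows "mero (deriv \<rho>)"
proof -
  have "eventually (\<lambda>z. deriv \<rho> z / \<rho> z \<noteq> 0) (cosparse UNIV)" using assms(1) by (simp add: mero_def)
  hence "eventually (\<lambda>z. deriv \<rho> z \<noteq> 0) (cosparse UNIV)" by (rule eventually_mono) auto
  thus ?thesis using meromorphic_on_deriv[OF mero_meromorphic[OF assms(2)]] by (simp add: mero_def)
qed

text \<open>
  The assumption on \<open>\<rho>' / \<rho>\<close> excludes constant \<open>\<rho>\<close>, for which orders of \<open>\<rho>'\<close> would be meaningless.
\<close>
lemma ord_log_deriv:
  assumes m: "mero (\<lambda>z. deriv \<rho> z / \<rho> z)" "mero \<rho>"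
  shows "zorder (\<lambda>z. deriv \<rho> z / \<rho> z) z \<ge> - 1"
    "zorder \<rho> z = 0 \<Longrightarrow> zorder (\<lambda>z. deriv \<rho> z / \<rho> z) z \<ge> 0"
proof -
  have m': "mero (deriv \<rho>)" by (rule mero_of_log_deriv[OF m])
  have o: "zorder (\<lambda>z. deriv \<rho> z / \<rho> z) z = zorder (deriv \<rho>) z - zorder \<rho> z"
    by (rule ord_divide[OF m' m(2)])
  have iso: "isolated_singularity_at \<rho> z" and ne: "not_essential \<rho> z"
    using mero_at(1)[OF m(2)] by (auto simp: meromorphic_at_iff)
  show 0: "zorder (\<lambda>z. deriv \<rho> z / \<rho> z) z \<ge> 0" if "zorder \<rho> z = 0"
  proof (rule ccontr)
    assume "\<not> ?thesis"
    hence "zorder (deriv \<rho>) z < 0" using o that by simp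
    hence "is_pole (deriv \<rho>) z" by (rule zorder_neg_imp_is_pole[OF mero_at(1,2)[OF m']])
    hence "is_pole \<rho> z" using is_pole_deriv_iff[OF mero_at(1)[OF m(2)]] by simp
    hence "zorder \<rho> z < 0" by (rule isolated_pole_imp_neg_zorder[OF iso])
    thus False using that by simp
  qed
  show "zorder (\<lambda>z. deriv \<rho> z / \<rho> z) z \<ge> - 1"
  proof (cases "zorder \<rho> z = 0")
    case False
    have "zorder (deriv \<rho>) z = zorder \<rho> z - 1"
      by (rule zorder_deriv_minus_1[OF iso ne mero_at(3)[OF m(2)] False])
    thus ?thesis using o by simp
  qed (use 0 in simp)
qed

lemma simple_zero_factor:
  assumes k: "k analytic_on {z}" "k z = 0" "deriv k z \<noteq> 0"
  obtains r h where "r > 0" "h holomorphic_on ball z r" "h z \<noteq> 0" "\<And>w. w \<in> ball z r \<Longrightarrow> h w \<noteq> 0"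
    "\<And>w. w \<in> ball z r \<Longrightarrow> k w = h w * (w - z)"
    "\<And>w. w \<in> ball z r \<Longrightarrow> deriv k w = deriv h w * (w - z) + h w"
proof -
  have z1: "zorder k z = 1"
    by (rule zorder_zero_eqI'[OF k(1)]) (use k in auto)
  have fr: "frequently (\<lambda>w. k w \<noteq> 0) (at z)"
  proof (rule ccontr)
    assume "\<not> ?thesis"
    hence "eventually (\<lambda>w. k w = 0) (at z)" by (simp add: frequently_def)
    hence "eventually (\<lambda>w. k w = 0) (nhds z)" using k(2) by (simp add: eventually_nhds_conv_at)
    hence "deriv k z = deriv (\<lambda>_. 0) z" by (intro deriv_cong_ev) auto
    thus False using k(3) by simp
  qed
  have mk: "k meromorphic_on {z}" using k(1) by (rule analytic_on_imp_meromorphic_on)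
  hence iso: "isolated_singularity_at k z" and ne: "not_essential k z" by (auto simp: meromorphic_at_iff)
  define h where "h = zor_poly k z"
  obtain r where r: "h z \<noteq> 0" "r > 0" "h holomorphic_on cball z r"
    "\<And>w. w \<in> cball z r - {z} \<Longrightarrow> k w = h w * (w - z) powi 1 \<and> h w \<noteq> 0"
    using zorder_exist[OF iso ne fr] unfolding z1 h_def by blast
  have hol: "h holomorphic_on ball z r" using r(3) by (rule holomorphic_on_subset) auto
  have nz: "h w \<noteq> 0" if "w \<in> ball z r" for w using r(1) r(4)[of w] that by (cases "w = z") auto
  have eq: "k w = h w * (w - z)" if "w \<in> ball z r" for w
    using r(4)[of w] that k(2) by (cases "w = z") auto
  have d: "deriv k w = deriv h w * (w - z) + h w" if w: "w \<in> ball z r" for w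
  proof -
    have "(h has_field_derivative deriv h w) (at w)" using holomorphic_derivI[OF hol open_ball w] .
    hence "((\<lambda>w. h w * (w - z)) has_field_derivative deriv h w * (w - z) + h w) (at w)"
      by (auto intro!: derivative_eq_intros)
    hence "(k has_field_derivative deriv h w * (w - z) + h w) (at w)"
      by (rule has_field_derivative_transform_within_open[OF _ open_ball w]) (simp add: eq)
    thus ?thesis by (rule DERIV_imp_deriv)
  qed
  show thesis by (rule that[OF r(2) hol r(1) nz eq d])
qed

text \<open>
  If \<open>k = h(w) (w - z)\<close> with \<open>h(z) \<noteq> 0\<close>, then \<open>k' / k^2 = (h + h' (w - z)) / (h^2 (w - z)^2)\<close>. The derivative of
  the numerator over \<open>h^2\<close> at \<open>z\<close> is \<open>2 h' / h^2 - 2 h' / h^2 = 0\<close>: the function \<open>k' / k^2\<close> has no residue at \<open>z\<close>, being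
  the derivative of \<open>- 1 / k\<close>. So the quotient of two such functions is, up to a removable singularity, a non-vanishing function \<open>\<sigma>\<close>
  with \<open>\<sigma>'(z) = 0\<close>.
\<close>
lemma cancellation_at_simple_zeros:
  assumes k1: "k1 analytic_on {z}" "k1 z = 0" "deriv k1 z \<noteq> 0"
    and k2: "k2 analytic_on {z}" "k2 z = 0" "deriv k2 z \<noteq> 0"
    and ev: "eventually (\<lambda>w. \<rho> w = (deriv k1 w / k1 w ^ 2) / (deriv k2 w / k2 w ^ 2)) (at z)"
    and m: "mero (\<lambda>w. deriv \<rho> w / \<rho> w)"
  shows "zorder (\<lambda>w. deriv \<rho> w / \<rho> w) z \<ge> 1"
proof -
  obtain r1 h1 where h1: "r1 > 0" "h1 holomorphic_on ball z r1" "h1 z \<noteq> 0" "\<And>w. w \<in> ball z r1 \<Longrightarrow> h1 w \<noteq> 0"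
    "\<And>w. w \<in> ball z r1 \<Longrightarrow> k1 w = h1 w * (w - z)"
    "\<And>w. w \<in> ball z r1 \<Longrightarrow> deriv k1 w = deriv h1 w * (w - z) + h1 w"
    using simple_zero_factor[OF k1] by blast
  obtain r2 h2 where h2: "r2 > 0" "h2 holomorphic_on ball z r2" "h2 z \<noteq> 0" "\<And>w. w \<in> ball z r2 \<Longrightarrow> h2 w \<noteq> 0"
    "\<And>w. w \<in> ball z r2 \<Longrightarrow> k2 w = h2 w * (w - z)"
    "\<And>w. w \<in> ball z r2 \<Longrightarrow> deriv k2 w = deriv h2 w * (w - z) + h2 w"
    using simple_zero_factor[OF k2] by blast
  define N1 where "N1 w = deriv h1 w * (w - z) + h1 w" for w
  define N2 where "N2 w = deriv h2 w * (w - z) + h2 w" for w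
  define \<sigma> where "\<sigma> w = (N1 w / N2 w) * (h2 w / h1 w)^2" for w
  have a1: "h1 analytic_on {z}" using h1 by (auto simp: analytic_at intro: exI[of _ "ball z r1"])
  have a2: "h2 analytic_on {z}" using h2 by (auto simp: analytic_at intro: exI[of _ "ball z r2"])
  have aN: "N1 analytic_on {z}" "N2 analytic_on {z}"
    unfolding N1_def[abs_def] N2_def[abs_def] by (intro analytic_intros analytic_deriv a1 a2)+
  have Nz: "N1 z = h1 z" "N2 z = h2 z" by (simp_all add: N1_def N2_def)
  have a\<sigma>: "\<sigma> analytic_on {z}" unfolding \<sigma>_def[abs_def]
    using aN a1 a2 h1(3) h2(3) Nz by (intro analytic_intros) auto
  have \<sigma>z: "\<sigma> z \<noteq> 0" using h1(3) h2(3) Nz by (simp add: \<sigma>_def)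
  have dh: "(h1 has_field_derivative deriv h1 z) (at z)" "(h2 has_field_derivative deriv h2 z) (at z)"
    using a1 a2 by (auto intro: analytic_derivI)
  have dN1: "(N1 has_field_derivative 2 * deriv h1 z) (at z)"
  proof -
    have "(deriv h1 has_field_derivative deriv (deriv h1) z) (at z)" using analytic_deriv[OF a1] by (auto intro: analytic_derivI)
    thus ?thesis unfolding N1_def[abs_def] by (auto intro!: derivative_eq_intros dh)
  qed
  have dN2: "(N2 has_field_derivative 2 * deriv h2 z) (at z)"
  proof -
    have "(deriv h2 has_field_derivative deriv (deriv h2) z) (at z)" using analytic_deriv[OF a2] by (auto intro: analytic_derivI)
    thus ?thesis unfolding N2_def[abs_def] by (auto intro!: derivative_eq_intros dh)
  qed
  have d1: "((\<lambda>w. N1 w / N2 w) has_field_derivative (2 * deriv h1 z * h2 z - h1 z * (2 * deriv h2 z)) / (h2 z * h2 z)) (at z)"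
    using DERIV_divide[OF dN1 dN2] Nz h2(3) by simp
  have "((\<lambda>w. h2 w / h1 w) has_field_derivative (deriv h2 z * h1 z - h2 z * deriv h1 z) / (h1 z * h1 z)) (at z)"
    using DERIV_divide[OF dh(2) dh(1)] h1(3) by simp
  from DERIV_power[OF this, of 2]
  have d2: "((\<lambda>w. (h2 w / h1 w)^2) has_field_derivative 2 * ((deriv h2 z * h1 z - h2 z * deriv h1 z) / (h1 z * h1 z) * (h2 z / h1 z))) (at z)"
    by simp
  have "deriv \<sigma> z = (2 * deriv h1 z * h2 z - h1 z * (2 * deriv h2 z)) / (h2 z * h2 z) * (h2 z / h1 z)^2
      + 2 * ((deriv h2 z * h1 z - h2 z * deriv h1 z) / (h1 z * h1 z) * (h2 z / h1 z)) * (N1 z / N2 z)"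
    unfolding \<sigma>_def[abs_def] using DERIV_mult[OF d1 d2] by (simp add: DERIV_imp_deriv)
  also have "\<dots> = 0" unfolding Nz using h1(3) h2(3) by (simp add: field_simps power2_eq_square)
  finally have d\<sigma>: "deriv \<sigma> z = 0" .
  define r where "r = min r1 r2"
  have r0: "r > 0" using h1 h2 by (simp add: r_def)
  have "eventually (\<lambda>w. w \<in> ball z r - {z}) (at z)" using r0 by (intro eventually_at_in_open) auto
  with ev have ev2: "eventually (\<lambda>w. \<rho> w = \<sigma> w) (at z)"
  proof eventually_elim
    case (elim w)
    hence w: "w \<in> ball z r1" "w \<in> ball z r2" "w - z \<noteq> 0" by (auto simp: r_def)
    have "\<rho> w = (N1 w / (h1 w * (w - z))^2) / (N2 w / (h2 w * (w - z))^2)"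
      using elim(1) h1(5,6)[OF w(1)] h2(5,6)[OF w(2)] by (simp add: N1_def N2_def)
    also have "\<dots> = \<sigma> w" using h1(4)[OF w(1)] h2(4)[OF w(2)] w(3)
      by (simp add: \<sigma>_def power_mult_distrib power_divide)
    finally show ?case .
  qed
  have ev3: "eventually (\<lambda>w. deriv \<rho> w / \<rho> w = deriv \<sigma> w / \<sigma> w) (at z)"
  proof -
    obtain U where U: "open U" "z \<in> U" "\<And>w. w \<in> U \<Longrightarrow> w \<noteq> z \<Longrightarrow> \<rho> w = \<sigma> w"
      using ev2 unfolding eventually_at_topological by blast
    have op: "open (U - {z})" using U(1) by (intro open_Diff) auto
    have "eventually (\<lambda>w. w \<in> U - {z}) (at z)" using U by (intro eventually_at_in_open) auto
    thus ?thesis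
    proof eventually_elim
      case (elim w)
      have "eventually (\<lambda>v. v \<in> U - {z}) (nhds w)" by (rule eventually_nhds_in_open[OF op elim])
      hence "eventually (\<lambda>v. \<rho> v = \<sigma> v) (nhds w)" by eventually_elim (use U in auto)
      hence "deriv \<rho> w = deriv \<sigma> w" by (rule deriv_cong_ev) simp
      thus ?case using U(3) elim by simp
    qed
  qed
  have eqz: "zorder (\<lambda>w. deriv \<rho> w / \<rho> w) z = zorder (\<lambda>w. deriv \<sigma> w / \<sigma> w) z"
    by (rule zorder_cong[OF ev3]) simp
  have an: "(\<lambda>w. deriv \<sigma> w / \<sigma> w) analytic_on {z}"
    using a\<sigma> \<sigma>z by (intro analytic_intros analytic_deriv) auto
  have "frequently (\<lambda>w. deriv \<rho> w / \<rho> w \<noteq> 0) (at z)" by (rule mero_at(3)[OF m])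
  hence "frequently (\<lambda>w. deriv \<sigma> w / \<sigma> w \<noteq> 0) (at z)"
    by (rule frequently_rev_mp) (use ev3 in \<open>auto elim: eventually_mono\<close>)
  hence "zorder (\<lambda>w. deriv \<sigma> w / \<sigma> w) z > 0" using zorder_pos_iff'[OF an] d\<sigma> by simp
  thus ?thesis using eqz by simp
qed

section \<open>Counting preimages\<close>

lemma prox_ge_0: "prox r X \<ge> 0"
proof (cases "(\<lambda>t. ln (max 1 (norm (X (circlepath 0 r t))))) integrable_on {0..1}")
  case True thus ?thesis unfolding prox_def cmean_def by (intro integral_nonneg) auto
next
  case False thus ?thesis unfolding prox_def cmean_def by (simp add: not_integrable_integral)
qed

context growth
begin

lemma count_poly_le:
  assumes f: "admissible f" and A: "A \<noteq> 0"
  obtains C where "eventually (\<lambda>r. Ncount (ord (\<lambda>z. poly A (f z))) r \<le> degree A * prox r f + C) radii"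
proof -
  have m: "mero (\<lambda>z. poly A (f z))" by (rule mero_poly[OF f A])
  obtain C where C: "C \<ge> 0" "\<And>X r. r \<ge> 0 \<Longrightarrow> good X r \<Longrightarrow> good (\<lambda>z. poly A (X z)) r \<Longrightarrow>
    prox r (\<lambda>z. poly A (X z)) \<le> degree A * prox r X + C"
    using prox_poly_le[of A] by blast
  obtain D where D: "\<And>r. r \<ge> 1 \<Longrightarrow> good (\<lambda>z. poly A (f z)) r \<Longrightarrow> Ncount (ord (\<lambda>z. poly A (f z))) r \<le> prox r (\<lambda>z. poly A (f z)) + D"
    using Ncount_ord_le_prox[OF m] by blast
  have "eventually (\<lambda>r. Ncount (ord (\<lambda>z. poly A (f z))) r \<le> degree A * prox r f + (C + D)) radii"
    using radii_ge[of 1] radii_good[OF m] radii_good[OF mero_admissible[OF f]]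
  proof eventually_elim
    case (elim r)
    thus ?case using C(2)[of r f] D[of r] by simp
  qed
  thus thesis by (rule that)
qed

lemma count_value_le:
  assumes f: "admissible f"
  obtains C where "eventually (\<lambda>r. Ncount (ord f) r \<le> prox r f + C) radii"
proof -
  obtain C where "eventually (\<lambda>r. Ncount (ord (\<lambda>z. poly [:0, 1:] (f z))) r \<le> degree [:0, 1::complex:] * prox r f + C) radii"
    using count_poly_le[OF f, of "[:0, 1:]"] by auto
  thus thesis using that[of C] by simp
qed

text \<open>
  \<open>f' = (f' / f) * f\<close>, and \<open>prox r (f' / f)\<close> is negligible.
\<close>
lemma count_deriv_le:
  assumes f: "admissible f" "tame f"
  obtains u where "small u" "eventually (\<lambda>r. Ncount (ord (deriv f)) r \<le> prox r f + u r) radii"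
proof -
  have m: "mero (deriv f)" by (rule mero_deriv_admissible[OF f(1)])
  obtain D where D: "\<And>r. r \<ge> 1 \<Longrightarrow> good (deriv f) r \<Longrightarrow> Ncount (ord (deriv f)) r \<le> prox r (deriv f) + D"
    using Ncount_ord_le_prox[OF m] by blast
  define u where "u r = prox r (\<lambda>z. deriv f z / f z) + D" for r
  have "small u" unfolding u_def by (intro small_add small_const logarithmic_derivative_small f)
  moreover have "eventually (\<lambda>r. Ncount (ord (deriv f)) r \<le> prox r f + u r) radii"
    using radii_ge[of 1] radii_good[OF m] radii_good[OF mero_admissible[OF f(1)]]
  proof eventually_elim
    case (elim r)
    have "prox r (deriv f) = prox r (\<lambda>z. deriv f z / f z * f z)"
      using elim good_nz[OF elim(3)] by (intro prox_cong) auto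
    also have "\<dots> \<le> prox r (\<lambda>z. deriv f z / f z) + prox r f"
      using elim by (intro prox_mult_le good_divide) auto
    finally show ?case using D[of r] elim by (simp add: u_def)
  qed
  ultimately show thesis by (rule that)
qed

end

lemma ord_value_product:
  assumes f: "admissible f" and B: "finite B" and z: "\<not> is_pole f z"
  shows "zorder (\<lambda>z. deriv f z / (\<Prod>\<beta>\<in>B. f z - \<beta>)) z
    = zorder (\<lambda>w. f w - f z) z - 1 - (if f z \<in> B then zorder (\<lambda>w. f w - f z) z else 0)"
proof -
  have "zorder (\<lambda>z. deriv f z / (\<Prod>\<beta>\<in>B. f z - \<beta>)) z = zorder (deriv f) z - zorder (\<lambda>z. \<Prod>\<beta>\<in>B. f z - \<beta>) z"
    by (intro ord_divide mero_deriv_admissible mero_prod mero_diff_const f B)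
  also have "zorder (\<lambda>z. \<Prod>\<beta>\<in>B. f z - \<beta>) z = (\<Sum>\<beta>\<in>B. zorder (\<lambda>z. f z - \<beta>) z)"
    by (intro ord_prod mero_diff_const f B)
  also have "\<dots> = (\<Sum>\<beta>\<in>B. if \<beta> = f z then zorder (\<lambda>w. f w - f z) z else 0)"
  proof (rule sum.cong)
    fix \<beta>
    show "zorder (\<lambda>z. f z - \<beta>) z = (if \<beta> = f z then zorder (\<lambda>w. f w - f z) z else 0)"
      using admissible_analytic[OF f z] by (auto intro!: ord_eq_0 analytic_intros)
  qed simp
  also have "\<dots> = (if f z \<in> B then zorder (\<lambda>w. f w - f z) z else 0)" using B by simp
  finally show ?thesis using ord_deriv[OF f z] by simp
qed

section \<open>The polynomial and its companions\<close>

definition mult_at :: "(complex \<Rightarrow> complex) \<Rightarrow> complex \<Rightarrow> int" where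
  "mult_at f z = zorder (\<lambda>w. f w - f z) z"

locale range_polynomial =
  fixes n m :: nat and a b \<alpha> :: complex and P Q :: "complex poly"
  assumes m_pos: "m > 0" and n_large: "n > 2 * m + 4" and a_nz: "a \<noteq> 0" and b_nz: "b \<noteq> 0"
    and P_def: "P = monom 1 n + monom a m + [:b:]"
    and P_Q: "P = [:- \<alpha>, 1:]\<^sup>2 * Q" and Q_\<alpha>: "poly Q \<alpha> \<noteq> 0"
    and Q_simple: "\<And>\<beta>. poly Q \<beta> = 0 \<Longrightarrow> order \<beta> P = 1"
    and card_roots: "card {w. poly P w = 0} = n - 1"
begin

text \<open>
  \<open>V\<close> is \<open>P\<close> without its leading term, and \<open>\<Delta> = n P - w P'\<close> (\<open>poly_\<Delta>\<close>). Since \<open>V' P - V P' = - w^(n-1) \<Delta>\<close>, the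
  zeros of \<open>\<Delta>\<close> and \<open>0\<close> are the critical points of \<open>V / P\<close>; among the roots of \<open>P\<close>, only \<open>\<alpha>\<close> is a root of \<open>\<Delta>\<close>.
\<close>
definition V :: "complex poly" where "V = monom a m + [:b:]"
definition \<Delta> :: "complex poly" where "\<Delta> = monom (of_nat (n - m) * a) m + [:of_nat n * b:]"

lemma poly_P: "poly P w = w ^ n + a * w ^ m + b" by (simp add: P_def poly_monom)
lemma poly_V: "poly V w = a * w ^ m + b" by (simp add: V_def poly_monom)
lemma poly_\<Delta>: "poly \<Delta> w = of_nat n * poly P w - w * poly (pderiv P) w"
proof -
  have 1: "w * w ^ (n - 1) = w ^ n" "w * w ^ (m - 1) = w ^ m" using m_pos n_large by (auto simp: power_eq_if)
  have "w * poly (pderiv P) w = of_nat n * (w * w ^ (n - 1)) + of_nat m * a * (w * w ^ (m - 1))"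
    by (simp add: P_def pderiv_add pderiv_monom poly_monom pderiv_pCons algebra_simps)
  moreover have e: "of_nat (n - m) = (of_nat n - of_nat m :: complex)" using n_large by (simp add: of_nat_diff)
  moreover have "poly \<Delta> w = of_nat (n - m) * a * w ^ m + of_nat n * b" by (simp add: \<Delta>_def poly_monom)
  hence "poly \<Delta> w = (of_nat n - of_nat m) * a * w ^ m + of_nat n * b" unfolding e .
  ultimately show ?thesis unfolding 1 poly_P by (simp add: algebra_simps)
qed

lemma P_nz: "P \<noteq> 0" using poly_P[of 0] b_nz m_pos n_large by (auto simp: power_0_left)
lemma Q_nz: "Q \<noteq> 0" using P_nz P_Q by auto
lemma V_nz: "V \<noteq> 0" using poly_V[of 0] b_nz m_pos by (auto simp: power_0_left)
lemma \<Delta>_0: "poly \<Delta> 0 \<noteq> 0" using b_nz m_pos n_large by (simp add: \<Delta>_def poly_monom power_0_left)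
lemma \<Delta>_nz: "\<Delta> \<noteq> 0" using \<Delta>_0 by auto
lemma P_0: "poly P 0 \<noteq> 0" using b_nz m_pos n_large by (simp add: poly_P power_0_left)

lemma degree_P: "degree P = n"
proof -
  have "degree (monom a m + [:b:]) \<le> m"
    by (intro degree_add_le degree_monom_le) auto
  hence "degree (monom a m + [:b:]) < degree (monom (1::complex) n)" using n_large by (simp add: degree_monom_eq)
  hence "degree (monom 1 n + (monom a m + [:b:])) = n" by (subst degree_add_eq_left) (auto simp: degree_monom_eq)
  thus ?thesis by (simp add: P_def add.assoc)
qed

lemma degree_Q: "degree Q = n - 2"
proof -
  have "degree P = degree ([:- \<alpha>, 1:]\<^sup>2) + degree Q" unfolding P_Q by (rule degree_mult_eq) (use Q_nz in auto)
  thus ?thesis using degree_P by (simp add: degree_power_eq)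
qed

lemma degree_\<Delta>: "degree \<Delta> \<le> m" unfolding \<Delta>_def by (intro degree_add_le degree_monom_le) auto
lemma degree_V: "degree V \<le> m" unfolding V_def by (intro degree_add_le degree_monom_le) auto

lemma root_P_iff: "poly P w = 0 \<longleftrightarrow> w = \<alpha> \<or> poly Q w = 0" by (auto simp: P_Q)

lemma \<Delta>_\<alpha>: "poly \<Delta> \<alpha> = 0"
proof -
  have "poly (pderiv P) \<alpha> = 0" unfolding P_Q power2_eq_square mult.assoc pderiv_mult by simp
  thus ?thesis using poly_\<Delta>[of \<alpha>] by (simp add: root_P_iff)
qed

lemma simple_root: 
  assumes "poly Q \<beta> = 0" shows "order \<beta> P = 1" "order \<beta> Q = 1" "poly (pderiv P) \<beta> \<noteq> 0" "poly \<Delta> \<beta> \<noteq> 0"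
proof -
  show 1: "order \<beta> P = 1" by (rule Q_simple[OF assms])
  have "order \<beta> P = order \<beta> ([:- \<alpha>, 1:]\<^sup>2) + order \<beta> Q" unfolding P_Q by (rule order_mult) (use P_nz P_Q in auto)
  moreover have "order \<beta> Q \<noteq> 0" using assms Q_nz by (simp add: order_root)
  ultimately show "order \<beta> Q = 1" using 1 by simp
  have P'nz: "pderiv P \<noteq> 0" using degree_P n_large by (simp add: pderiv_eq_0_iff)
  hence "order \<beta> P = Suc (order \<beta> (pderiv P))" using 1 assms root_P_iff by (intro order_pderiv) auto
  hence "order \<beta> (pderiv P) = 0" using 1 by simp
  thus d: "poly (pderiv P) \<beta> \<noteq> 0" using P'nz by (simp add: order_root)
  have "\<beta> \<noteq> 0" using assms P_0 root_P_iff by auto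
  moreover have "poly P \<beta> = 0" using assms root_P_iff by simp
  ultimately show "poly \<Delta> \<beta> \<noteq> 0" using d by (simp add: poly_\<Delta>)
qed

lemma order_not_root: "poly A x \<noteq> 0 \<Longrightarrow> order x A = 0" by (rule order_0I)

text \<open>
  The negative of the derivative of \<open>V(f) / P(f)\<close>; see \<open>deriv_V_over_P\<close>.
\<close>
definition \<phi> :: "(complex \<Rightarrow> complex) \<Rightarrow> complex \<Rightarrow> complex" where
  "\<phi> f z = deriv f z * f z ^ (n - 1) * poly \<Delta> (f z) / poly P (f z) ^ 2"

definition roots0 :: "complex set" where "roots0 = insert 0 {w. poly P w = 0}"

definition \<psi> :: "(complex \<Rightarrow> complex) \<Rightarrow> complex \<Rightarrow> complex" where
  "\<psi> f z = deriv f z / (\<Prod>\<beta>\<in>roots0. f z - \<beta>)"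

lemma roots0: "finite roots0" "roots0 \<noteq> {}" "card roots0 = n"
proof -
  have f: "finite {w. poly P w = 0}" by (rule poly_roots_finite[OF P_nz])
  thus "finite roots0" "roots0 \<noteq> {}" by (auto simp: roots0_def)
  have "0 \<notin> {w. poly P w = 0}" using P_0 by simp
  thus "card roots0 = n" unfolding roots0_def using f card_roots n_large by simp
qed

lemma mero_\<phi>: "admissible f \<Longrightarrow> mero (\<phi> f)"
  unfolding \<phi>_def[abs_def]
  by (intro mero_divide mero_mult mero_power mero_deriv_admissible mero_poly mero_admissible P_nz \<Delta>_nz)

lemma mero_\<psi>: "admissible f \<Longrightarrow> mero (\<psi> f)"
  unfolding \<psi>_def[abs_def] by (intro mero_divide mero_deriv_admissible mero_prod mero_diff_const roots0)

lemma ord_eq_mult_at: 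
  assumes "admissible f" "\<not> is_pole f z"
  shows "zorder f z = (if f z = 0 then mult_at f z else 0)"
  using admissible_analytic[OF assms] by (auto simp: mult_at_def intro: ord_eq_0)

lemma ord_\<phi>:
  assumes f: "admissible f" and z: "\<not> is_pole f z"
  shows "zorder (\<phi> f) z = mult_at f z - 1 + (n - 1) * zorder f z + order (f z) \<Delta> * mult_at f z - 2 * (order (f z) P * mult_at f z)"
proof -
  have md: "mero (deriv f)" and mf: "mero f" and mD: "mero (\<lambda>z. poly \<Delta> (f z))" and mP: "mero (\<lambda>z. poly P (f z))"
    using f by (auto intro: mero_deriv_admissible mero_admissible mero_poly[OF f P_nz] mero_poly[OF f \<Delta>_nz])
  have "zorder (\<phi> f) z = zorder (\<lambda>z. deriv f z * f z ^ (n - 1) * poly \<Delta> (f z)) z - zorder (\<lambda>z. poly P (f z) ^ 2) z"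
    unfolding \<phi>_def[abs_def] by (intro ord_divide mero_mult mero_power md mf mD mP)
  also have "zorder (\<lambda>z. deriv f z * f z ^ (n - 1) * poly \<Delta> (f z)) z
     = zorder (\<lambda>z. deriv f z * f z ^ (n - 1)) z + zorder (\<lambda>z. poly \<Delta> (f z)) z"
    by (intro ord_mult mero_mult mero_power md mf mD)
  also have "zorder (\<lambda>z. deriv f z * f z ^ (n - 1)) z = zorder (deriv f) z + zorder (\<lambda>z. f z ^ (n - 1)) z"
    by (intro ord_mult mero_mult mero_power md mf)
  also have "zorder (\<lambda>z. f z ^ (n - 1)) z = (n - 1) * zorder f z" by (rule ord_power[OF mf])
  also have "zorder (\<lambda>z. poly P (f z) ^ 2) z = 2 * zorder (\<lambda>z. poly P (f z)) z" using ord_power[OF mP, of 2] by simp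
  finally show ?thesis
    unfolding ord_deriv[OF f z] ord_poly_comp[OF f \<Delta>_nz z] ord_poly_comp[OF f P_nz z] by (simp add: mult_at_def)
qed

lemma ord_\<psi>:
  assumes f: "admissible f" and z: "\<not> is_pole f z"
  shows "zorder (\<psi> f) z = (if f z \<in> roots0 then - 1 else mult_at f z - 1)"
  using ord_value_product[OF f roots0(1) z] by (simp add: \<psi>_def[abs_def] mult_at_def)

lemma eq_V: "poly V w = poly P w - w ^ n" by (simp add: poly_V poly_P)

lemma V_at_root: "poly P \<beta> = 0 \<Longrightarrow> poly V \<beta> \<noteq> 0"
  using P_0 by (auto simp: eq_V)

text \<open>
  At a root of \<open>P\<close> the quotient \<open>P / V\<close> is regular. So, with \<open>k = P(f) / V(f)\<close>, near such a point \<open>\<phi> f\<close> has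
  the form \<open>k' / k^2\<close> to which \<open>cancellation_at_simple_zeros\<close> applies.
\<close>
lemma deriv_P_over_V:
  assumes f: "f analytic_on {w}" and V: "poly V (f w) \<noteq> 0"
  shows "((\<lambda>z. poly P (f z) / poly V (f z)) has_field_derivative
    deriv f w * f w ^ (n - 1) * poly \<Delta> (f w) / poly V (f w) ^ 2) (at w)"
proof -
  have df: "(f has_field_derivative deriv f w) (at w)" using f by (intro analytic_derivI)
  have dA: "((\<lambda>z. poly A (f z)) has_field_derivative poly (pderiv A) (f w) * deriv f w) (at w)" for A
    using DERIV_chain2[OF poly_DERIV df] .
  have V': "poly (pderiv V) x = poly (pderiv P) x - of_nat n * x ^ (n - 1)" for x
    by (simp add: V_def P_def pderiv_add pderiv_monom poly_monom)
  have xn: "x ^ n = x * x ^ (n - 1)" for x :: complex using n_large by (simp add: power_eq_if)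
  define x where "x = f w"
  have "poly (pderiv P) x * poly V x - poly P x * poly (pderiv V) x = x ^ (n - 1) * poly \<Delta> x"
    unfolding V' eq_V poly_\<Delta> xn[of x] by (simp add: algebra_simps)
  hence "(poly (pderiv P) x * deriv f w * poly V x - poly P x * (poly (pderiv V) x * deriv f w))
      = deriv f w * x ^ (n - 1) * poly \<Delta> x"
    by (metis (no_types, opaque_lifting) mult.commute mult.left_commute right_diff_distrib)
  thus ?thesis using DERIV_divide[OF dA[of P] dA[of V] V] by (simp add: x_def power2_eq_square)
qed

end

section \<open>The local inequality\<close>

lemma log_deriv_mult:
  assumes "X analytic_on {z}" "Y analytic_on {z}" "X z \<noteq> 0" "Y z \<noteq> 0"
  shows "deriv (\<lambda>z. X z * Y z) z / (X z * Y z) = deriv X z / X z + deriv Y z / Y z"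
proof -
  have "deriv (\<lambda>z. X z * Y z) z = X z * deriv Y z + deriv X z * Y z"
    using assms by (intro deriv_mult analytic_on_imp_differentiable_at) auto
  thus ?thesis using assms by (simp add: field_simps)
qed

lemma log_deriv_divide:
  assumes "X analytic_on {z}" "Y analytic_on {z}" "X z \<noteq> 0" "Y z \<noteq> 0"
  shows "deriv (\<lambda>z. X z / Y z) z / (X z / Y z) = deriv X z / X z - deriv Y z / Y z"
proof -
  have "deriv (\<lambda>z. X z / Y z) z = (deriv X z * Y z - X z * deriv Y z) / (Y z)^2"
    using assms by (intro deriv_divide analytic_on_imp_differentiable_at) auto
  thus ?thesis using assms by (simp add: field_simps power2_eq_square)
qed

lemma log_deriv_power:
  assumes "X analytic_on {z}" "X z \<noteq> 0"
  shows "deriv (\<lambda>z. X z ^ k) z / (X z ^ k) = of_nat k * (deriv X z / X z)"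
proof (cases k)
  case (Suc j)
  have "((\<lambda>z. X z ^ k) has_field_derivative of_nat k * (deriv X z * X z ^ (k - 1))) (at z)"
    using DERIV_power[OF analytic_derivI[OF assms(1)], of k] by simp
  hence "deriv (\<lambda>z. X z ^ k) z = of_nat k * (deriv X z * X z ^ (k - 1))" by (rule DERIV_imp_deriv)
  thus ?thesis using assms Suc by simp
qed simp

lemma prox_sum_le:
  assumes "finite I" "I \<noteq> {}" "C \<ge> 0" "r \<ge> 0" "continuous_on (sphere 0 r) H"
    "\<And>i. i \<in> I \<Longrightarrow> continuous_on (sphere 0 r) (Y i)"
    "\<And>z. norm z = r \<Longrightarrow> norm (H z) \<le> C * (\<Sum>i\<in>I. norm (Y i z))"
  shows "prox r H \<le> ln (max 1 (C * card I)) + (\<Sum>i\<in>I. prox r (Y i))"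
proof -
  have c: "continuous_on (sphere 0 r) (\<lambda>z. ln (max 1 (norm (Y i z))))" if "i \<in> I" for i
    by (intro continuous_lnmax continuous_on_norm assms(6) that)
  have "prox r H \<le> cmean r (\<lambda>z. ln (max 1 (C * card I)) + (\<Sum>i\<in>I. ln (max 1 (norm (Y i z)))))"
    unfolding prox_def
  proof (rule cmean_mono)
    fix z :: complex assume z: "norm z = r"
    have "ln (max 1 (norm (H z))) \<le> ln (max 1 (C * (\<Sum>i\<in>I. norm (Y i z))))"
      using assms(7)[OF z] by (intro ln_mono) auto
    also have "\<dots> \<le> ln (max 1 (C * card I)) + (\<Sum>i\<in>I. ln (max 1 (norm (Y i z))))"
      by (rule ln_max_sum_le[OF assms(1,2) _ assms(3)]) auto
    finally show "ln (max 1 (norm (H z))) \<le> ln (max 1 (C * card I)) + (\<Sum>i\<in>I. ln (max 1 (norm (Y i z))))" .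
  next
    show "continuous_on (sphere 0 r) (\<lambda>z. ln (max 1 (norm (H z))))"
      by (intro continuous_lnmax continuous_on_norm assms(5))
    show "continuous_on (sphere 0 r) (\<lambda>z. ln (max 1 (C * card I)) + (\<Sum>i\<in>I. ln (max 1 (norm (Y i z)))))"
      by (intro continuous_on_add continuous_on_const continuous_on_sum c)
  qed (rule assms(4))
  also have "\<dots> = ln (max 1 (C * card I)) + (\<Sum>i\<in>I. prox r (Y i))"
    unfolding prox_def
    by (subst cmean_add[OF continuous_on_const continuous_on_sum[OF c] assms(4)])
      (simp_all add: cmean_const cmean_sum[OF c assms(4,1)])
  finally show ?thesis .
qed

lemma good_log_deriv_continuous:
  assumes "good X r" shows "continuous_on (sphere 0 r) (\<lambda>z. deriv X z / X z)"
proof -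
  have "(\<lambda>z. deriv X z / X z) analytic_on sphere 0 r"
    by (subst analytic_on_analytic_at) (use assms in \<open>auto simp: good_def intro!: analytic_on_divide analytic_deriv\<close>)
  thus ?thesis using analytic_imp_holomorphic holomorphic_on_imp_continuous_on by blast
qed

context range_polynomial
begin

lemma mult_at_ge_1: "admissible f \<Longrightarrow> \<not> is_pole f z \<Longrightarrow> mult_at f z \<ge> 1"
  unfolding mult_at_def by (rule ord_value_pos)

lemma \<phi>_as_quotient_near:
  assumes f: "admissible f" and z: "\<not> is_pole f z" and V: "poly V (f z) \<noteq> 0"
  shows "eventually (\<lambda>w. \<phi> f w = deriv (\<lambda>z. poly P (f z) / poly V (f z)) w / (poly P (f w) / poly V (f w)) ^ 2) (at z)"
proof -
  have an: "f analytic_on {z}" by (rule admissible_analytic[OF f z])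
  have "isCont (\<lambda>z. poly V (f z)) z" by (rule analytic_at_imp_isCont[OF analytic_on_poly_comp[OF an]])
  hence "((\<lambda>z. poly V (f z)) \<longlongrightarrow> poly V (f z)) (at z)" by (rule isContD)
  hence "eventually (\<lambda>w. poly V (f w) \<noteq> 0) (at z)" using V by (rule tendsto_imp_eventually_ne)
  moreover have "eventually (\<lambda>w. f analytic_on {w}) (at z)"
    using meromorphic_on_imp_analytic_cosparse[OF admissible_meromorphic[OF f]]
    by (rule eventually_cosparse_imp_eventually_at) simp
  ultimately show ?thesis
  proof eventually_elim
    case (elim w)
    have "deriv (\<lambda>z. poly P (f z) / poly V (f z)) w = deriv f w * f w ^ (n - 1) * poly \<Delta> (f w) / poly V (f w) ^ 2"
      using deriv_P_over_V[OF elim(2,1)] by (rule DERIV_imp_deriv)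
    thus ?case using elim(1) by (simp add: \<phi>_def power_divide)
  qed
qed

lemma simple_point:
  assumes f: "admissible f" and z: "\<not> is_pole f z" and Q: "poly Q (f z) = 0" and p: "mult_at f z = 1"
  shows "(\<lambda>z. poly P (f z) / poly V (f z)) analytic_on {z}" "poly P (f z) / poly V (f z) = 0"
    "deriv (\<lambda>z. poly P (f z) / poly V (f z)) z \<noteq> 0"
proof -
  have an: "f analytic_on {z}" by (rule admissible_analytic[OF f z])
  have P0: "poly P (f z) = 0" using Q root_P_iff by simp
  have V: "poly V (f z) \<noteq> 0" by (rule V_at_root[OF P0])
  show "(\<lambda>z. poly P (f z) / poly V (f z)) analytic_on {z}"
    using V by (intro analytic_on_divide analytic_on_poly_comp an) auto
  show "poly P (f z) / poly V (f z) = 0" using P0 by simp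
  have md: "mero (deriv f)" by (rule mero_deriv_admissible[OF f])
  have "zorder (deriv f) z = 0" using ord_deriv[OF f z] p by (simp add: mult_at_def)
  hence "deriv f z \<noteq> 0"
    using zorder_eq_0_iff[OF analytic_deriv[OF an] mero_at(3)[OF md]] by simp
  moreover have "f z \<noteq> 0" using P0 P_0 by auto
  moreover have "poly \<Delta> (f z) \<noteq> 0" using simple_root(4)[OF Q] .
  ultimately show "deriv (\<lambda>z. poly P (f z) / poly V (f z)) z \<noteq> 0"
    using DERIV_imp_deriv[OF deriv_P_over_V[OF an V]] V by simp
qed

text \<open>
  Off the poles, \<open>- ord (\<psi> f) z\<close> is \<open>1\<close> if \<open>f z\<close> is \<open>0\<close> or a root of \<open>P\<close>, and \<open>1 - p\<close> otherwise, where \<open>p\<close> is the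
  multiplicity with which \<open>f\<close> takes its value at \<open>z\<close>; let \<open>q\<close> be that of \<open>g\<close>, and \<open>h\<close> the order of \<open>\<rho>' / \<rho>\<close>. Always
  \<open>h \<ge> -1\<close>, and \<open>h \<ge> 0\<close> if \<open>\<phi> f\<close> and \<open>\<phi> g\<close> have the same order.
  
  At a common root of \<open>Q\<close> the claim is \<open>2 \<le> (p + q)/2 + h + \<kappa> (p - 1) + \<kappa> (q - 1)\<close>. For \<open>p = q = 1\<close> it holds because then
  \<open>h \<ge> 1\<close>; for \<open>p = q = 2\<close> because \<open>h \<ge> 0\<close>; for \<open>p, q \<ge> 3\<close> because \<open>h \<ge> -1\<close>; and in the remaining case
  \<open>p, q \<ge> 2\<close>, \<open>p + q \<ge> 5\<close>, which occurs only for \<open>\<kappa> = 1/2\<close>, the terms with \<open>\<kappa>\<close> make up for the loss. Where both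
  functions take the value \<open>\<alpha>\<close>, the zeros of \<open>\<Delta>(f)\<close> and \<open>\<Delta>(g)\<close> contribute at least \<open>p + q\<close>, and either \<open>p = q\<close> and
  \<open>h \<ge> 0\<close>, or \<open>p + q \<ge> 3\<close>. At any other point a pole
  of \<open>\<rho>' / \<rho>\<close> comes from a zero of \<open>\<phi> f\<close> or \<open>\<phi> g\<close>, and is paid for by a zero of \<open>f\<close> or \<open>\<Delta>(f)\<close>, or by the term
  \<open>1 - p\<close> on the left (and likewise for \<open>g\<close>).
\<close>
lemma pointwise_inequality:
  fixes \<kappa> :: real
  assumes f: "admissible f" and g: "admissible g" and zf: "\<not> is_pole f z" and zg: "\<not> is_pole g z"
    and s1: "f z = \<alpha> \<longleftrightarrow> g z = \<alpha>" and s2: "poly Q (f z) = 0 \<longleftrightarrow> poly Q (g z) = 0"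
    and s3: "poly Q (f z) = 0 \<Longrightarrow> min (mult_at f z) 3 = min (mult_at g z) 3 \<or>
        \<kappa> = 1/2 \<and> min (mult_at f z) 2 = min (mult_at g z) 2"
    and \<kappa>: "\<kappa> \<ge> 0"
    and H: "mero (\<lambda>z. deriv \<rho> z / \<rho> z)" and \<rho>: "\<rho> = (\<lambda>z. \<phi> f z / \<phi> g z)"
  shows "- ord (\<psi> f) z - ord (\<psi> g) z \<le>
    1/2 * ord (\<lambda>z. poly Q (f z)) z + 1/2 * ord (\<lambda>z. poly Q (g z)) z
    + ord (\<lambda>z. poly \<Delta> (f z)) z + ord (\<lambda>z. poly \<Delta> (g z)) z + 2 * ord f z + 2 * ord g z
    + ord (\<lambda>z. deriv \<rho> z / \<rho> z) z + \<kappa> * ord (deriv f) z + \<kappa> * ord (deriv g) z"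
proof -
  define p where "p = mult_at f z"
  define q where "q = mult_at g z"
  define h where "h = zorder (\<lambda>z. deriv \<rho> z / \<rho> z) z"
  have p1: "p \<ge> 1" unfolding p_def by (rule mult_at_ge_1[OF f zf])
  have q1: "q \<ge> 1" unfolding q_def by (rule mult_at_ge_1[OF g zg])
  have m\<rho>: "mero \<rho>" unfolding \<rho> by (intro mero_divide mero_\<phi> f g)
  have o\<rho>: "zorder \<rho> z = zorder (\<phi> f) z - zorder (\<phi> g) z" unfolding \<rho> by (intro ord_divide mero_\<phi> f g)
  have h1: "h \<ge> -1" unfolding h_def by (rule ord_log_deriv(1)[OF H m\<rho>])
  have h0: "h \<ge> 0" if "zorder (\<phi> f) z = zorder (\<phi> g) z"
    unfolding h_def by (rule ord_log_deriv(2)[OF H m\<rho>]) (use that o\<rho> in simp)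
  have oQ: "zorder (\<lambda>z. poly Q (f z)) z = order (f z) Q * p" "zorder (\<lambda>z. poly Q (g z)) z = order (g z) Q * q"
    unfolding p_def q_def mult_at_def by (intro ord_poly_comp f g Q_nz zf zg)+
  have oD: "zorder (\<lambda>z. poly \<Delta> (f z)) z = order (f z) \<Delta> * p" "zorder (\<lambda>z. poly \<Delta> (g z)) z = order (g z) \<Delta> * q"
    unfolding p_def q_def mult_at_def by (intro ord_poly_comp f g \<Delta>_nz zf zg)+
  have od: "zorder (deriv f) z = p - 1" "zorder (deriv g) z = q - 1"
    unfolding p_def q_def mult_at_def by (intro ord_deriv f g zf zg)+
  have of: "zorder f z = (if f z = 0 then p else 0)" "zorder g z = (if g z = 0 then q else 0)"
    unfolding p_def q_def by (intro ord_eq_mult_at f g zf zg)+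
  have o\<psi>: "zorder (\<psi> f) z = (if f z \<in> roots0 then - 1 else p - 1)" "zorder (\<psi> g) z = (if g z \<in> roots0 then - 1 else q - 1)"
    unfolding p_def q_def by (intro ord_\<psi> f g zf zg)+
  have o\<phi>: "zorder (\<phi> f) z = p - 1 + (n - 1) * zorder f z + order (f z) \<Delta> * p - 2 * (order (f z) P * p)"
    "zorder (\<phi> g) z = q - 1 + (n - 1) * zorder g z + order (g z) \<Delta> * q - 2 * (order (g z) P * q)"
    unfolding p_def q_def by (intro ord_\<phi> f g zf zg)+
  have nonneg: "0 \<le> \<kappa> * (real_of_int p - 1)" "0 \<le> \<kappa> * (real_of_int q - 1)" using \<kappa> p1 q1 by auto
  consider (Q) "poly Q (f z) = 0" "poly Q (g z) = 0" | (alpha) "f z = \<alpha>" "g z = \<alpha>"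
    | (none) "poly P (f z) \<noteq> 0" "poly P (g z) \<noteq> 0"
    using s1 s2 root_P_iff by blast
  thus ?thesis
  proof cases
    case Q
    have P0: "poly P (f z) = 0" "poly P (g z) = 0" using Q root_P_iff by auto
    have nz: "f z \<noteq> 0" "g z \<noteq> 0" using P0 P_0 by auto
    have ordQ: "order (f z) Q = 1" "order (g z) Q = 1" and ordP: "order (f z) P = 1" "order (g z) P = 1"
      and ordD: "order (f z) \<Delta> = 0" "order (g z) \<Delta> = 0"
      using simple_root Q by (auto intro: order_not_root)
    have r0: "f z \<in> roots0" "g z \<in> roots0" using P0 by (auto simp: roots0_def)
    have \<phi>: "zorder (\<phi> f) z = - p - 1" "zorder (\<phi> g) z = - q - 1"
      unfolding o\<phi> of ordP ordD using nz by auto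
    have hpq: "h \<ge> 0" if "p = q" using h0 \<phi> that by simp
    have h11: "h \<ge> 1" if "p = 1" "q = 1"
    proof -
      let ?k1 = "\<lambda>z. poly P (f z) / poly V (f z)" and ?k2 = "\<lambda>z. poly P (g z) / poly V (g z)"
      have ev: "eventually (\<lambda>w. \<rho> w = (deriv ?k1 w / ?k1 w ^ 2) / (deriv ?k2 w / ?k2 w ^ 2)) (at z)"
        using \<phi>_as_quotient_near[OF f zf V_at_root[OF P0(1)]] \<phi>_as_quotient_near[OF g zg V_at_root[OF P0(2)]]
      proof eventually_elim
        case (elim w)
        show ?case unfolding \<rho> elim ..
      qed
      show ?thesis unfolding h_def
        by (rule cancellation_at_simple_zeros[OF simple_point[OF f zf Q(1)] simple_point[OF g zg Q(2)] ev H])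
          (use that in \<open>auto simp: p_def q_def\<close>)
    qed
    have "2 \<le> 1/2 * real_of_int p + 1/2 * real_of_int q + real_of_int h + \<kappa> * (real_of_int p - 1) + \<kappa> * (real_of_int q - 1)"
    proof -
      consider "p = 1" "q = 1" | "p = 2" "q = 2" | "p \<ge> 3" "q \<ge> 3" | "p \<ge> 2" "q \<ge> 2" "p + q \<ge> 5" "\<kappa> = 1/2"
      proof -
        have "min p 3 = min q 3 \<or> \<kappa> = 1/2 \<and> min p 2 = min q 2"
          using s3[OF Q(1)] unfolding p_def[symmetric] q_def[symmetric] .
        hence "p = q \<and> p < 3 \<or> p \<ge> 3 \<and> q \<ge> 3 \<or> \<kappa> = 1/2 \<and> (p = q \<and> p < 2 \<or> p \<ge> 2 \<and> q \<ge> 2)"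
          by (auto simp: min_def split: if_splits)
        hence "p = 1 \<and> q = 1 \<or> p = 2 \<and> q = 2 \<or> p \<ge> 3 \<and> q \<ge> 3 \<or> p \<ge> 2 \<and> q \<ge> 2 \<and> p + q \<ge> 5 \<and> \<kappa> = 1/2"
          using p1 q1 by auto
        thus thesis using that by blast
      qed
      thus ?thesis
      proof cases
        case 1 thus ?thesis using h11 nonneg by simp
      next
        case 2
        hence "real_of_int h \<ge> 0" using hpq by simp
        thus ?thesis using 2 nonneg by simp
      next
        case 3
        hence "real_of_int p \<ge> 3" "real_of_int q \<ge> 3" "real_of_int h \<ge> -1" using h1 by linarith+
        thus ?thesis using nonneg by linarith
      next
        case 4
        hence "real_of_int p + real_of_int q \<ge> 5" "real_of_int h \<ge> -1" using h1 by linarith+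
        thus ?thesis unfolding 4(4) by (simp add: field_simps)
      qed
    qed
    thus ?thesis unfolding h_def[symmetric] oQ oD od of o\<psi> ordQ ordD using r0 nz by simp
  next
    case alpha
    have P0: "poly P \<alpha> = 0" by (simp add: root_P_iff)
    have nz: "f z \<noteq> 0" "g z \<noteq> 0" using P0 P_0 alpha by auto
    have r0: "f z \<in> roots0" "g z \<in> roots0" using P0 alpha by (auto simp: roots0_def)
    have D1: "order \<alpha> \<Delta> \<ge> 1" using \<Delta>_\<alpha> \<Delta>_nz by (simp add: order_root Suc_le_eq)
    have Dp: "int (order \<alpha> \<Delta>) * p \<ge> p" "int (order \<alpha> \<Delta>) * q \<ge> q"
      using mult_right_mono[of 1 "int (order \<alpha> \<Delta>)" p] mult_right_mono[of 1 "int (order \<alpha> \<Delta>)" q] D1 p1 q1 by auto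
    have "2 \<le> int (order \<alpha> \<Delta>) * p + int (order \<alpha> \<Delta>) * q + h"
    proof (cases "p = q")
      case True
      have "zorder (\<phi> f) z = zorder (\<phi> g) z" unfolding o\<phi> of True alpha by simp
      thus ?thesis using h0 Dp p1 q1 by linarith
    next
      case False thus ?thesis using h1 Dp p1 q1 by linarith
    qed
    hence "2 \<le> real_of_int (int (order \<alpha> \<Delta>) * p) + real_of_int (int (order \<alpha> \<Delta>) * q) + real_of_int h"
      by (metis of_int_add of_int_le_iff of_int_numeral)
    moreover have "order \<alpha> Q = 0" by (rule order_not_root[OF Q_\<alpha>])
    ultimately show ?thesis unfolding h_def[symmetric] oQ oD od of o\<psi> alpha using r0 nz nonneg alpha by simp
  next
    case none
    have nQ: "order (f z) Q = 0" "order (g z) Q = 0" "order (f z) P = 0" "order (g z) P = 0"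
      using none root_P_iff by (auto intro: order_not_root)
    have key: "(if x \<in> roots0 then 1 else - (k - 1)) + (if o' \<noteq> 0 then 1 else 0) \<le> int (order x \<Delta>) * k + 2 * (if x = 0 then k else 0)"
      if "poly P x \<noteq> 0" "k \<ge> 1" "o' = k - 1 + (n - 1) * (if x = 0 then k else 0) + int (order x \<Delta>) * k"
      for x :: complex and k o' :: int
    proof (cases "x = 0")
      case True
      have "0 \<le> int (order x \<Delta>) * k" using that by simp
      thus ?thesis using True that(2) order_not_root[OF \<Delta>_0] by (simp add: roots0_def)
    next
      case False
      hence x: "x \<notin> roots0" using that by (simp add: roots0_def)
      show ?thesis
      proof (cases "order x \<Delta> = 0")
        case True thus ?thesis using x False that by auto
      next
        case o: False
        hence "1 * k \<le> int (order x \<Delta>) * k" using that by (intro mult_right_mono) auto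
        moreover have "(if o' \<noteq> 0 then 1 else 0) \<le> (1::int)" by simp
        ultimately show ?thesis using that(2) unfolding if_not_P[OF x] if_not_P[OF False] by linarith
      qed
    qed
    have kf: "(if f z \<in> roots0 then 1 else - (p - 1)) + (if zorder (\<phi> f) z \<noteq> 0 then 1 else 0)
        \<le> int (order (f z) \<Delta>) * p + 2 * zorder f z"
      unfolding of by (rule key[OF none(1) p1]) (simp add: o\<phi> nQ of)
    have kg: "(if g z \<in> roots0 then 1 else - (q - 1)) + (if zorder (\<phi> g) z \<noteq> 0 then 1 else 0)
        \<le> int (order (g z) \<Delta>) * q + 2 * zorder g z"
      unfolding of by (rule key[OF none(2) q1]) (simp add: o\<phi> nQ of)
    have "h \<ge> - (if zorder (\<phi> f) z \<noteq> 0 then 1 else 0) - (if zorder (\<phi> g) z \<noteq> 0 then 1 else 0)"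
      using h1 h0 by auto
    hence "- zorder (\<psi> f) z - zorder (\<psi> g) z \<le> int (order (f z) \<Delta>) * p + int (order (g z) \<Delta>) * q + 2 * zorder f z + 2 * zorder g z + h"
      using kf kg unfolding o\<psi> by (auto split: if_splits)
    hence "real_of_int (- zorder (\<psi> f) z - zorder (\<psi> g) z) \<le> real_of_int (int (order (f z) \<Delta>) * p + int (order (g z) \<Delta>) * q + 2 * zorder f z + 2 * zorder g z + h)"
      by (simp only: of_int_le_iff)
    thus ?thesis unfolding h_def[symmetric] oQ oD od nQ using nonneg by simp
  qed
qed

text \<open>
  \<open>\<phi> f\<close> is a product of powers of \<open>f'\<close>, \<open>f\<close>, \<open>\<Delta>(f)\<close> and \<open>P(f)\<close>, all of which are tame.
\<close>
lemma log_deriv_\<phi>_small: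
  assumes gr: "growth T r0" and f: "admissible f" "growth.tame T r0 f"
  shows "growth.small T r0 (\<lambda>r. prox r (\<lambda>z. deriv (\<phi> f) z / \<phi> f z))"
proof -
  interpret growth T r0 by (rule gr)
  define X where "X i = [deriv f, f, \<lambda>z. poly \<Delta> (f z), \<lambda>z. poly P (f z)] ! i" for i :: nat
  have I: "i = 0 \<or> i = 1 \<or> i = 2 \<or> i = 3" if "i \<in> {..<4}" for i :: nat using that by auto
  have mX: "mero (X i)" "tame (X i)" if "i \<in> {..<4}" for i
    using I[OF that] mero_deriv_admissible[OF f(1)] mero_admissible[OF f(1)] mero_poly[OF f(1) \<Delta>_nz]
      mero_poly[OF f(1) P_nz] tame_deriv[OF f(2)] f(2) tame_poly[OF f(2)] by (auto simp: X_def)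
  have four: "(\<Sum>i<4. h i) = h 0 + h 1 + h 2 + h (3::nat)" for h :: "nat \<Rightarrow> real"
    by (simp add: eval_nat_numeral)
  have "small (\<lambda>r. ln (max 1 (real n * card {..<4::nat})) + (\<Sum>i<4. prox r (\<lambda>z. deriv (X i) z / X i z)))"
    by (intro small_add small_const small_sum logarithmic_derivative_small mX) auto
  moreover have "eventually (\<lambda>r. \<forall>i\<in>{..<4}. good (X i) r) radii"
    using radii_good[OF mX(1)] by (intro eventually_ball_finite) auto
  hence "eventually (\<lambda>r. prox r (\<lambda>z. deriv (\<phi> f) z / \<phi> f z)
    \<le> ln (max 1 (real n * card {..<4::nat})) + (\<Sum>i<4. prox r (\<lambda>z. deriv (X i) z / X i z))) radii"
    using radii_ge[of 0] radii_good[OF mero_\<phi>[OF f(1)]]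
  proof eventually_elim
    case (elim r)
    show ?case
    proof (rule prox_sum_le[OF _ _ _ elim(2) good_log_deriv_continuous[OF elim(3)]])
      show "continuous_on (sphere 0 r) (\<lambda>z. deriv (X i) z / X i z)" if "i \<in> {..<4}" for i
        using elim(1) that by (intro good_log_deriv_continuous) auto
      fix z :: complex assume z: "norm z = r"
      have g: "X i analytic_on {z}" "X i z \<noteq> 0" if "i \<in> {..<4}" for i
        using elim(1) that z by (auto simp: good_def)
      have g0: "deriv f analytic_on {z}" "deriv f z \<noteq> 0" and g1: "f analytic_on {z}" "f z \<noteq> 0"
        and g2: "(\<lambda>z. poly \<Delta> (f z)) analytic_on {z}" "poly \<Delta> (f z) \<noteq> 0"
        and g3: "(\<lambda>z. poly P (f z)) analytic_on {z}" "poly P (f z) \<noteq> 0"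
        using g[of 0] g[of 1] g[of 2] g[of 3] by (auto simp: X_def eval_nat_numeral)
      define D where "D Y = deriv Y z / Y z" for Y :: "complex \<Rightarrow> complex"
      have "D (\<phi> f) = D (\<lambda>z. deriv f z * f z ^ (n - 1) * poly \<Delta> (f z)) - D (\<lambda>z. poly P (f z) ^ 2)"
        unfolding D_def \<phi>_def[abs_def]
        by (rule log_deriv_divide) (use g0 g1 g2 g3 in \<open>auto intro!: analytic_on_mult analytic_on_power\<close>)
      also have "D (\<lambda>z. deriv f z * f z ^ (n - 1) * poly \<Delta> (f z)) = D (\<lambda>z. deriv f z * f z ^ (n - 1)) + D (\<lambda>z. poly \<Delta> (f z))"
        unfolding D_def by (rule log_deriv_mult) (use g0 g1 g2 in \<open>auto intro!: analytic_on_mult analytic_on_power\<close>)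
      also have "D (\<lambda>z. deriv f z * f z ^ (n - 1)) = D (deriv f) + D (\<lambda>z. f z ^ (n - 1))"
        unfolding D_def by (rule log_deriv_mult) (use g0 g1 in \<open>auto intro!: analytic_on_power\<close>)
      also have "D (\<lambda>z. f z ^ (n - 1)) = of_nat (n - 1) * D f"
        unfolding D_def by (rule log_deriv_power[OF g1])
      also have "D (\<lambda>z. poly P (f z) ^ 2) = of_nat 2 * D (\<lambda>z. poly P (f z))"
        unfolding D_def by (rule log_deriv_power[OF g3])
      finally have "norm (D (\<phi> f)) = norm (D (deriv f) + of_nat (n - 1) * D f + D (\<lambda>z. poly \<Delta> (f z)) - of_nat 2 * D (\<lambda>z. poly P (f z)))"
        by (rule arg_cong)
      also have "\<dots> \<le> norm (D (deriv f)) + norm (of_nat (n - 1) * D f) + norm (D (\<lambda>z. poly \<Delta> (f z))) + norm (of_nat 2 * D (\<lambda>z. poly P (f z)))"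
        by (intro norm_triangle_mono norm_triangle_le_diff add_mono order_refl)
      also have "\<dots> \<le> n * norm (D (deriv f)) + n * norm (D f) + n * norm (D (\<lambda>z. poly \<Delta> (f z))) + n * norm (D (\<lambda>z. poly P (f z)))"
      proof -
        have le: "c * x \<le> n * x" if "c \<le> n" "x \<ge> 0" for c x :: real using that by (intro mult_right_mono) auto
        have "1 * norm (D (deriv f)) \<le> n * norm (D (deriv f))" "1 * norm (D (\<lambda>z. poly \<Delta> (f z))) \<le> n * norm (D (\<lambda>z. poly \<Delta> (f z)))"
          "real (n - 1) * norm (D f) \<le> n * norm (D f)" "2 * norm (D (\<lambda>z. poly P (f z))) \<le> n * norm (D (\<lambda>z. poly P (f z)))"
          using n_large by (intro le; simp)+
        thus ?thesis by (simp add: norm_mult)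
      qed
      also have "\<dots> = n * (\<Sum>i<4. norm (deriv (X i) z / X i z))"
        unfolding four by (simp add: D_def X_def eval_nat_numeral algebra_simps)
      finally show "norm (deriv (\<phi> f) z / \<phi> f z) \<le> n * (\<Sum>i<4. norm (deriv (X i) z / X i z))"
        by (simp add: D_def)
    qed (simp_all add: lessThan_empty_iff)
  qed
  ultimately show ?thesis by (rule small_mono)
qed

end

section \<open>The nondegenerate case\<close>

context range_polynomial
begin

text \<open>
  For the meromorphic function \<open>\<rho>' / \<rho>\<close>, not being \<open>mero\<close> means vanishing identically. If it does not, summing
  \<open>pointwise_inequality\<close> over all points outside the poles and adding the second main theorem for \<open>f\<close> and \<open>g\<close> with the \<open>n\<close> values
  in \<open>roots0\<close> gives \<open>(n - 1) T \<le> ((n - 2)/2 + m + 2 + \<kappa>) T + o(T)\<close>: the summands come from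
  \<open>Q\<close>, \<open>\<Delta>\<close>, the zeros, and the derivatives.
\<close>
theorem nondegenerate_impossible:
  fixes \<kappa> :: real
  assumes gr: "growth T r0" and T: "\<And>r. T r = prox r f + prox r g"
    and f: "admissible f" "growth.tame T r0 f" and g: "admissible g" "growth.tame T r0 g"
    and s1: "\<And>z. \<not> is_pole f z \<Longrightarrow> \<not> is_pole g z \<Longrightarrow> f z = \<alpha> \<longleftrightarrow> g z = \<alpha>"
    and s2: "\<And>z. \<not> is_pole f z \<Longrightarrow> \<not> is_pole g z \<Longrightarrow> poly Q (f z) = 0 \<longleftrightarrow> poly Q (g z) = 0"
    and s3: "\<And>z. \<not> is_pole f z \<Longrightarrow> \<not> is_pole g z \<Longrightarrow> poly Q (f z) = 0 \<Longrightarrow>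
        min (mult_at f z) 3 = min (mult_at g z) 3 \<or> \<kappa> = 1/2 \<and> min (mult_at f z) 2 = min (mult_at g z) 2"
    and \<kappa>: "\<kappa> \<ge> 0" and n: "real n > 2 * m + 4 + 2 * \<kappa>"
    and \<rho>: "\<rho> = (\<lambda>z. \<phi> f z / \<phi> g z)"
  shows "\<not> mero (\<lambda>z. deriv \<rho> z / \<rho> z)"
proof
  assume H: "mero (\<lambda>z. deriv \<rho> z / \<rho> z)"
  interpret growth T r0 by (rule gr)
  have m\<rho>: "mero \<rho>" unfolding \<rho> by (intro mero_divide mero_\<phi> f g)
  define Qf where "Qf = ord (\<lambda>z. poly Q (f z))"
  define Qg where "Qg = ord (\<lambda>z. poly Q (g z))"
  define Df where "Df = ord (\<lambda>z. poly \<Delta> (f z))"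
  define Dg where "Dg = ord (\<lambda>z. poly \<Delta> (g z))"
  define h where "h = ord (\<lambda>z. deriv \<rho> z / \<rho> z)"
  note lf = locfin_ord[OF mero_poly[OF f(1) Q_nz], folded Qf_def] locfin_ord[OF mero_poly[OF g(1) Q_nz], folded Qg_def]
    locfin_ord[OF mero_poly[OF f(1) \<Delta>_nz], folded Df_def] locfin_ord[OF mero_poly[OF g(1) \<Delta>_nz], folded Dg_def]
    locfin_ord[OF mero_admissible[OF f(1)]] locfin_ord[OF mero_admissible[OF g(1)]] locfin_ord[OF H, folded h_def]
    locfin_ord[OF mero_deriv_admissible[OF f(1)]] locfin_ord[OF mero_deriv_admissible[OF g(1)]]
    locfin_ord[OF mero_\<psi>[OF f(1)]] locfin_ord[OF mero_\<psi>[OF g(1)]]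
  define k where "k z = (-1) * ord (\<psi> f) z + (-1) * ord (\<psi> g) z" for z
  define l where "l z = 1/2 * Qf z + (1/2 * Qg z + (Df z + (Dg z + (2 * ord f z + (2 * ord g z + (h z + (\<kappa> * ord (deriv f) z + \<kappa> * ord (deriv g) z)))))))" for z
  have lfk: "locfin k" unfolding k_def[abs_def] by (intro locfin_add locfin_cmult lf)
  have lfl: "locfin l" unfolding l_def[abs_def] by (intro locfin_add locfin_cmult lf)
  have Nk: "Ncount k r = - Ncount (ord (\<psi> f)) r - Ncount (ord (\<psi> g)) r" for r
    unfolding k_def[abs_def] Ncount_add[OF locfin_cmult[OF lf(10)] locfin_cmult[OF lf(11)]] Ncount_cmult by simp
  have Nl: "Ncount l r = 1/2 * Ncount Qf r + (1/2 * Ncount Qg r + (Ncount Df r + (Ncount Dg r + (2 * Ncount (ord f) r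
      + (2 * Ncount (ord g) r + (Ncount h r + (\<kappa> * Ncount (ord (deriv f)) r + \<kappa> * Ncount (ord (deriv g)) r)))))))" for r
    unfolding l_def[abs_def] by (simp only: Ncount_add locfin_add locfin_cmult lf Ncount_cmult)
  have fin: "finite ({z. is_pole f z} \<union> {z. is_pole g z})" using f g by (simp add: admissible_def)
  have kl: "k z \<le> l z" if "z \<notin> {z. is_pole f z} \<union> {z. is_pole g z}" for z
    using pointwise_inequality[OF f(1) g(1) _ _ s1 s2 s3 \<kappa> H \<rho>, of z] that
    by (simp add: k_def l_def Qf_def Qg_def Df_def Dg_def h_def)
  obtain C where C: "\<And>r. r \<ge> 1 \<Longrightarrow> Ncount k r \<le> Ncount l r + C * ln r"
    using Ncount_mono_finite[OF lfk lfl fin kl] by blast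
  obtain uf where uf: "small uf" "eventually (\<lambda>r. (card roots0 - 1) * prox r f \<le> - Ncount (ord (\<psi> f)) r + uf r) radii"
    using second_main_theorem[OF f roots0(1,2)] unfolding \<psi>_def[abs_def] by blast
  obtain ug where ug: "small ug" "eventually (\<lambda>r. (card roots0 - 1) * prox r g \<le> - Ncount (ord (\<psi> g)) r + ug r) radii"
    using second_main_theorem[OF g roots0(1,2)] unfolding \<psi>_def[abs_def] by blast
  obtain c1 where c1: "eventually (\<lambda>r. Ncount Qf r \<le> degree Q * prox r f + c1) radii"
    using count_poly_le[OF f(1) Q_nz] unfolding Qf_def by blast
  obtain c2 where c2: "eventually (\<lambda>r. Ncount Qg r \<le> degree Q * prox r g + c2) radii"
    using count_poly_le[OF g(1) Q_nz] unfolding Qg_def by blast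
  obtain c3 where c3: "eventually (\<lambda>r. Ncount Df r \<le> degree \<Delta> * prox r f + c3) radii"
    using count_poly_le[OF f(1) \<Delta>_nz] unfolding Df_def by blast
  obtain c4 where c4: "eventually (\<lambda>r. Ncount Dg r \<le> degree \<Delta> * prox r g + c4) radii"
    using count_poly_le[OF g(1) \<Delta>_nz] unfolding Dg_def by blast
  obtain c5 where c5: "eventually (\<lambda>r. Ncount (ord f) r \<le> prox r f + c5) radii"
    using count_value_le[OF f(1)] by blast
  obtain c6 where c6: "eventually (\<lambda>r. Ncount (ord g) r \<le> prox r g + c6) radii"
    using count_value_le[OF g(1)] by blast
  obtain vf where vf: "small vf" "eventually (\<lambda>r. Ncount (ord (deriv f)) r \<le> prox r f + vf r) radii"
    using count_deriv_le[OF f] by blast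
  obtain vg where vg: "small vg" "eventually (\<lambda>r. Ncount (ord (deriv g)) r \<le> prox r g + vg r) radii"
    using count_deriv_le[OF g] by blast
  define w where "w r = (\<Sum>X\<in>{f, g}. prox r (\<lambda>z. deriv (\<phi> X) z / \<phi> X z))" for r
  have w_small: "small w" unfolding w_def
    by (intro small_sum) (use log_deriv_\<phi>_small[OF gr f] log_deriv_\<phi>_small[OF gr g] in auto)
  obtain c7 where c7: "\<And>r. r \<ge> 1 \<Longrightarrow> good (\<lambda>z. deriv \<rho> z / \<rho> z) r \<Longrightarrow> Ncount h r \<le> prox r (\<lambda>z. deriv \<rho> z / \<rho> z) + c7"
    using Ncount_ord_le_prox[OF H] unfolding h_def by blast
  define wh where "wh r = (ln (max 1 (1 * real (card {f, g}))) + c7) + w r" for r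
  have wh: "small wh" unfolding wh_def by (intro small_add small_const w_small)
  have evh: "eventually (\<lambda>r. Ncount h r \<le> wh r) radii" if "f \<noteq> g"
    using radii_ge[of 1] radii_good[OF H] radii_good[OF mero_\<phi>[OF f(1)]] radii_good[OF mero_\<phi>[OF g(1)]] radii_good[OF m\<rho>]
  proof eventually_elim
    case (elim r)
    have "prox r (\<lambda>z. deriv \<rho> z / \<rho> z) \<le> ln (max 1 (1 * real (card {f, g}))) + (\<Sum>X\<in>{f, g}. prox r (\<lambda>z. deriv (\<phi> X) z / \<phi> X z))"
    proof (rule prox_sum_le)
      show "continuous_on (sphere 0 r) (\<lambda>z. deriv \<rho> z / \<rho> z)" by (rule good_log_deriv_continuous[OF elim(5)])
      show "continuous_on (sphere 0 r) (\<lambda>z. deriv (\<phi> X) z / \<phi> X z)" if "X \<in> {f, g}" for X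
        using elim that by (auto intro: good_log_deriv_continuous)
      fix z :: complex assume z: "norm z = r"
      have "deriv \<rho> z / \<rho> z = deriv (\<phi> f) z / \<phi> f z - deriv (\<phi> g) z / \<phi> g z"
        unfolding \<rho> by (rule log_deriv_divide) (use elim z in \<open>auto simp: good_def\<close>)
      thus "norm (deriv \<rho> z / \<rho> z) \<le> 1 * (\<Sum>X\<in>{f, g}. norm (deriv (\<phi> X) z / \<phi> X z))"
        using that norm_triangle_ineq4[of "deriv (\<phi> f) z / \<phi> f z" "deriv (\<phi> g) z / \<phi> g z"] by simp
    qed (use elim in auto)
    thus ?case using c7[OF elim(1,2)] by (simp add: wh_def w_def)
  qed
  \<comment> \<open>Needed because the sum over \<open>{f, g}\<close> in \<open>w\<close> would otherwise have a single term; for \<open>f = g\<close> the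
    quotient \<open>\<rho>\<close> is constant.\<close>
  have fg: "f \<noteq> g"
  proof
    assume "f = g"
    obtain z where z: "\<phi> g z \<noteq> 0" "eventually (\<lambda>w. \<phi> g w \<noteq> 0) (at z)" "deriv \<rho> z / \<rho> z \<noteq> 0"
    proof -
      have "eventually (\<lambda>z. deriv \<rho> z / \<rho> z \<noteq> 0 \<and> \<phi> g z \<noteq> 0) (cosparse UNIV)"
      proof (rule eventually_conj)
        show "eventually (\<lambda>z. deriv \<rho> z / \<rho> z \<noteq> 0) (cosparse UNIV)" using H unfolding mero_def by blast
        show "eventually (\<lambda>z. \<phi> g z \<noteq> 0) (cosparse UNIV)" using mero_\<phi>[OF g(1)] unfolding mero_def by blast
      qed
      hence "\<exists>z. deriv \<rho> z / \<rho> z \<noteq> 0 \<and> \<phi> g z \<noteq> 0"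
        using eventually_happens[of _ "cosparse (UNIV :: complex set)"] by simp
      thus thesis using that mero_at(2)[OF mero_\<phi>[OF g(1)]] by blast
    qed
    have "eventually (\<lambda>w. \<phi> g w \<noteq> 0) (nhds z)" using z by (simp add: eventually_nhds_conv_at)
    hence "eventually (\<lambda>w. \<rho> w = 1) (nhds z)" by (rule eventually_mono) (simp add: \<rho> \<open>f = g\<close>)
    hence "deriv \<rho> z = deriv (\<lambda>_. 1) z" by (rule deriv_cong_ev) simp
    thus False using z(3) by simp
  qed
  define e where "e r = (C * ln r + (uf r + ug r)) + ((wh r + \<kappa> * vf r) + (\<kappa> * vg r + (c1/2 + c2/2 + c3 + c4 + 2 * c5 + 2 * c6)))" for r
  have "small e" unfolding e_def
    by (intro small_add small_ln small_cmult small_const uf ug vf vg wh \<kappa>)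
  moreover have "eventually (\<lambda>r. (n/2 - m - 2 - \<kappa>) * T r \<le> e r) radii"
    using radii_ge[of 1] uf(2) ug(2) c1 c2 c3 c4 c5 c6 vf(2) vg(2) evh[OF fg]
  proof eventually_elim
    case (elim r)
    have n1: "real (card roots0 - 1) = real n - 1" using n_large by (simp add: roots0 of_nat_diff)
    have dQ: "real (degree Q) = real n - 2" using n_large by (simp add: degree_Q of_nat_diff)
    have p0: "0 \<le> prox r f" "0 \<le> prox r g" by (rule prox_ge_0)+
    have D: "degree \<Delta> * prox r f \<le> m * prox r f" "degree \<Delta> * prox r g \<le> m * prox r g"
      using degree_\<Delta> p0 by (auto intro!: mult_right_mono)
    have K: "\<kappa> * Ncount (ord (deriv f)) r \<le> \<kappa> * (prox r f + vf r)" "\<kappa> * Ncount (ord (deriv g)) r \<le> \<kappa> * (prox r g + vg r)"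
      using elim \<kappa> by (auto intro!: mult_left_mono)
    have "(real n - 1) * prox r f + (real n - 1) * prox r g \<le> Ncount k r + uf r + ug r"
      using elim(2,3) unfolding n1 Nk by linarith
    also have "\<dots> \<le> Ncount l r + C * ln r + uf r + ug r" using C[OF elim(1)] by linarith
    finally have "(real n - 1) * prox r f + (real n - 1) * prox r g \<le> Ncount l r + C * ln r + uf r + ug r" .
    moreover have "Ncount l r \<le> 1/2 * ((real n - 2) * prox r f + c1) + 1/2 * ((real n - 2) * prox r g + c2)
        + (m * prox r f + c3) + (m * prox r g + c4) + 2 * (prox r f + c5) + 2 * (prox r g + c6) + wh r
        + \<kappa> * (prox r f + vf r) + \<kappa> * (prox r g + vg r)"
    proof -
      have sum: "1/2 * A1 + (1/2 * A2 + (A3 + (A4 + (2 * A5 + (2 * A6 + (A7 + (A8 + A9)))))))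
          \<le> 1/2 * B1 + 1/2 * B2 + B3 + B4 + 2 * B5 + 2 * B6 + B7 + B8 + B9"
        if "A1 \<le> B1" "A2 \<le> B2" "A3 \<le> B3" "A4 \<le> B4" "A5 \<le> B5" "A6 \<le> B6" "A7 \<le> B7" "A8 \<le> B8" "A9 \<le> B9"
        for A1 A2 A3 A4 A5 A6 A7 A8 A9 B1 B2 B3 B4 B5 B6 B7 B8 B9 :: real
        using that by linarith
      show ?thesis unfolding Nl
        by (rule sum[OF elim(4,5)[unfolded dQ] _ _ elim(8,9,12) K]) (use elim(6,7) D in linarith)+
    qed
    ultimately show ?case unfolding T e_def by (simp add: field_simps)
  qed
  moreover have "n/2 - m - 2 - \<kappa> > 0" using n by simp
  ultimately show False by (intro small_contradiction[of e "n/2 - m - 2 - \<kappa>"])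
qed

end

section \<open>The degenerate case\<close>

lemma sum_order_complex_poly:
  fixes P :: "complex poly"
  assumes "P \<noteq> 0"
  shows "(\<Sum>w | poly P w = 0. order w P) = degree P"
proof -
  have "degree P = size (proots P)" by (simp add: size_proots_complex)
  also have "\<dots> = (\<Sum>w\<in>set_mset (proots P). count (proots P) w)" by (rule size_multiset_overloaded_eq)
  also have "\<dots> = (\<Sum>w | poly P w = 0. order w P)"
    using assms by (simp add: set_count_proots count_proots)
  finally show ?thesis by simp
qed

lemma card_roots_ge_half:
  fixes p :: "complex poly"
  assumes "p \<noteq> 0" "\<And>x. order x p \<le> 2"
  shows "degree p \<le> 2 * card {x. poly p x = 0}"
proof -
  have "degree p = (\<Sum>x\<in>{x. poly p x = 0}. order x p)" by (rule sum_order_complex_poly[OF assms(1), symmetric])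
  also have "\<dots> \<le> (\<Sum>x\<in>{x. poly p x = 0}. 2)" by (intro sum_mono assms)
  finally show ?thesis by simp
qed

lemma constant_of_deriv_eventually_zero:
  assumes U: "open U" "connected U" and X: "X analytic_on U"
    and ev: "eventually (\<lambda>z. deriv X z = 0) (cosparse UNIV)"
  obtains c where "\<And>z. z \<in> U \<Longrightarrow> X z = c"
proof -
  have an: "X analytic_on {z}" if "z \<in> U" for z using X that by (subst (asm) analytic_on_analytic_at) auto
  have d0: "deriv X z = 0" if z: "z \<in> U" for z
  proof -
    have "isCont (deriv X) z" using analytic_at_imp_isCont[OF analytic_deriv[OF an[OF z]]] .
    hence "(deriv X \<longlongrightarrow> deriv X z) (at z)" by (rule isContD)
    moreover have "eventually (\<lambda>w. deriv X w = 0) (at z)"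
      using eventually_cosparse_imp_eventually_at[OF ev] by simp
    hence "(deriv X \<longlongrightarrow> 0) (at z)" by (rule tendsto_eventually)
    ultimately show ?thesis using tendsto_unique[of "at z"] by auto
  qed
  have der: "(X has_field_derivative 0) (at z)" if "z \<in> U" for z
    using analytic_derivI[OF an[OF that]] d0[OF that] by simp
  have cont: "continuous_on U X" using X analytic_imp_holomorphic holomorphic_on_imp_continuous_on by blast
  have "\<forall>z\<in>U - {}. (X has_field_derivative 0) (at z)" using der by simp
  from DERIV_zero_connected_constant[OF U(2,1) finite.emptyI cont this] show thesis
    using that by blast
qed

context growth
begin

text \<open>
  Each preimage of \<open>B\<close> costs \<open>1\<close> in the second main theorem, so any divisor that is at least \<open>1\<close> there bounds
  \<open>(q - 1) prox r f\<close>. Such a divisor will come from the other function.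
\<close>
lemma second_main_counting:
  assumes f: "admissible f" "tame f" and B: "finite B" "B \<noteq> {}"
    and k: "locfin k" and S: "finite S" "\<And>z. z \<notin> S \<Longrightarrow> 0 \<le> k z" "\<And>z. z \<notin> S \<Longrightarrow> f z \<in> B \<Longrightarrow> 1 \<le> k z"
  obtains u where "small u" "eventually (\<lambda>r. (card B - 1) * prox r f \<le> Ncount k r + u r) radii"
proof -
  define \<psi> where "\<psi> z = deriv f z / (\<Prod>\<beta>\<in>B. f z - \<beta>)" for z
  have m\<psi>: "mero \<psi>" unfolding \<psi>_def[abs_def] by (intro mero_divide mero_deriv_admissible mero_prod mero_diff_const f B)
  obtain u where u: "small u" "eventually (\<lambda>r. (card B - 1) * prox r f \<le> - Ncount (ord \<psi>) r + u r) radii"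
    using second_main_theorem[OF f B] unfolding \<psi>_def[abs_def] by blast
  have fin: "finite (S \<union> {z. is_pole f z})" using S f by (simp add: admissible_def)
  have le: "(-1) * ord \<psi> z \<le> k z" if "z \<notin> S \<union> {z. is_pole f z}" for z
  proof -
    have z: "\<not> is_pole f z" "z \<notin> S" using that by auto
    have "real_of_int (zorder (\<lambda>w. f w - f z) z) \<ge> 1" using ord_value_pos[OF f(1) z(1)] by simp
    thus ?thesis using ord_value_product[OF f(1) B(1) z(1)] S(2)[OF z(2)] S(3)[OF z(2)]
      by (simp add: \<psi>_def[abs_def])
  qed
  obtain C where C: "\<And>r. r \<ge> 1 \<Longrightarrow> Ncount (\<lambda>z. (-1) * ord \<psi> z) r \<le> Ncount k r + C * ln r"
    using Ncount_mono_finite[OF locfin_cmult[OF locfin_ord[OF m\<psi>]] k fin le] by blast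
  have "small (\<lambda>r. u r + C * ln r)" by (intro small_add small_ln u)
  moreover have "eventually (\<lambda>r. (card B - 1) * prox r f \<le> Ncount k r + (u r + C * ln r)) radii"
    using u(2) radii_ge[of 1]
  proof eventually_elim
    case (elim r)
    thus ?case using C[OF elim(2)] unfolding Ncount_cmult by simp
  qed
  ultimately show thesis by (rule that)
qed

end

context range_polynomial
begin

text \<open>
  \<open>V(f)/P(f) = c V(g)/P(g) + d\<close> without denominators.
\<close>
definition related :: "complex \<Rightarrow> complex \<Rightarrow> (complex \<Rightarrow> complex) \<Rightarrow> (complex \<Rightarrow> complex) \<Rightarrow> bool" where
  "related c d f g \<longleftrightarrow> (\<forall>z. \<not> is_pole f z \<longrightarrow> \<not> is_pole g z \<longrightarrow>
    poly V (f z) * poly P (g z) = c * poly V (g z) * poly P (f z) + d * poly P (f z) * poly P (g z))"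

lemma deriv_V_over_P:
  assumes f: "f analytic_on {w}" and P: "poly P (f w) \<noteq> 0"
  shows "((\<lambda>z. poly V (f z) / poly P (f z)) has_field_derivative - \<phi> f w) (at w)"
proof -
  have df: "(f has_field_derivative deriv f w) (at w)" using f by (intro analytic_derivI)
  have dA: "((\<lambda>z. poly A (f z)) has_field_derivative poly (pderiv A) (f w) * deriv f w) (at w)" for A
    using DERIV_chain2[OF poly_DERIV df] .
  have V': "poly (pderiv V) x = poly (pderiv P) x - of_nat n * x ^ (n - 1)" for x
    by (simp add: V_def P_def pderiv_add pderiv_monom poly_monom)
  have xn: "x ^ n = x * x ^ (n - 1)" for x :: complex using n_large by (simp add: power_eq_if)
  define x where "x = f w"
  have "poly (pderiv V) x * poly P x - poly V x * poly (pderiv P) x = - (x ^ (n - 1) * poly \<Delta> x)"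
    unfolding V' eq_V poly_\<Delta> xn[of x] by (simp add: algebra_simps)
  moreover have "poly (pderiv V) x * D * poly P x - poly V x * (poly (pderiv P) x * D) =
     D * (poly (pderiv V) x * poly P x - poly V x * poly (pderiv P) x)" for D by (simp add: algebra_simps)
  ultimately have "poly (pderiv V) x * deriv f w * poly P x - poly V x * (poly (pderiv P) x * deriv f w)
      = deriv f w * - (x ^ (n - 1) * poly \<Delta> x)" by simp
  thus ?thesis using DERIV_divide[OF dA[of V] dA[of P] P]
    by (simp add: x_def power2_eq_square \<phi>_def mult_ac)
qed

text \<open>
  If \<open>\<rho>' = 0\<close>, then \<open>\<phi> f = c \<phi> g\<close>, and both sides are derivatives of \<open>- V/P\<close>. The set of regular points is connected,
  as the complement of a sparse set, so both integrations produce a single constant; at the remaining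
  points the relation follows by continuity.
\<close>
lemma degenerate_relation:
  assumes f: "admissible f" and g: "admissible g" and \<rho>: "\<rho> = (\<lambda>z. \<phi> f z / \<phi> g z)"
    and H: "\<not> mero (\<lambda>z. deriv \<rho> z / \<rho> z)"
  obtains c d where "c \<noteq> 0" "related c d f g"
proof -
  have m\<rho>: "mero \<rho>" unfolding \<rho> by (intro mero_divide mero_\<phi> f g)
  have "(\<lambda>z. deriv \<rho> z / \<rho> z) meromorphic_on UNIV"
    using mero_meromorphic[OF m\<rho>] by (intro meromorphic_on_divide meromorphic_on_deriv)
  hence "eventually (\<lambda>z. deriv \<rho> z / \<rho> z = 0) (cosparse UNIV)" using meroI H by blast
  moreover have "eventually (\<lambda>z. \<rho> z \<noteq> 0) (cosparse UNIV)" using m\<rho> by (simp add: mero_def)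
  ultimately have d\<rho>: "eventually (\<lambda>z. deriv \<rho> z = 0) (cosparse UNIV)" by eventually_elim simp
  define R where "R z \<longleftrightarrow> f analytic_on {z} \<and> g analytic_on {z} \<and> poly P (f z) \<noteq> 0 \<and> poly P (g z) \<noteq> 0
    \<and> \<phi> f z \<noteq> 0 \<and> \<phi> g z \<noteq> 0" for z
  have evR: "eventually R (cosparse UNIV)"
    unfolding R_def
    using meromorphic_on_imp_analytic_cosparse[OF admissible_meromorphic[OF f]]
      meromorphic_on_imp_analytic_cosparse[OF admissible_meromorphic[OF g]]
      mero_poly[OF f P_nz] mero_poly[OF g P_nz] mero_\<phi>[OF f] mero_\<phi>[OF g]
    by (intro eventually_conj) (auto simp: mero_def)
  define U where "U = UNIV - {z. \<not> R z}"
  have sp: "{z. \<not> R z} sparse_in UNIV" using evR by (simp only: eventually_cosparse)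
  have U: "open U" "connected U" unfolding U_def
    by (rule open_diff_sparse_pts[OF open_UNIV sp],
        rule sparse_imp_connected[OF _ connected_UNIV open_UNIV sp]) simp
  have R: "R z" if "z \<in> U" for z using that by (simp add: U_def)
  have a\<phi>: "\<phi> f analytic_on {z}" "\<phi> g analytic_on {z}" if "z \<in> U" for z
    unfolding \<phi>_def[abs_def] using R[OF that] unfolding R_def
    by (auto intro!: analytic_on_divide analytic_on_mult analytic_on_power analytic_deriv analytic_on_poly_comp)
  have "\<rho> analytic_on U" unfolding \<rho>
    by (subst analytic_on_analytic_at) (use a\<phi> R in \<open>auto intro!: analytic_on_divide simp: R_def\<close>)
  then obtain c where c: "\<And>z. z \<in> U \<Longrightarrow> \<rho> z = c"
    using constant_of_deriv_eventually_zero[OF U _ d\<rho>] by blast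
  define X where "X z = poly V (f z) / poly P (f z) - c * (poly V (g z) / poly P (g z))" for z
  have dX: "(X has_field_derivative 0) (at z)" if z: "z \<in> U" for z
  proof -
    have "(X has_field_derivative - \<phi> f z - c * - \<phi> g z) (at z)"
      unfolding X_def[abs_def] using R[OF z] unfolding R_def
      by (intro DERIV_diff DERIV_cmult deriv_V_over_P) auto
    moreover have "\<phi> f z = c * \<phi> g z"
    proof -
      have "\<phi> f z / \<phi> g z = c" using c[OF z] unfolding \<rho> .
      moreover have "\<phi> g z \<noteq> 0" using R[OF z] unfolding R_def by blast
      ultimately show ?thesis by (simp add: divide_eq_eq)
    qed
    ultimately show ?thesis by simp
  qed
  hence cont: "continuous_on U X" by (meson DERIV_isCont continuous_at_imp_continuous_on)
  have "\<forall>z\<in>U - {}. (X has_field_derivative 0) (at z)" using dX by simp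
  from DERIV_zero_connected_constant[OF U(2,1) finite.emptyI cont this]
  obtain d where d: "\<And>z. z \<in> U \<Longrightarrow> X z = d" by blast
  have "\<exists>z. R z" using eventually_happens[OF evR] by simp
  then obtain z0 where "R z0" by blast
  hence "z0 \<in> U" by (simp add: U_def)
  hence "c \<noteq> 0" using c[of z0] \<open>R z0\<close> by (auto simp: \<rho> R_def)
  moreover have "related c d f g" unfolding related_def
  proof (intro allI impI)
    fix z assume z: "\<not> is_pole f z" "\<not> is_pole g z"
    define Y where "Y z = poly V (f z) * poly P (g z) - (c * poly V (g z) * poly P (f z) + d * poly P (f z) * poly P (g z))" for z
    have "Y analytic_on {z}" unfolding Y_def[abs_def]
      using admissible_analytic[OF f z(1)] admissible_analytic[OF g z(2)]
      by (intro analytic_on_diff analytic_on_add analytic_on_mult analytic_on_const analytic_on_poly_comp)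
    hence "(Y \<longlongrightarrow> Y z) (at z)" using analytic_at_imp_isCont isContD by blast
    moreover have "eventually (\<lambda>w. Y w = 0) (at z)"
    proof -
      have "eventually R (at z)" using eventually_cosparse_imp_eventually_at[OF evR] by simp
      thus ?thesis
      proof eventually_elim
        case (elim w)
        hence "poly V (f w) / poly P (f w) - c * (poly V (g w) / poly P (g w)) = d" using d[of w] by (simp add: U_def X_def)
        hence "poly V (f w) / poly P (f w) = c * (poly V (g w) / poly P (g w)) + d" by (simp add: algebra_simps)
        moreover have "poly P (f w) \<noteq> 0" "poly P (g w) \<noteq> 0" using elim unfolding R_def by blast+
        moreover have "x * q = c * y * p + d * p * q"
          if "x / p = c * (y / q) + d" "p \<noteq> 0" "q \<noteq> 0" for x y p q :: complex
        proof -
          have "x = (c * (y / q) + d) * p" using that by (simp add: divide_eq_eq)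
          thus ?thesis using that(3) by (simp add: field_simps)
        qed
        ultimately show ?case unfolding Y_def by simp
      qed
    qed
    hence "(Y \<longlongrightarrow> 0) (at z)" by (rule tendsto_eventually)
    ultimately have "Y z = 0" using tendsto_unique[of "at z"] by auto
    thus "poly V (f z) * poly P (g z) = c * poly V (g z) * poly P (f z) + d * poly P (f z) * poly P (g z)"
      by (simp add: Y_def)
  qed
  ultimately show thesis by (rule that)
qed

lemma related_sym:
  assumes "c \<noteq> 0" "related c d f g" shows "related (1 / c) (- d / c) g f"
  unfolding related_def
proof (intro allI impI)
  fix z assume "\<not> is_pole g z" "\<not> is_pole f z"
  hence "poly V (f z) * poly P (g z) = c * poly V (g z) * poly P (f z) + d * poly P (f z) * poly P (g z)"
    using assms(2) by (simp add: related_def)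
  hence "c * (poly V (g z) * poly P (f z)) = poly V (f z) * poly P (g z) - d * poly P (f z) * poly P (g z)" by simp
  hence "poly V (g z) * poly P (f z) = (poly V (f z) * poly P (g z) - d * poly P (f z) * poly P (g z)) / c"
    using assms(1) by (simp add: field_simps)
  thus "poly V (g z) * poly P (f z) = 1 / c * poly V (f z) * poly P (g z) + - d / c * poly P (g z) * poly P (f z)"
    by (simp add: diff_divide_distrib mult_ac)
qed

text \<open>
  \<open>e P - V = e w^n + (e - 1)(a w^m + b)\<close> is a trinomial with non-zero coefficients, and a non-zero root of a trinomial has
  multiplicity at most \<open>2\<close>. So it has at least \<open>n/2 > m + 2\<close> distinct roots.
\<close>
lemma many_exceptional_roots:
  assumes e: "e \<noteq> 0" "e \<noteq> 1"
  shows "finite {w. e * poly P w = poly V w}" "m + 3 \<le> card {w. e * poly P w = poly V w}"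
proof -
  define X where "X = smult e P - V"
  have X: "poly X w = e * w ^ n + (e - 1) * (a * w ^ m + b)" for w
    by (simp add: X_def poly_P poly_V algebra_simps)
  have roots: "{w. e * poly P w = poly V w} = {w. poly X w = 0}" by (auto simp: X_def)
  have X0: "poly X 0 \<noteq> 0" unfolding X using e b_nz m_pos n_large by (simp add: power_0_left)
  hence Xnz: "X \<noteq> 0" by auto
  show "finite {w. e * poly P w = poly V w}" unfolding roots by (rule poly_roots_finite[OF Xnz])
  have dX: "degree X = n"
  proof -
    have "degree V < degree (smult e P)" using degree_V degree_P e n_large by simp
    hence "degree (smult e P + - V) = degree (smult e P)" by (intro degree_add_eq_left) simp
    thus ?thesis using e degree_P by (simp add: X_def)
  qed
  have Xm: "X = monom e n + monom ((e - 1) * a) m + [:(e - 1) * b:]"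
  proof -
    have "poly X = poly (monom e n + monom ((e - 1) * a) m + [:(e - 1) * b:])"
      by (rule ext) (simp add: X poly_monom algebra_simps)
    thus ?thesis by (simp only: poly_eq_poly_eq_iff)
  qed
  have ord2: "order x X \<le> 2" for x
  proof (rule ccontr)
    assume "\<not> ?thesis"
    hence o: "order x X \<ge> 3" by simp
    have X1: "pderiv X \<noteq> 0" using dX n_large pderiv_eq_0_iff[of X] by linarith
    have d1: "degree (pderiv X) = n - 1" by (simp add: degree_pderiv dX)
    have X2: "pderiv (pderiv X) \<noteq> 0" using d1 n_large pderiv_eq_0_iff[of "pderiv X"] by linarith
    have r0: "poly X x = 0" using o by (simp add: order_root)
    have o1: "order x X = Suc (order x (pderiv X))" by (rule order_pderiv[OF Xnz r0])
    hence r1: "poly (pderiv X) x = 0" using o by (simp add: order_root)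
    have "order x (pderiv X) = Suc (order x (pderiv (pderiv X)))" by (rule order_pderiv[OF X1 r1])
    hence r2: "poly (pderiv (pderiv X)) x = 0" using o o1 by (simp add: order_root)
    have x0: "x \<noteq> 0" using r0 X0 by auto
    have pw: "x * x ^ (n - 1) = x ^ n" "x * x ^ (m - 1) = x ^ m" using m_pos n_large by (auto simp: power_eq_if)
    have pw2: "x ^ 2 * x ^ (n - 2) = x ^ n"
    proof -
      have "2 + (n - 2) = n" using n_large by simp
      thus ?thesis unfolding power_add[symmetric] by (rule arg_cong)
    qed
    have P1: "x * poly (pderiv X) x = e * of_nat n * x ^ n + (e - 1) * a * of_nat m * x ^ m"
    proof -
      have "x * poly (pderiv X) x = e * of_nat n * (x * x ^ (n - 1)) + (e - 1) * a * of_nat m * (x * x ^ (m - 1))"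
        unfolding Xm by (simp add: pderiv_add pderiv_monom poly_monom pderiv_pCons algebra_simps)
      thus ?thesis unfolding pw .
    qed
    have P2: "x ^ 2 * poly (pderiv (pderiv X)) x = e * of_nat n * (of_nat n - 1) * x ^ n + (e - 1) * a * of_nat m * (of_nat m - 1) * x ^ m"
    proof -
      have dd: "poly (pderiv (pderiv X)) x = of_nat (n - 1) * (of_nat n * e) * x ^ (n - 2) + of_nat (m - 1) * (of_nat m * ((e - 1) * a)) * x ^ (m - 2)"
        unfolding Xm by (simp add: pderiv_add pderiv_monom poly_monom pderiv_pCons numeral_2_eq_2)
      have dd': "x ^ 2 * poly (pderiv (pderiv X)) x = of_nat n * e * (of_nat (n - 1) * (x ^ 2 * x ^ (n - 2)))
          + of_nat m * ((e - 1) * a) * (of_nat (m - 1) * (x ^ 2 * x ^ (m - 2)))"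
        unfolding dd distrib_left by (simp only: mult_ac)
      have pm: "of_nat (m - 1) * (x ^ 2 * x ^ (m - 2)) = of_nat (m - 1) * x ^ m"
      proof (cases "m = 1")
        case False
        hence "m \<ge> 2" using m_pos by simp
        hence "x ^ 2 * x ^ (m - 2) = x ^ m" unfolding power_add[symmetric] by (intro arg_cong[where f = "\<lambda>k. x ^ k"]) simp
        thus ?thesis by simp
      qed simp
      have nm: "of_nat (n - 1) = (of_nat n - 1 :: complex)" "of_nat (m - 1) = (of_nat m - 1 :: complex)"
        using m_pos n_large by (auto simp: of_nat_diff)
      show ?thesis unfolding dd' pm pw2 unfolding nm by (simp only: mult_ac)
    qed
    have "e * of_nat n * (of_nat n - of_nat m) * x ^ n = 0"
    proof -
      define A where "A = e * of_nat n * x ^ n"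
      define B where "B = (e - 1) * a * of_nat m * x ^ m"
      have "A + B = 0" using P1 r1 by (simp add: A_def B_def)
      hence B: "B = - A" by (simp add: add_eq_0_iff)
      have "A * (of_nat n - 1) + B * (of_nat m - 1) = 0" using P2 r2 by (simp add: A_def B_def mult_ac)
      hence "A * (of_nat n - of_nat m) = 0" unfolding B by (simp add: algebra_simps)
      thus ?thesis by (simp add: A_def mult_ac)
    qed
    moreover have "of_nat n - of_nat m \<noteq> (0::complex)" using n_large by simp
    ultimately show False using e x0 n_large by simp
  qed
  have "n \<le> 2 * card {w. poly X w = 0}" using card_roots_ge_half[OF Xnz ord2] dX by simp
  thus "m + 3 \<le> card {w. e * poly P w = poly V w}" unfolding roots using n_large by linarith
qed

text \<open>
  Where \<open>V(f)/P(f) = d\<close>, the relation forces \<open>V(g) = 0\<close>; where \<open>V(f)/P(f) = c + d\<close>, it forces \<open>V(g) = P(g)\<close>,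
  that is \<open>g = 0\<close>. So the at least \<open>m + 3\<close> values \<open>w\<close> with \<open>V w = e P w\<close> are taken by \<open>f\<close> only at the zeros of \<open>V(g)\<close> or
  of \<open>g\<close>, and there are at most \<open>m prox r g\<close> of these.
\<close>
lemma exceptional_inequality:
  assumes gr: "growth T r0"
    and f: "admissible f" "growth.tame T r0 f" and g: "admissible g"
    and rel: "c \<noteq> 0" "related c d f g" and e: "e = d \<or> e = c + d" "e \<noteq> 0" "e \<noteq> 1"
  obtains u where "growth.small T r0 u"
    "eventually (\<lambda>r. (m + 2) * prox r f \<le> m * prox r g + u r) (growth.radii T r0)"
proof -
  interpret growth T r0 by (rule gr)
  define B where "B = {w. e * poly P w = poly V w}"
  have B: "finite B" "m + 3 \<le> card B" using many_exceptional_roots[OF e(2,3)] by (auto simp: B_def)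
  have B0: "B \<noteq> {}" using B by auto
  define Y where "Y = (if e = d then V else [:0, 1:])"
  have Ynz: "Y \<noteq> 0" using V_nz by (simp add: Y_def)
  have dY: "degree Y \<le> m" using degree_V m_pos by (simp add: Y_def)
  have mY: "mero (\<lambda>z. poly Y (g z))" by (rule mero_poly[OF g Ynz])
  define S where "S = {z. is_pole f z} \<union> {z. is_pole g z}"
  have S: "finite S" using f g by (simp add: S_def admissible_def)
  have zero: "poly Y (g z) = 0" if z: "z \<notin> S" "f z \<in> B" for z
  proof -
    have r: "poly V (f z) * poly P (g z) = c * poly V (g z) * poly P (f z) + d * poly P (f z) * poly P (g z)"
      using rel(2) z by (simp add: related_def S_def)
    have eB: "poly V (f z) = e * poly P (f z)" using z by (simp add: B_def)
    have Pf: "poly P (f z) \<noteq> 0" using eB V_at_root by fastforce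
    show ?thesis
    proof (cases "e = d")
      case True
      hence "c * poly V (g z) * poly P (f z) = 0" using r eB by (simp add: algebra_simps)
      thus ?thesis using True Pf rel(1) by (simp add: Y_def)
    next
      case False
      hence "e = c + d" using e by simp
      hence "poly P (f z) * (c * (poly P (g z) - poly V (g z))) = 0" using r eB by (simp add: algebra_simps)
      hence "poly P (g z) - poly V (g z) = 0" using Pf rel(1) by simp
      hence "g z ^ n = 0" by (simp add: eq_V)
      thus ?thesis using False by (simp add: Y_def)
    qed
  qed
  have an: "(\<lambda>z. poly Y (g z)) analytic_on {z}" if "z \<notin> S" for z
    using that by (intro analytic_on_poly_comp admissible_analytic[OF g]) (auto simp: S_def)
  have k0: "0 \<le> ord (\<lambda>z. poly Y (g z)) z" if "z \<notin> S" for z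
    using ord_nonneg[OF mY an[OF that]] by simp
  have k1: "1 \<le> ord (\<lambda>z. poly Y (g z)) z" if "z \<notin> S" "f z \<in> B" for z
    using ord_pos[OF mY an[OF that(1)] zero[OF that]] by simp
  obtain u where u: "small u" "eventually (\<lambda>r. (card B - 1) * prox r f \<le> Ncount (ord (\<lambda>z. poly Y (g z))) r + u r) radii"
    using second_main_counting[OF f B(1) B0 locfin_ord[OF mY] S k0 k1] by blast
  obtain C where C: "eventually (\<lambda>r. Ncount (ord (\<lambda>z. poly Y (g z))) r \<le> degree Y * prox r g + C) radii"
    using count_poly_le[OF g Ynz] by blast
  have "small (\<lambda>r. u r + C)" by (intro small_add u small_const)
  moreover have "eventually (\<lambda>r. (m + 2) * prox r f \<le> m * prox r g + (u r + C)) radii"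
    using u(2) C
  proof eventually_elim
    case (elim r)
    have "(m + 2) * prox r f \<le> (card B - 1) * prox r f" using B by (intro mult_right_mono prox_ge_0) auto
    moreover have "degree Y * prox r g \<le> m * prox r g" using dY by (intro mult_right_mono prox_ge_0) auto
    ultimately show ?case using elim by linarith
  qed
  ultimately show thesis by (rule that)
qed

text \<open>
  For \<open>c = -1\<close> and \<open>d = 1\<close> both exceptional values \<open>d\<close> and \<open>c + d\<close> are \<open>0\<close> or \<open>1\<close>, so the previous lemma gives
  nothing. But here the relation is \<open>(f g)^n = V(f) V(g)\<close>: if \<open>f\<close> takes the value \<open>0\<close> or a root \<open>\<gamma>\<close> of \<open>V\<close>, then \<open>f\<close> or \<open>g\<close>
  has a zero, hence \<open>V(f) V(g)\<close> has order at least \<open>n\<close>.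
\<close>
lemma reciprocal_inequality:
  assumes gr: "growth T r0"
    and f: "admissible f" "growth.tame T r0 f" and g: "admissible g"
    and rel: "related (-1) 1 f g"
  obtains u where "growth.small T r0 u"
    "eventually (\<lambda>r. n * prox r f \<le> m * (prox r f + prox r g) + u r) (growth.radii T r0)"
proof -
  interpret growth T r0 by (rule gr)
  have "\<exists>\<gamma>. poly V \<gamma> = 0"
  proof -
    have "poly V 1 \<noteq> poly V 0" using a_nz m_pos by (simp add: poly_V power_0_left)
    hence "\<not> constant (poly V)" unfolding constant_def by blast
    thus ?thesis by (rule fundamental_theorem_of_algebra)
  qed
  then obtain \<gamma> where \<gamma>: "poly V \<gamma> = 0" by blast
  have \<gamma>0: "\<gamma> \<noteq> 0" using \<gamma> b_nz m_pos by (auto simp: poly_V power_0_left)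
  define B where "B = {0, \<gamma>}"
  have B: "finite B" "B \<noteq> {}" "card B = 2" using \<gamma>0 by (auto simp: B_def)
  define S where "S = {z. is_pole f z} \<union> {z. is_pole g z}"
  have S: "finite S" using f g by (simp add: S_def admissible_def)
  have prod: "f z ^ n * g z ^ n = poly V (f z) * poly V (g z)" if "z \<notin> S" for z
  proof -
    have "poly V (f z) * poly P (g z) = - 1 * poly V (g z) * poly P (f z) + 1 * poly P (f z) * poly P (g z)"
      using rel that unfolding related_def S_def by blast
    moreover have "poly P x = x ^ n + poly V x" for x by (simp add: eq_V)
    ultimately show ?thesis by (simp add: algebra_simps)
  qed
  have mf: "mero f" and mg: "mero g" and mVf: "mero (\<lambda>z. poly V (f z))" and mVg: "mero (\<lambda>z. poly V (g z))"
    using mero_admissible f g mero_poly[OF f(1) V_nz] mero_poly[OF g V_nz] by auto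
  have ords: "int n * zorder f z + int n * zorder g z = zorder (\<lambda>z. poly V (f z)) z + zorder (\<lambda>z. poly V (g z)) z" for z
  proof -
    have "eventually (\<lambda>z. z \<notin> S) (cosparse UNIV)" by (rule eventually_not_in_cosparse[OF finite_imp_sparse[OF S]])
    hence "eventually (\<lambda>z. z \<notin> S) (at z)" by (rule eventually_cosparse_imp_eventually_at) simp
    hence "eventually (\<lambda>w. f w ^ n * g w ^ n = poly V (f w) * poly V (g w)) (at z)" by (rule eventually_mono) (rule prod)
    hence "zorder (\<lambda>w. f w ^ n * g w ^ n) z = zorder (\<lambda>w. poly V (f w) * poly V (g w)) z" by (rule zorder_cong) simp
    moreover have "zorder (\<lambda>w. f w ^ n * g w ^ n) z = int n * zorder f z + int n * zorder g z"
      using ord_mult[OF mero_power[OF mf] mero_power[OF mg], of n n z] ord_power[OF mf, of n z] ord_power[OF mg, of n z] by simp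
    moreover have "zorder (\<lambda>w. poly V (f w) * poly V (g w)) z = zorder (\<lambda>z. poly V (f z)) z + zorder (\<lambda>z. poly V (g z)) z"
      by (rule ord_mult[OF mVf mVg])
    ultimately show ?thesis by simp
  qed
  define k where "k z = (1 / n) * ord (\<lambda>z. poly V (f z)) z + (1 / n) * ord (\<lambda>z. poly V (g z)) z" for z
  have lk: "locfin k" unfolding k_def[abs_def] by (intro locfin_add locfin_cmult locfin_ord mVf mVg)
  have n0: "real n > 0" using n_large by simp
  have kn: "k z = (1 / n) * real_of_int (zorder (\<lambda>z. poly V (f z)) z + zorder (\<lambda>z. poly V (g z)) z)" for z
    by (simp add: k_def add_divide_distrib)
  have kge: "1 \<le> k z" if "int n \<le> zorder (\<lambda>z. poly V (f z)) z + zorder (\<lambda>z. poly V (g z)) z" for z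
  proof -
    have "real n \<le> real_of_int (zorder (\<lambda>z. poly V (f z)) z + zorder (\<lambda>z. poly V (g z)) z)"
      using that by linarith
    thus ?thesis unfolding kn using n0 by (simp add: field_simps)
  qed
  have an: "f analytic_on {z}" "g analytic_on {z}" if "z \<notin> S" for z
    using that f g by (auto simp: S_def intro: admissible_analytic)
  have nn: "0 \<le> zorder f z" "0 \<le> zorder g z" "0 \<le> zorder (\<lambda>z. poly V (f z)) z" "0 \<le> zorder (\<lambda>z. poly V (g z)) z"
    if "z \<notin> S" for z
    using an[OF that] mf mg mVf mVg by (auto intro!: ord_nonneg analytic_on_poly_comp)
  have k0: "0 \<le> k z" if "z \<notin> S" for z unfolding kn using nn[OF that] n0 by simp
  have V0: "poly V 0 \<noteq> 0" using b_nz m_pos by (simp add: poly_V power_0_left)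
  have k1: "1 \<le> k z" if z: "z \<notin> S" "f z \<in> B" for z
  proof (rule kge, cases "f z = 0")
    case True
    have "zorder f z \<ge> 1" using ord_pos[OF mf an(1)[OF z(1)] True] by simp
    hence "int n * 1 \<le> int n * zorder f z" by (intro mult_left_mono) auto
    moreover have "0 \<le> int n * zorder g z" using nn[OF z(1)] by simp
    ultimately show "int n \<le> zorder (\<lambda>z. poly V (f z)) z + zorder (\<lambda>z. poly V (g z)) z"
      using ords[of z] by linarith
  next
    case False
    hence fz: "f z = \<gamma>" using z by (simp add: B_def)
    have "zorder f z = 0" using an(1)[OF z(1)] False by (rule ord_eq_0)
    moreover have "zorder (\<lambda>z. poly V (f z)) z > 0"
      using an(1)[OF z(1)] fz \<gamma> by (intro ord_pos[OF mVf] analytic_on_poly_comp) auto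
    ultimately have "int n * zorder g z > 0" using ords[of z] nn[OF z(1)] by simp
    hence "zorder g z \<ge> 1" using n0 by (simp add: zero_less_mult_iff)
    hence "int n * 1 \<le> int n * zorder g z" by (intro mult_left_mono) auto
    thus "int n \<le> zorder (\<lambda>z. poly V (f z)) z + zorder (\<lambda>z. poly V (g z)) z"
      using ords[of z] \<open>zorder f z = 0\<close> by simp
  qed
  obtain u where u: "small u" "eventually (\<lambda>r. (card B - 1) * prox r f \<le> Ncount k r + u r) radii"
    using second_main_counting[OF f B(1,2) lk S k0 k1] by blast
  obtain C where C: "eventually (\<lambda>r. Ncount (ord (\<lambda>z. poly V (f z))) r \<le> degree V * prox r f + C) radii"
    using count_poly_le[OF f(1) V_nz] by blast
  obtain D where D: "eventually (\<lambda>r. Ncount (ord (\<lambda>z. poly V (g z))) r \<le> degree V * prox r g + D) radii"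
    using count_poly_le[OF g V_nz] by blast
  have "small (\<lambda>r. n * u r + (C + D))" by (intro small_add small_cmult u small_const) simp
  moreover have "eventually (\<lambda>r. n * prox r f \<le> m * (prox r f + prox r g) + (n * u r + (C + D))) radii"
    using u(2) C D
  proof eventually_elim
    case (elim r)
    have "Ncount k r = (1 / n) * Ncount (ord (\<lambda>z. poly V (f z))) r + (1 / n) * Ncount (ord (\<lambda>z. poly V (g z))) r"
      unfolding k_def[abs_def] Ncount_add[OF locfin_cmult[OF locfin_ord[OF mVf]] locfin_cmult[OF locfin_ord[OF mVg]]] Ncount_cmult ..
    hence "n * Ncount k r = Ncount (ord (\<lambda>z. poly V (f z))) r + Ncount (ord (\<lambda>z. poly V (g z))) r"
      using n0 by (simp add: field_simps)
    moreover have "n * prox r f \<le> n * (Ncount k r + u r)" using elim(1) B(3) by (intro mult_left_mono) auto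
    moreover have "degree V * prox r f \<le> m * prox r f" "degree V * prox r g \<le> m * prox r g"
      using degree_V by (auto intro!: mult_right_mono prox_ge_0)
    ultimately show ?case using elim(2,3) by (simp add: distrib_left)
  qed
  ultimately show thesis by (rule that)
qed

text \<open>
  The inequalities for \<open>f\<close> and for \<open>g\<close> (by the inverse relation) are added; the sum contradicts that \<open>T\<close> is not negligible
  against itself.
\<close>
theorem related_imp_trivial:
  assumes gr: "growth T r0" and T: "\<And>r. T r = prox r f + prox r g"
    and f: "admissible f" "growth.tame T r0 f" and g: "admissible g" "growth.tame T r0 g"
    and rel: "c \<noteq> 0" "related c d f g"
  shows "c = 1 \<and> d = 0"
proof -
  interpret growth T r0 by (rule gr)
  have sym: "1 / c \<noteq> 0" "related (1 / c) (- d / c) g f" using rel related_sym by auto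
  have not_recip: "\<not> (c = -1 \<and> d = 1)"
  proof
    assume "c = -1 \<and> d = 1"
    hence r: "related (-1) 1 f g" "related (-1) 1 g f" using rel sym by auto
    obtain u where u: "small u" "eventually (\<lambda>r. n * prox r f \<le> m * (prox r f + prox r g) + u r) radii"
      using reciprocal_inequality[OF gr f g(1) r(1)] by blast
    obtain v where v: "small v" "eventually (\<lambda>r. n * prox r g \<le> m * (prox r g + prox r f) + v r) radii"
      using reciprocal_inequality[OF gr g f(1) r(2)] by blast
    have "eventually (\<lambda>r. (real n - 2 * m) * T r \<le> u r + v r) radii"
      using u(2) v(2) by eventually_elim (simp add: T algebra_simps)
    moreover have "real n - 2 * m > 0" using n_large by simp
    ultimately show False using small_contradiction[OF small_add[OF u(1) v(1)]] by blast
  qed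
  show ?thesis
  proof (rule ccontr)
    assume nt: "\<not> (c = 1 \<and> d = 0)"
    have "\<exists>e. (e = d \<or> e = c + d) \<and> e \<noteq> 0 \<and> e \<noteq> 1"
    proof (rule ccontr)
      assume "\<not> ?thesis"
      hence "(d = 0 \<or> d = 1) \<and> (c + d = 0 \<or> c + d = 1)" by blast
      thus False using rel(1) nt not_recip by (auto simp: add_eq_0_iff2)
    qed
    then obtain e where e: "e = d \<or> e = c + d" "e \<noteq> 0" "e \<noteq> 1" by blast
    have "\<exists>e. (e = - d / c \<or> e = 1 / c + - d / c) \<and> e \<noteq> 0 \<and> e \<noteq> 1"
    proof (rule ccontr)
      assume "\<not> ?thesis"
      hence 1: "- d / c = 0 \<or> - d / c = 1" and 2: "1 / c + - d / c = 0 \<or> 1 / c + - d / c = 1" by blast+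
      from 1 show False
      proof
        assume "- d / c = 0"
        hence "d = 0" using rel(1) by simp
        thus False using 2 rel(1) nt by simp
      next
        assume d: "- d / c = 1"
        hence "1 / c + 1 = 0 \<or> 1 / c + 1 = 1" using 2 by (simp only:)
        hence "1 / c = -1" using rel(1) by (auto simp: add_eq_0_iff2)
        hence "- c = 1" using rel(1) by (simp add: divide_eq_eq)
        hence "c = -1" by (metis minus_minus)
        thus False using d not_recip by simp
      qed
    qed
    then obtain e' where e': "e' = - d / c \<or> e' = 1 / c + - d / c" "e' \<noteq> 0" "e' \<noteq> 1" by blast
    obtain u where u: "small u" "eventually (\<lambda>r. (m + 2) * prox r f \<le> m * prox r g + u r) radii"
      using exceptional_inequality[OF gr f g(1) rel e] by blast
    obtain v where v: "small v" "eventually (\<lambda>r. (m + 2) * prox r g \<le> m * prox r f + v r) radii"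
      using exceptional_inequality[OF gr g f(1) sym e'] by blast
    have "eventually (\<lambda>r. 2 * T r \<le> u r + v r) radii"
      using u(2) v(2) by eventually_elim (simp add: T algebra_simps)
    thus False using small_contradiction[OF small_add[OF u(1) v(1)], of 2] by simp
  qed
qed

end

section \<open>Functions essential at infinity\<close>

text \<open>
  For a function that is analytic near infinity and meromorphic there, one of the two alternatives
  excluded here would hold. This form is convenient because it refers to values only.
\<close>
definition transcendental :: "(complex \<Rightarrow> complex) \<Rightarrow> bool" where
  "transcendental g \<longleftrightarrow> (\<forall>M. \<not> eventually (\<lambda>z. norm (g z) \<le> M) at_infinity) \<and> \<not> filterlim g at_infinity at_infinity"

lemma eventually_at_0_imp_at_infinity:
  assumes "eventually P (at (0::complex))"
  shows "eventually (\<lambda>z. P (inverse z)) at_infinity"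
proof -
  have "filterlim inverse (at (0::complex)) at_infinity"
    by (rule filterlim_atI[OF tendsto_inverse_0])
      (use eventually_not_equal_at_infinity[of "0::complex"] in \<open>auto elim: eventually_mono\<close>)
  thus ?thesis using assms unfolding filterlim_iff by blast
qed

text \<open>
  Stated for a power because the relation between \<open>f\<close> and \<open>g\<close> determines only \<open>g^m\<close>.
\<close>
lemma not_transcendental:
  assumes "not_essential (\<lambda>w. g (inverse w) ^ k) 0" "k > 0"
  shows "\<not> transcendental g"
proof
  assume t: "transcendental g"
  from assms(1) consider (lim) l where "((\<lambda>w. g (inverse w) ^ k) \<longlongrightarrow> l) (at 0)" | (pole) "is_pole (\<lambda>w. g (inverse w) ^ k) 0"
    unfolding not_essential_def by blast
  thus False
  proof cases
    case lim
    have "eventually (\<lambda>w. dist (g (inverse w) ^ k) l < 1) (at 0)" using lim by (rule tendstoD) simp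
    hence "eventually (\<lambda>w. norm (g (inverse w)) \<le> norm l + 1) (at 0)"
    proof eventually_elim
      case (elim w)
      have "norm (g (inverse w) ^ k) \<le> norm l + 1"
        using elim norm_triangle_ineq2[of "g (inverse w) ^ k" l] by (simp add: dist_norm)
      hence le: "norm (g (inverse w)) ^ k \<le> norm l + 1" by (simp add: norm_power)
      show ?case
      proof (rule ccontr)
        assume "\<not> ?case"
        hence gt: "norm (g (inverse w)) > norm l + 1" by simp
        hence "norm (g (inverse w)) ^ 1 \<le> norm (g (inverse w)) ^ k"
          using assms(2) norm_ge_zero[of l] by (intro power_increasing) linarith+
        thus False using le gt by simp
      qed
    qed
    from eventually_at_0_imp_at_infinity[OF this] show False using t by (simp add: transcendental_def)
  next
    case pole
    have "filterlim g at_infinity at_infinity"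
      unfolding filterlim_at_infinity[OF order_refl]
    proof (intro allI impI)
      fix r :: real assume r: "r > 0"
      have "eventually (\<lambda>w. r ^ k + 1 \<le> norm (g (inverse w) ^ k)) (at 0)"
        using pole r unfolding is_pole_def filterlim_at_infinity[OF order_refl] by (simp add: add_pos_pos)
      hence "eventually (\<lambda>w. r \<le> norm (g (inverse w))) (at 0)"
      proof eventually_elim
        case (elim w)
        show ?case
        proof (rule ccontr)
          assume "\<not> ?case"
          hence "norm (g (inverse w)) ^ k \<le> r ^ k" by (intro power_mono) auto
          thus False using elim by (simp add: norm_power)
        qed
      qed
      from eventually_at_0_imp_at_infinity[OF this] show "eventually (\<lambda>z. r \<le> norm (g z)) at_infinity" by simp
    qed
    thus False using t by (simp add: transcendental_def)
  qed
qed

lemma coprime_root_unity: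
  fixes x :: complex
  assumes "gcd n m = 1" "n > 0" "x ^ n = 1" "x ^ m = 1"
  shows "x = 1"
proof -
  obtain u v where "n * u = m * v + gcd n m" using bezout_nat[of n m] assms(2) by auto
  hence "x ^ (n * u) = x ^ (m * v) * x" using assms(1) by simp
  thus ?thesis using assms(3,4) by (simp add: power_mult)
qed

lemma norm_inverse_gt: "0 < R \<Longrightarrow> (w::complex) \<noteq> 0 \<Longrightarrow> norm w < 1 / R \<Longrightarrow> R < norm (inverse w)"
  by (simp only: norm_inverse) (simp add: field_simps)

text \<open>
  The great theorem of Picard, applied to \<open>1 / (K - a)\<close>, which omits \<open>0\<close> and \<open>1 / (b - a)\<close>.
\<close>
lemma meromorphic_at_infinity_of_omitted_values:
  assumes R: "R > 0" and K: "\<And>z. norm z > R \<Longrightarrow> K analytic_on {z}" and ab: "a \<noteq> b"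
    and om: "\<And>z. norm z > R \<Longrightarrow> K z \<noteq> a \<and> K z \<noteq> b"
  shows "(\<lambda>w. K (inverse w)) meromorphic_on {0}"
proof -
  define M where "M = ball (0::complex) (1 / R)"
  have M: "norm (inverse w) > R" if "w \<in> M - {0}" for w
    using that R by (intro norm_inverse_gt) (auto simp: M_def)
  have an: "(\<lambda>w. K (inverse w)) analytic_on {w}" if "w \<in> M - {0}" for w
  proof -
    have "(K \<circ> inverse) analytic_on {w}"
      by (rule analytic_on_compose) (use that K[OF M[OF that]] in \<open>auto intro!: analytic_intros\<close>)
    thus ?thesis by (simp add: o_def)
  qed
  hence anM: "(\<lambda>w. K (inverse w)) analytic_on (M - {0})" by (subst analytic_on_analytic_at) blast
  define Y where "Y w = inverse (K (inverse w) - a)" for w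
  have anY: "Y analytic_on (M - {0})"
    unfolding Y_def[abs_def] using om M by (intro analytic_on_inverse analytic_on_diff anM analytic_on_const) auto
  have oM: "open M" "0 \<in> M" using R by (auto simp: M_def)
  have ba: "0 \<noteq> inverse (b - a)" using ab by simp
  have omY: "Y w \<noteq> 0 \<and> Y w \<noteq> inverse (b - a)" if "w \<in> M - {0}" for w
    using om[OF M[OF that]] by (auto simp: Y_def)
  obtain l where l: "(Y \<longlongrightarrow> l) (at 0) \<or> ((inverse \<circ> Y) \<longlongrightarrow> l) (at 0)"
    using great_Picard[OF oM ba analytic_imp_holomorphic[OF anY] omY] by blast
  have iso: "isolated_singularity_at (\<lambda>w. K (inverse w)) 0"
    unfolding isolated_singularity_at_def using anM R by (intro exI[of _ "1/R"]) (auto simp: M_def)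
  have isoY: "isolated_singularity_at Y 0"
    unfolding isolated_singularity_at_def using anY R by (intro exI[of _ "1/R"]) (auto simp: M_def)
  have "not_essential (\<lambda>w. inverse (Y w)) 0"
  proof (cases "\<exists>l. (Y \<longlongrightarrow> l) (at 0)")
    case True
    hence "not_essential Y 0" unfolding not_essential_def by blast
    thus ?thesis using isoY by (rule not_essential_inverse)
  next
    case False
    hence "((\<lambda>w. inverse (Y w)) \<longlongrightarrow> l) (at 0)" using l by (auto simp: o_def)
    thus ?thesis unfolding not_essential_def by blast
  qed
  hence ne: "not_essential (\<lambda>w. K (inverse w) - a) 0" by (simp add: Y_def)
  have iso': "isolated_singularity_at (\<lambda>w. K (inverse w) - a) 0"
    unfolding isolated_singularity_at_def using anM R
    by (intro exI[of _ "1/R"]) (auto simp: M_def intro!: analytic_on_diff)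
  have "(\<lambda>w. K (inverse w) - a) meromorphic_on {0}" using ne iso' by (simp add: meromorphic_at_iff)
  hence "(\<lambda>w. (K (inverse w) - a) + a) meromorphic_on {0}" by (intro meromorphic_on_add meromorphic_on_const)
  thus ?thesis by simp
qed

context range_polynomial
begin

text \<open>
  \<open>V(f) P(g) = V(g) P(f)\<close> means \<open>V(f) g^n = V(g) f^n\<close>. Suppose \<open>f = \<zeta> g\<close> at a point where \<open>g \<noteq> 0\<close>, with \<open>\<zeta>^(n-m) = 1\<close>. Then \<open>b (\<zeta>^m - 1) = 0\<close>,
  so \<open>\<zeta>^m = \<zeta>^n = 1\<close> and \<open>\<zeta> = 1\<close> by coprimality. Hence \<open>f / g\<close> omits all other roots of unity of order \<open>n - m\<close>.
  
  Three of them are used. The zeros of \<open>g\<close> may accumulate at infinity, and \<open>f / g\<close> has to be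
  extended to them; it is more convenient to work with \<open>K = g / (f - \<zeta>1 g) = 1 / (f/g - \<zeta>1)\<close>, which is finite, and
  which omits \<open>1 / (\<zeta>2 - \<zeta>1)\<close> and \<open>1 / (\<zeta>3 - \<zeta>1)\<close>. So \<open>K\<close> is meromorphic at infinity, and so is \<open>h = \<zeta>1 + 1 / K = f / g\<close>.
  If \<open>h^m \<noteq> h^n\<close>, then \<open>g^m = b (h^n - 1) / (a (h^m - h^n))\<close> is meromorphic at infinity, which is impossible. Otherwise
  \<open>h^n = 1 = h^m\<close>, that is \<open>f = g\<close> near infinity and hence everywhere.
\<close>
theorem trivially_related_imp_eq:
  assumes f: "admissible f" and g: "admissible g" and t: "transcendental g"
    and rel: "related 1 0 f g" and gcd: "gcd n m = 1"
  shows "f = g"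
proof -
  have rel': "(a * f z ^ m + b) * g z ^ n = (a * g z ^ m + b) * f z ^ n" if "\<not> is_pole f z" "\<not> is_pole g z" for z
  proof -
    have "poly V (f z) * poly P (g z) = poly V (g z) * poly P (f z)" using rel that by (simp add: related_def)
    moreover have "poly P x = x ^ n + poly V x" for x by (simp add: eq_V)
    ultimately show ?thesis by (simp add: poly_V algebra_simps)
  qed
  have finp: "finite ({z. is_pole f z} \<union> {z. is_pole g z})" using f g by (simp add: admissible_def)
  then obtain R where R: "R > 0" "\<And>z. norm z > R \<Longrightarrow> \<not> is_pole f z \<and> \<not> is_pole g z"
  proof -
    have "bounded ({z. is_pole f z} \<union> {z. is_pole g z})" using finp by (rule finite_imp_bounded)
    then obtain R where "R > 0" "\<And>z. z \<in> {z. is_pole f z} \<union> {z. is_pole g z} \<Longrightarrow> norm z \<le> R"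
      unfolding bounded_pos by blast
    thus thesis using that[of R] by force
  qed
  have af: "f analytic_on {z}" and ag: "g analytic_on {z}" if "norm z > R" for z
    using R(2)[OF that] f g admissible_analytic by blast+
  have relR: "(a * f z ^ m + b) * g z ^ n = (a * g z ^ m + b) * f z ^ n" if "norm z > R" for z
    using rel' R(2)[OF that] by blast
  have g0f0: "f z = 0" if "norm z > R" "g z = 0" for z
    using relR[OF that(1)] that(2) b_nz m_pos n_large by (simp add: power_0_left)
  have omit: "f z \<noteq> \<zeta> * g z" if z: "norm z > R" "g z \<noteq> 0" and \<zeta>: "\<zeta> ^ (n - m) = 1" "\<zeta> \<noteq> 1" for z \<zeta>
  proof
    assume eq: "f z = \<zeta> * g z"
    have "\<zeta> ^ n = \<zeta> ^ (n - m) * \<zeta> ^ m" using n_large by (simp add: power_add[symmetric])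
    hence nm: "\<zeta> ^ n = \<zeta> ^ m" using \<zeta> by simp
    have "(a * \<zeta> ^ m * g z ^ m + b) * g z ^ n = (a * g z ^ m + b) * (\<zeta> ^ m * g z ^ n)"
      using relR[OF z(1)] unfolding eq power_mult_distrib nm by (simp add: mult.assoc)
    hence "(a * \<zeta> ^ m * g z ^ m + b) = (a * g z ^ m + b) * \<zeta> ^ m" using z(2) by (simp add: mult.assoc[symmetric])
    hence "b * (\<zeta> ^ m - 1) = 0" by (simp add: algebra_simps)
    hence "\<zeta> ^ m = 1" using b_nz by simp
    hence "\<zeta> = 1" using coprime_root_unity[OF gcd _ _ \<open>\<zeta> ^ m = 1\<close>] nm n_large by simp
    thus False using \<zeta> by simp
  qed
  obtain \<zeta>1 \<zeta>2 \<zeta>3 :: complex where \<zeta>: "\<zeta>1 ^ (n - m) = 1" "\<zeta>2 ^ (n - m) = 1" "\<zeta>3 ^ (n - m) = 1"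
    "\<zeta>1 \<noteq> 1" "\<zeta>2 \<noteq> 1" "\<zeta>3 \<noteq> 1" "\<zeta>1 \<noteq> \<zeta>2" "\<zeta>1 \<noteq> \<zeta>3" "\<zeta>2 \<noteq> \<zeta>3"
  proof -
    define Z where "Z = {z::complex. z ^ (n - m) = 1} - {1}"
    have "card {z::complex. z ^ (n - m) = 1} = n - m" using n_large by (intro card_roots_unity_eq) simp
    hence "card Z = n - m - 1" unfolding Z_def by (subst card_Diff_singleton) auto
    hence "3 \<le> card Z" using n_large by simp
    then obtain Z' where "Z' \<subseteq> Z" "card Z' = 3" using obtain_subset_with_card_n by metis
    then obtain x y z where "Z' = {x, y, z}" "x \<noteq> y" "x \<noteq> z" "y \<noteq> z" by (auto simp: card_3_iff)
    thus thesis using that[of x y z] \<open>Z' \<subseteq> Z\<close> by (auto simp: Z_def)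
  qed
  have root_n: "\<zeta> ^ n \<noteq> 1" if "\<zeta> ^ (n - m) = 1" "\<zeta> \<noteq> 1" for \<zeta> :: complex
  proof
    assume 1: "\<zeta> ^ n = 1"
    have "\<zeta> ^ n = \<zeta> ^ (n - m) * \<zeta> ^ m" using n_large by (simp add: power_add[symmetric])
    hence "\<zeta> ^ m = 1" using 1 that by simp
    thus False using coprime_root_unity[OF gcd _ 1] that n_large by simp
  qed
  have ev_g: "eventually (\<lambda>w. g w \<noteq> 0) (at z)" for z by (rule mero_at(2)[OF mero_admissible[OF g]])
  have ev_R: "eventually (\<lambda>w. norm w > R) (at z)" if "norm z > R" for z :: complex
  proof -
    have "open {w::complex. norm w > R}" by (intro open_Collect_less continuous_intros)
    hence "eventually (\<lambda>w. w \<in> {w. norm w > R}) (at z)" using that by (intro eventually_at_in_open') auto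
    thus ?thesis by simp
  qed
  define q where "q z = f z - \<zeta>1 * g z" for z
  define K where "K z = g z / q z" for z
  have qnz: "q z \<noteq> 0" if "norm z > R" "g z \<noteq> 0" for z
    using omit[OF that \<zeta>(1,4)] by (simp add: q_def)
  have mq: "q meromorphic_on UNIV" unfolding q_def[abs_def]
    using admissible_meromorphic f g by (intro meromorphic_intros) auto
  have mK: "K meromorphic_on UNIV" unfolding K_def[abs_def]
    using mq admissible_meromorphic[OF g] by (intro meromorphic_intros)
  define K' where "K' = remove_sings K"
  have nK': "K' nicely_meromorphic_on UNIV" unfolding K'_def by (rule remove_sings_nicely_meromorphic[OF mK])
  have aq: "q analytic_on {z}" if "norm z > R" for z
    unfolding q_def[abs_def] using af[OF that] ag[OF that] by (intro analytic_intros)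
  have K'_reg: "K analytic_on {z}" "K' z = K z" if "norm z > R" "g z \<noteq> 0" for z
  proof -
    show "K analytic_on {z}" unfolding K_def[abs_def] using qnz[OF that] aq[OF that(1)] ag[OF that(1)]
      by (intro analytic_on_divide) auto
    thus "K' z = K z" by (simp add: K'_def)
  qed
  \<comment> \<open>At a zero of \<open>g\<close> the quotient \<open>f / g\<close> tends to an \<open>n\<close>-th root of unity.\<close>
  have lim_n: "((\<lambda>w. (\<zeta>1 + inverse (K w)) ^ n) \<longlongrightarrow> 1) (at z)" if z: "norm z > R" "g z = 0" for z
  proof -
    have cf: "(f \<longlongrightarrow> 0) (at z)" using analytic_at_imp_isCont[OF af[OF z(1)]] g0f0[OF z] by (simp add: isCont_def)
    have cg: "(g \<longlongrightarrow> 0) (at z)" using analytic_at_imp_isCont[OF ag[OF z(1)]] z(2) by (simp add: isCont_def)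
    have "((\<lambda>w. (a * f w ^ m + b) / (a * g w ^ m + b)) \<longlongrightarrow> (a * 0 ^ m + b) / (a * 0 ^ m + b)) (at z)"
      using b_nz m_pos by (intro tendsto_intros cf cg) (simp add: power_0_left)
    hence lim: "((\<lambda>w. (a * f w ^ m + b) / (a * g w ^ m + b)) \<longlongrightarrow> 1) (at z)" using b_nz m_pos by (simp add: power_0_left)
    have "((\<lambda>w. a * g w ^ m + b) \<longlongrightarrow> a * 0 ^ m + b) (at z)" by (intro tendsto_intros cg)
    hence "eventually (\<lambda>w. a * g w ^ m + b \<noteq> 0) (at z)"
      by (rule tendsto_imp_eventually_ne) (use b_nz m_pos in \<open>simp add: power_0_left\<close>)
    hence "eventually (\<lambda>w. (a * f w ^ m + b) / (a * g w ^ m + b) = (\<zeta>1 + inverse (K w)) ^ n) (at z)"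
      using ev_g[of z] ev_R[OF z(1)]
    proof eventually_elim
      case (elim w)
      have "\<zeta>1 + inverse (K w) = f w / g w" using elim by (simp add: K_def q_def diff_divide_distrib)
      moreover have "(f w / g w) ^ n = (a * f w ^ m + b) / (a * g w ^ m + b)"
        using relR[OF elim(3)] elim(1,2) by (simp add: power_divide frac_eq_eq mult.commute)
      ultimately show ?case by simp
    qed
    with lim show ?thesis by (rule Lim_transform_eventually)
  qed
  have iso: "isolated_singularity_at K z" "not_essential K z" for z
    using meromorphic_on_subset[OF mK, of "{z}"] by (auto simp: meromorphic_at_iff)
  have ne1: "\<zeta>1 ^ n \<noteq> 1" by (rule root_n[OF \<zeta>(1,4)])
  have K_lim: "\<exists>l. K \<midarrow>z\<rightarrow> l" if z: "norm z > R" for z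
  proof (cases "g z = 0")
    case False
    thus ?thesis using analytic_at_imp_isCont[OF K'_reg(1)[OF z False]] by (auto simp: isCont_def)
  next
    case True
    have "\<not> is_pole K z"
    proof
      assume "is_pole K z"
      hence "((\<lambda>w. inverse (K w)) \<longlongrightarrow> 0) (at z)" unfolding is_pole_def by (rule filterlim_compose[OF tendsto_inverse_0])
      hence "((\<lambda>w. (\<zeta>1 + inverse (K w)) ^ n) \<longlongrightarrow> (\<zeta>1 + 0) ^ n) (at z)" by (intro tendsto_intros)
      from tendsto_unique[OF _ this lim_n[OF z True]] show False using ne1 by simp
    qed
    thus ?thesis using iso(2)[of z] unfolding not_essential_def by blast
  qed
  have aK': "K' analytic_on {z}" if z: "norm z > R" for z
    using K_lim[OF z] remove_sings_analytic_at[OF iso(1)] unfolding K'_def by blast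
  have K'_omits: "K' z \<noteq> inverse (\<zeta> - \<zeta>1)" if z: "norm z > R" and zz: "\<zeta> ^ (n - m) = 1" "\<zeta> \<noteq> 1" "\<zeta> \<noteq> \<zeta>1" for z \<zeta>
  proof
    assume eq: "K' z = inverse (\<zeta> - \<zeta>1)"
    show False
    proof (cases "g z = 0")
      case False
      have "g z / q z = inverse (\<zeta> - \<zeta>1)" using eq K'_reg(2)[OF z False] by (simp add: K_def)
      hence "g z * (\<zeta> - \<zeta>1) = q z" using qnz[OF z False] zz by (simp add: field_simps)
      hence "f z = \<zeta> * g z" by (simp add: q_def algebra_simps)
      thus False using omit[OF z False zz(1,2)] by simp
    next
      case True
      obtain l where l: "K \<midarrow>z\<rightarrow> l" using K_lim[OF z] by blast
      hence "l = inverse (\<zeta> - \<zeta>1)" using eq remove_sings_eqI[OF l] by (simp add: K'_def)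
      hence "((\<lambda>w. inverse (K w)) \<longlongrightarrow> inverse (inverse (\<zeta> - \<zeta>1))) (at z)"
        using l zz by (intro tendsto_inverse) auto
      hence "((\<lambda>w. (\<zeta>1 + inverse (K w)) ^ n) \<longlongrightarrow> (\<zeta>1 + (\<zeta> - \<zeta>1)) ^ n) (at z)" by (intro tendsto_intros) simp
      from tendsto_unique[OF _ this lim_n[OF z True]] show False using root_n[OF zz(1,2)] by simp
    qed
  qed
  have K'_eq: "K' z * q z = g z" if z: "norm z > R" for z
  proof (cases "g z = 0")
    case True thus ?thesis using g0f0[OF z True] by (simp add: q_def)
  next
    case False thus ?thesis using K'_reg(2)[OF z False] qnz[OF z False] by (simp add: K_def)
  qed
  define F where "F w = K' (inverse w)" for w
  define f1 where "f1 w = f (inverse w)" for w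
  define g1 where "g1 w = g (inverse w)" for w
  have F: "F meromorphic_on {0}" unfolding F_def[abs_def]
  proof (rule meromorphic_at_infinity_of_omitted_values[OF R(1) aK'])
    show "inverse (\<zeta>2 - \<zeta>1) \<noteq> inverse (\<zeta>3 - \<zeta>1)" using \<zeta> by simp
    show "K' z \<noteq> inverse (\<zeta>2 - \<zeta>1) \<and> K' z \<noteq> inverse (\<zeta>3 - \<zeta>1)" if "norm z > R" for z
      using K'_omits[OF that] \<zeta> by metis
  qed
  have near0: "eventually (\<lambda>w. norm (inverse w) > R) (at (0::complex))"
  proof -
    have "eventually (\<lambda>w. w \<in> ball 0 (1 / R) - {0}) (at (0::complex))" using R(1) by (intro eventually_at_in_open) auto
    thus ?thesis by eventually_elim (rule norm_inverse_gt[OF R(1)], auto)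
  qed
  have Feq: "eventually (\<lambda>w. F w * (f1 w - \<zeta>1 * g1 w) = g1 w) (at 0)"
    using near0 by eventually_elim (use K'_eq in \<open>simp add: F_def f1_def g1_def q_def\<close>)
  have Fnz: "eventually (\<lambda>w. F w \<noteq> 0) (at 0)"
  proof (rule ccontr)
    assume "\<not> ?thesis"
    hence "frequently (\<lambda>w. F w = 0) (at 0)" by (simp add: frequently_def)
    hence "eventually (\<lambda>w. F w = 0) (at 0)"
      using not_essential_frequently_0_imp_eventually_0[of F 0] F by (simp add: meromorphic_at_iff)
    with Feq have "eventually (\<lambda>w. norm (g1 w) \<le> 0) (at 0)" by eventually_elim simp
    from eventually_at_0_imp_at_infinity[OF this]
    have "eventually (\<lambda>z. norm (g z) \<le> 0) at_infinity" unfolding g1_def inverse_inverse_eq .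
    thus False using t unfolding transcendental_def by blast
  qed
  define h where "h w = \<zeta>1 + inverse (F w)" for w
  have mh: "h meromorphic_on {0}" unfolding h_def[abs_def] using F by (intro meromorphic_intros)
  have fh: "eventually (\<lambda>w. f1 w = h w * g1 w) (at 0)"
    using Feq Fnz
  proof eventually_elim
    case (elim w)
    have "h w * g1 w = \<zeta>1 * g1 w + inverse (F w) * (F w * (f1 w - \<zeta>1 * g1 w))" using elim(1) by (simp add: h_def distrib_right)
    thus ?case using elim(2) by (simp add: mult.assoc[symmetric])
  qed
  \<comment> \<open>The zeros of \<open>g\<close> may accumulate at infinity, but there both sides vanish.\<close>
  have main: "eventually (\<lambda>w. a * g1 w ^ m * (h w ^ m - h w ^ n) = b * (h w ^ n - 1)) (at 0)"
    using fh Fnz near0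
  proof eventually_elim
    case (elim w)
    define z where "z = inverse w"
    have z: "norm z > R" using elim(3) by (simp add: z_def)
    show ?case
    proof (cases "g1 w = 0")
      case False
      have "(a * f1 w ^ m + b) * g1 w ^ n = (a * g1 w ^ m + b) * f1 w ^ n"
        using relR[OF z] by (simp add: f1_def g1_def z_def)
      hence "(a * h w ^ m * g1 w ^ m + b) * g1 w ^ n = (a * g1 w ^ m + b) * h w ^ n * g1 w ^ n"
        unfolding elim(1) power_mult_distrib by (simp add: mult_ac)
      hence "a * h w ^ m * g1 w ^ m + b = (a * g1 w ^ m + b) * h w ^ n" using False by simp
      thus ?thesis by (simp add: algebra_simps)
    next
      case True
      hence gz: "g z = 0" by (simp add: g1_def z_def)
      obtain l where l: "K \<midarrow>z\<rightarrow> l" using K_lim[OF z] by blast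
      have lF: "l = F w" using remove_sings_eqI[OF l] by (simp add: F_def K'_def z_def)
      have "((\<lambda>v. (\<zeta>1 + inverse (K v)) ^ n) \<longlongrightarrow> (\<zeta>1 + inverse l) ^ n) (at z)"
        using l lF elim(2) by (intro tendsto_intros) auto
      from tendsto_unique[OF _ this lim_n[OF z gz]] have "h w ^ n = 1" by (simp add: h_def lF)
      thus ?thesis using True m_pos by (simp add: power_0_left)
    qed
  qed
  have mD: "(\<lambda>w. h w ^ m - h w ^ n) meromorphic_on {0}" using mh by (intro meromorphic_intros)
  show "f = g"
  proof (cases "eventually (\<lambda>w. h w ^ m - h w ^ n \<noteq> 0) (at 0)")
    case True
    define G where "G w = b * (h w ^ n - 1) / (a * (h w ^ m - h w ^ n))" for w
    have mG: "G meromorphic_on {0}" unfolding G_def[abs_def] using mh by (intro meromorphic_intros)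
    have ev: "eventually (\<lambda>w. g (inverse w) ^ m = G w) (at 0)"
      using main True by eventually_elim (use a_nz in \<open>simp add: G_def g1_def field_simps\<close>)
    have "not_essential (\<lambda>w. g (inverse w) ^ m) 0"
      using mG not_essential_cong[OF ev refl] by (simp add: meromorphic_at_iff)
    thus ?thesis using not_transcendental m_pos t by blast
  next
    case False
    hence "frequently (\<lambda>w. h w ^ m - h w ^ n = 0) (at 0)" by (simp add: frequently_def)
    hence "eventually (\<lambda>w. h w ^ m - h w ^ n = 0) (at 0)"
      using not_essential_frequently_0_imp_eventually_0[of "\<lambda>w. h w ^ m - h w ^ n" 0] mD by (simp add: meromorphic_at_iff)
    hence "eventually (\<lambda>w. f1 w - g1 w = 0) (at 0)" using main fh
    proof eventually_elim
      case (elim w)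
      have "h w ^ n = 1" using elim(1,2) b_nz by simp
      moreover have "h w ^ m = 1" using elim(1) \<open>h w ^ n = 1\<close> by simp
      ultimately have "h w = 1" using coprime_root_unity[OF gcd] n_large by simp
      thus ?case using elim(3) by simp
    qed
    from eventually_at_0_imp_at_infinity[OF this]
    have "eventually (\<lambda>z. f z = g z) at_infinity" by (simp add: f1_def g1_def)
    then obtain B where B: "\<And>z. norm z \<ge> B \<Longrightarrow> f z = g z" by (auto simp: eventually_at_infinity)
    define z0 where "z0 = complex_of_real (max R B + 1)"
    have "norm z0 = max R B + 1" using R(1) unfolding z0_def norm_of_real by simp
    hence z0: "norm z0 > R" "norm z0 > B" by auto
    define E where "E z = f z - g z" for z
    have mE: "E meromorphic_on UNIV" unfolding E_def[abs_def]
      using admissible_meromorphic f g by (intro meromorphic_intros) auto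
    have "open {z::complex. norm z > B}" by (intro open_Collect_less continuous_intros)
    hence "eventually (\<lambda>z. z \<in> {z. norm z > B}) (at z0)" using z0 by (intro eventually_at_in_open') auto
    hence evE: "eventually (\<lambda>z. E z = 0) (at z0)" by eventually_elim (use B in \<open>auto simp: E_def\<close>)
    have "\<not> eventually (\<lambda>z. E z \<noteq> 0) (cosparse UNIV)"
    proof
      assume "eventually (\<lambda>z. E z \<noteq> 0) (cosparse UNIV)"
      hence "eventually (\<lambda>z. E z \<noteq> 0) (at z0)" by (rule eventually_cosparse_imp_eventually_at) simp
      with evE have "eventually (\<lambda>z. False) (at z0)" by eventually_elim simp
      thus False by simp
    qed
    hence evE: "eventually (\<lambda>z. E z = 0) (cosparse UNIV)"
      using meromorphic_imp_constant_or_avoid[OF mE, of 0] by auto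
    show ?thesis
    proof
      fix z
      have ev: "eventually (\<lambda>w. f w = g w) (at z)"
        using eventually_cosparse_imp_eventually_at[OF evE, of z] by (simp add: E_def)
      have "remove_sings f z = remove_sings g z" by (rule remove_sings_cong[OF ev refl])
      moreover have "remove_sings X z = X z" if "admissible X" for X
      proof (cases "is_pole X z")
        case True
        thus ?thesis using is_pole_zero_at_nicely_mero[of X UNIV z] that by (simp add: admissible_def)
      next
        case False
        thus ?thesis using admissible_analytic[OF that] by simp
      qed
      ultimately show "f z = g z" using f g by metis
    qed
  qed
qed

end

section \<open>L-functions are essential at infinity\<close>

lemma L_function_poles:
  assumes "L_function L"
  shows "L nicely_meromorphic_on UNIV" "{z. is_pole L z} \<subseteq> {1}"
proof -
  show 1: "L nicely_meromorphic_on UNIV" using assms unfolding L_function_def by (elim conjE)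
  obtain k0 G where "entire_finite_order G" and G: "\<And>s. s \<noteq> 1 \<Longrightarrow> G s = (s - 1) ^ k0 * L s"
    using assms unfolding L_function_def by blast
  hence hol: "G holomorphic_on UNIV" by (simp add: entire_finite_order_def)
  show "{z. is_pole L z} \<subseteq> {1}"
  proof
    fix z assume z: "z \<in> {z. is_pole L z}"
    show "z \<in> {1}"
    proof (rule ccontr)
      assume "z \<notin> {1}"
      hence z1: "z \<noteq> 1" by simp
      have "isCont G z" using hol by (metis UNIV_I continuous_on_eq_continuous_at holomorphic_on_imp_continuous_on open_UNIV)
      hence "(G \<longlongrightarrow> G z) (at z)" by (rule isContD)
      hence "((\<lambda>s. G s / (s - 1) ^ k0) \<longlongrightarrow> G z / (z - 1) ^ k0) (at z)" using z1 by (intro tendsto_intros) auto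
      moreover have "eventually (\<lambda>s. G s / (s - 1) ^ k0 = L s) (at z)"
      proof -
        have "eventually (\<lambda>s. s \<in> - {1}) (at z)" using z1 by (intro eventually_at_in_open') auto
        thus ?thesis by eventually_elim (use G in auto)
      qed
      ultimately have "(L \<longlongrightarrow> G z / (z - 1) ^ k0) (at z)" by (rule Lim_transform_eventually)
      thus False using z not_tendsto_and_filterlim_at_infinity[of "at z" L] unfolding is_pole_def by auto
    qed
  qed
qed

text \<open>
  \<open>L = exp (\<Sum> b(j) j^(-s))\<close> with \<open>b(1) = 0\<close>, and the series is \<open>O(2^(-x))\<close> because it converges absolutely at \<open>3\<close>.
\<close>
lemma L_function_exponential_decay:
  assumes "L_function L"
  obtains C where "eventually (\<lambda>x::real. norm (L (of_real x) - 1) \<le> C * 2 powr (- x)) at_top"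
proof -
  obtain b :: "nat \<Rightarrow> complex" and \<theta> :: real where b: "\<And>j. j \<ge> 1 \<Longrightarrow> \<not> primepow j \<Longrightarrow> b j = 0" and \<theta>: "\<theta> < 1/2"
    and bO: "(\<lambda>j. norm (b j)) \<in> O(\<lambda>j. real j powr \<theta>)"
    and bL: "\<And>s. Re s > 1 \<Longrightarrow> \<exists>v. dirichlet_sums b s v \<and> exp v = L s"
    using assms unfolding L_function_def by blast
  have b1: "b 1 = 0" using b[of 1] by simp
  have sum3: "summable (\<lambda>j. norm (b (Suc j)) * real (Suc j) powr (- 3))"
  proof (rule summable_comparison_test_bigo)
    have "(\<lambda>j. norm (b j) * real j powr (- 3)) \<in> O(\<lambda>j. real j powr \<theta> * real j powr (- 3))"
      using bO by (intro landau_o.big.mult) auto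
    also have "(\<lambda>j. real j powr \<theta> * real j powr (- 3)) = (\<lambda>j. real j powr (\<theta> - 3))"
      by (simp add: powr_add[symmetric])
    finally have "(\<lambda>j. norm (b j) * real j powr (- 3)) \<in> O(\<lambda>j. real j powr (\<theta> - 3))" .
    from landau_o.big.compose[OF this filterlim_Suc]
    show "(\<lambda>j. norm (b (Suc j)) * real (Suc j) powr (- 3)) \<in> O(\<lambda>j. real (Suc j) powr (\<theta> - 3))" .
    have "summable (\<lambda>j. real j powr (\<theta> - 3))" using \<theta> by (subst summable_real_powr_iff) simp
    hence "summable (\<lambda>j. real (Suc j) powr (\<theta> - 3))" by (subst summable_Suc_iff)
    thus "summable (\<lambda>j. norm (real (Suc j) powr (\<theta> - 3)))" by simp
  qed
  define M where "M = (\<Sum>j. norm (b (Suc j)) * real (Suc j) powr (- 3))"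
  have M0: "M \<ge> 0" unfolding M_def by (intro suminf_nonneg sum3) auto
  have v_bound: "norm v \<le> M * 2 powr (3 - x)" if x: "x \<ge> 3" and v: "dirichlet_sums b (of_real x) v" for x :: real and v
  proof -
    define t where "t j = b (Suc j) * of_nat (Suc j) powr (- of_real x)" for j
    have tv: "t sums v" using v by (simp only: dirichlet_sums_def t_def[abs_def])
    have tb: "norm (t j) \<le> norm (b (Suc j)) * real (Suc j) powr (- 3) * 2 powr (3 - x)" for j
    proof (cases "j = 0")
      case True thus ?thesis using b1 by (simp add: t_def)
    next
      case False
      have "norm (of_nat (Suc j) powr (- of_real x) :: complex) = real (Suc j) powr (- x)"
        by (subst norm_powr_real_powr) auto
      also have "\<dots> = real (Suc j) powr (- 3) * real (Suc j) powr (3 - x)" by (simp add: powr_add[symmetric])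
      also have "real (Suc j) powr (3 - x) \<le> 2 powr (3 - x)"
        using False x by (intro powr_mono2') auto
      finally have "norm (of_nat (Suc j) powr (- of_real x) :: complex) \<le> real (Suc j) powr (- 3) * 2 powr (3 - x)" by simp
      hence "norm (b (Suc j)) * norm (of_nat (Suc j) powr (- of_real x) :: complex) \<le> norm (b (Suc j)) * (real (Suc j) powr (- 3) * 2 powr (3 - x))"
        by (intro mult_left_mono) auto
      thus ?thesis by (simp only: t_def norm_mult mult.assoc)
    qed
    have s2: "summable (\<lambda>j. norm (b (Suc j)) * real (Suc j) powr (- 3) * 2 powr (3 - x))"
      by (intro summable_mult2 sum3)
    have "norm v = norm (suminf t)" using tv by (simp add: sums_iff)
    also have "\<dots> \<le> (\<Sum>j. norm (b (Suc j)) * real (Suc j) powr (- 3) * 2 powr (3 - x))"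
      by (rule norm_suminf_le[OF tb s2])
    also have "\<dots> = M * 2 powr (3 - x)" unfolding M_def by (rule suminf_mult2[OF sum3, symmetric])
    finally show ?thesis .
  qed
  have "((\<lambda>x::real. M * 2 powr (3 - x)) \<longlongrightarrow> 0) at_top" by real_asymp
  hence "eventually (\<lambda>x::real. M * 2 powr (3 - x) < 1/2) at_top" by (rule order_tendstoD) simp
  hence "eventually (\<lambda>x::real. norm (L (of_real x) - 1) \<le> (16 * M) * 2 powr (- x)) at_top"
    using eventually_ge_at_top[of 3]
  proof eventually_elim
    case (elim x)
    obtain v where v: "dirichlet_sums b (of_real x) v" "exp v = L (of_real x)" using bL[of "of_real x"] elim by auto
    have nv: "norm v \<le> M * 2 powr (3 - x)" by (rule v_bound[OF elim(2) v(1)])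
    hence v2: "norm v \<le> 1/2" using elim by simp
    have "norm (exp v - exp 0) \<le> 2 * norm (v - 0)"
    proof (rule field_differentiable_bound[of "cball 0 (1/2)" exp exp])
      show "(exp has_field_derivative exp z) (at z within cball 0 (1/2))" for z :: complex
        by (rule DERIV_subset[OF DERIV_exp]) simp
      show "norm (exp z) \<le> 2" if "z \<in> cball 0 (1/2)" for z :: complex
        using that by (intro exp_bound_half) simp
    qed (use v2 in auto)
    hence "norm (exp v - 1) \<le> 2 * norm v" by simp
    also have "\<dots> \<le> 2 * (M * 2 powr (3 - x))" using nv by simp
    also have "\<dots> = (16 * M) * 2 powr (- x)" by (simp add: powr_diff powr_minus field_simps)
    finally show ?case using v by simp
  qed
  thus thesis by (rule that)
qed

text \<open>
  \<open>L\<close> tends to \<open>1\<close> along the positive axis, so it does not tend to infinity. If it were bounded near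
  infinity, \<open>L - 1\<close> would be meromorphic there, hence either identically zero or bounded below by a power of
  \<open>1 / norm z\<close>; the latter contradicts the exponential decay.
\<close>
lemma L_function_transcendental:
  assumes L: "L_function L" and nc: "\<not> L constant_on UNIV"
  shows "transcendental L"
proof -
  obtain C where C: "eventually (\<lambda>x::real. norm (L (of_real x) - 1) \<le> C * 2 powr (- x)) at_top"
    using L_function_exponential_decay[OF L] by blast
  have C0: "((\<lambda>x::real. C * 2 powr (- x)) \<longlongrightarrow> 0) at_top" by real_asymp
  have of_real_inf: "filterlim (\<lambda>x::real. complex_of_real x) at_infinity at_top"
    unfolding filterlim_at_infinity_conv_norm_at_top norm_of_real by real_asymp
  have not_inf: "\<not> filterlim L at_infinity at_infinity"
  proof
    assume "filterlim L at_infinity at_infinity"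
    hence "filterlim (\<lambda>x::real. L (of_real x)) at_infinity at_top" using of_real_inf by (rule filterlim_compose)
    hence "eventually (\<lambda>x::real. 3 \<le> norm (L (of_real x))) at_top" unfolding filterlim_at_infinity[OF order_refl] by simp
    moreover have "eventually (\<lambda>x::real. C * 2 powr (- x) < 1) at_top" using C0 by (rule order_tendstoD) simp
    ultimately have "eventually (\<lambda>x::real. False) at_top" using C
    proof eventually_elim
      case (elim x)
      have "norm (L (of_real x)) \<le> norm (L (of_real x) - 1) + norm (1::complex)" by (metis diff_add_cancel norm_triangle_ineq)
      thus ?case using elim by simp
    qed
    thus False by simp
  qed
  moreover have "\<not> eventually (\<lambda>z. norm (L z) \<le> M) at_infinity" for M
  proof
    assume bd: "eventually (\<lambda>z. norm (L z) \<le> M) at_infinity"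
    then obtain B where B: "\<And>z. norm z \<ge> B \<Longrightarrow> norm (L z) \<le> M" by (auto simp: eventually_at_infinity)
    define R where "R = max B 2"
    have an: "L analytic_on {z}" if "z \<noteq> 1" for z
      using L_function_poles[OF L] that nicely_meromorphic_on_imp_analytic_at[of L UNIV z] by auto
    define X where "X w = L (inverse w) - 1" for w
    \<comment> \<open>A function bounded by \<open>M\<close> omits \<open>\<bar>M\<bar> + 1\<close> and \<open>\<bar>M\<bar> + 2\<close>.\<close>
    have "(\<lambda>w. L (inverse w)) meromorphic_on {0}"
    proof (rule meromorphic_at_infinity_of_omitted_values)
      show "R > 0" by (simp add: R_def)
      show "complex_of_real (\<bar>M\<bar> + 1) \<noteq> complex_of_real (\<bar>M\<bar> + 2)" unfolding of_real_eq_iff by simp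
      fix z :: complex assume z: "norm z > R"
      have "z \<noteq> 1" using z by (auto simp: R_def)
      thus "L analytic_on {z}" by (rule an)
      have "norm (L z) \<le> M" using z by (intro B) (simp add: R_def)
      thus "L z \<noteq> complex_of_real (\<bar>M\<bar> + 1) \<and> L z \<noteq> complex_of_real (\<bar>M\<bar> + 2)"
        using norm_of_real[of "\<bar>M\<bar> + 1"] norm_of_real[of "\<bar>M\<bar> + 2"] by fastforce
    qed
    hence mX: "X meromorphic_on {0}" unfolding X_def[abs_def] by (intro meromorphic_on_diff meromorphic_on_const)
    hence iso: "isolated_singularity_at X 0" and ne: "not_essential X 0" by (auto simp: meromorphic_at_iff)
    have fr: "frequently (\<lambda>w. X w \<noteq> 0) (at 0)"
    proof (rule ccontr)
      assume "\<not> ?thesis"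
      hence "eventually (\<lambda>w. X w = 0) (at 0)" by (simp add: frequently_def)
      from eventually_at_0_imp_at_infinity[OF this]
      have "eventually (\<lambda>z. L z = 1) at_infinity" by (simp add: X_def)
      then obtain B' where B': "\<And>z. norm z \<ge> B' \<Longrightarrow> L z = 1" by (auto simp: eventually_at_infinity)
      define z0 where "z0 = complex_of_real (\<bar>B'\<bar> + 1)"
      have z0: "norm z0 > B'" unfolding z0_def norm_of_real by simp
      have "open {z::complex. norm z > B'}" by (intro open_Collect_less continuous_intros)
      hence "eventually (\<lambda>z. z \<in> {z. norm z > B'}) (at z0)" using z0 by (intro eventually_at_in_open') auto
      hence "eventually (\<lambda>z. L z = 1) (at z0)" by eventually_elim (use B' in auto)
      hence "frequently (\<lambda>z. L z = 1) (at z0)" by (rule eventually_frequently[rotated]) simp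
      from frequently_eq_meromorphic_imp_constant[OF this L_function_poles(1)[OF L] open_UNIV connected_UNIV UNIV_I]
      show False using nc by (auto simp: constant_on_def)
    qed
    obtain h r where h: "h 0 \<noteq> 0" "r > 0" "h holomorphic_on cball 0 r"
      "\<And>w. w \<in> cball 0 r - {0} \<Longrightarrow> X w = h w * (w - 0) powi zorder X 0"
      using zorder_exist[OF iso ne fr] by blast
    define N where "N = nat (zorder X 0)"
    have "continuous_on (ball 0 r) h"
      using h(3) by (intro holomorphic_on_imp_continuous_on) (rule holomorphic_on_subset, auto)
    moreover have "(0::complex) \<in> ball 0 r" using h(2) by simp
    ultimately have "isCont h 0" using continuous_on_eq_continuous_at[OF open_ball] by blast
    hence "(h \<longlongrightarrow> h 0) (at 0)" by (rule isContD)
    hence hl: "((\<lambda>w. norm (h w)) \<longlongrightarrow> norm (h 0)) (at 0)" by (rule tendsto_norm)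
    have "eventually (\<lambda>w. norm (h w) > norm (h 0) / 2) (at 0)" by (rule order_tendstoD(1)[OF hl]) (use h(1) in simp)
    moreover have "eventually (\<lambda>w. w \<in> ball 0 (min r 1) - {0}) (at (0::complex))" using h(2) by (intro eventually_at_in_open) auto
    ultimately have "eventually (\<lambda>w. norm (h 0) / 2 * norm w ^ N \<le> norm (X w)) (at 0)"
    proof eventually_elim
      case (elim w)
      have w: "w \<in> cball 0 r - {0}" "norm w \<le> 1" "norm w > 0" using elim by auto
      have "norm w ^ N \<le> norm w powi zorder X 0"
      proof (cases "zorder X 0 \<ge> 0")
        case True
        hence "norm w powi zorder X 0 = norm w ^ N" by (simp add: N_def power_int_def)
        thus ?thesis by simp
      next
        case False
        hence "norm w powi zorder X 0 = inverse (norm w) ^ nat (- zorder X 0)" by (simp add: power_int_def)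
        moreover have "1 \<le> inverse (norm w) ^ nat (- zorder X 0)" using w by (intro one_le_power) (simp add: one_le_inverse)
        ultimately show ?thesis using False by (simp add: N_def)
      qed
      hence "norm (h 0) / 2 * norm w ^ N \<le> norm (h w) * norm w powi zorder X 0"
        using elim(1) by (intro mult_mono) auto
      also have "\<dots> = norm (X w)" using h(4)[OF w(1)] by (simp add: norm_mult norm_power_int)
      finally show ?case .
    qed
    from eventually_at_0_imp_at_infinity[OF this]
    have "eventually (\<lambda>z. norm (h 0) / 2 * norm (inverse z) ^ N \<le> norm (L z - 1)) at_infinity" by (simp add: X_def)
    hence "eventually (\<lambda>x::real. norm (h 0) / 2 * norm (inverse (complex_of_real x)) ^ N \<le> norm (L (of_real x) - 1)) at_top"
      using of_real_inf unfolding filterlim_iff by blast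
    with C eventually_gt_at_top[of 0] have "eventually (\<lambda>x::real. norm (h 0) / 2 \<le> C * 2 powr (- x) * x ^ N) at_top"
    proof eventually_elim
      case (elim x)
      have "norm (h 0) / 2 * inverse x ^ N \<le> C * 2 powr (- x)" using elim by (simp add: norm_inverse)
      hence "norm (h 0) / 2 * inverse x ^ N * x ^ N \<le> C * 2 powr (- x) * x ^ N" using elim by (intro mult_right_mono) auto
      moreover have "inverse x ^ N * x ^ N = 1" using elim by (simp add: power_mult_distrib[symmetric])
      ultimately show ?case by (simp add: mult.assoc)
    qed
    moreover have "((\<lambda>x::real. C * 2 powr (- x) * x ^ N) \<longlongrightarrow> 0) at_top" by real_asymp
    hence "eventually (\<lambda>x::real. C * 2 powr (- x) * x ^ N < norm (h 0) / 2) at_top"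
      by (rule order_tendstoD) (use h(1) in simp)
    ultimately have "eventually (\<lambda>x::real. False) at_top" by eventually_elim simp
    thus False by simp
  qed
  ultimately show ?thesis by (simp add: transcendental_def)
qed

section \<open>Growth of functions essential at infinity\<close>

lemma prox_continuous:
  assumes f: "\<And>z. norm z \<ge> r0 \<Longrightarrow> f analytic_on {z}" and r0: "r0 \<ge> 0"
  shows "continuous_on {r0..} (\<lambda>r. prox r f)"
proof -
  have "f analytic_on {z. norm z \<ge> r0}" by (subst analytic_on_analytic_at) (use f in auto)
  hence cf: "continuous_on {z. norm z \<ge> r0} f"
    using analytic_imp_holomorphic holomorphic_on_imp_continuous_on by blast
  have "continuous_on ({r0..} \<times> cbox 0 1) (\<lambda>(r, t). ln (max 1 (norm (f (circlepath 0 r t)))))"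
    unfolding case_prod_beta
  proof (intro continuous_lnmax continuous_on_norm continuous_on_compose2[OF cf])
    show "continuous_on ({r0..} \<times> cbox 0 1) (\<lambda>p. circlepath 0 (fst p) (snd p))"
      unfolding circlepath by (intro continuous_intros)
    show "(\<lambda>p. circlepath 0 (fst p) (snd p)) ` ({r0..} \<times> cbox 0 1) \<subseteq> {z. r0 \<le> norm z}"
    proof (intro image_subsetI CollectI)
      fix p :: "real \<times> real" assume "p \<in> {r0..} \<times> cbox 0 1"
      hence p: "fst p \<ge> r0" by auto
      hence "norm (circlepath 0 (fst p) (snd p)) = fst p" using circlepath_in_sphere[of "fst p" "snd p"] r0 by simp
      thus "r0 \<le> norm (circlepath 0 (fst p) (snd p))" using p by simp
    qed
  qed
  from integral_continuous_on_param[OF this] show ?thesis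
    unfolding prox_def cmean_def by simp
qed

text \<open>
  By the great theorem of Picard. In its version for infinitely many preimages, the case in which \<open>1 / g\<close> has a limit at
  infinity has to be treated separately: \<open>g\<close> is then essential only if it has zeros arbitrarily far out.
\<close>
lemma transcendental_takes_values_infinitely_often:
  assumes t: "transcendental g" and R: "R > 0" "\<And>z. norm z > R \<Longrightarrow> g analytic_on {z}"
  obtains c where "infinite {z. norm z > R \<and> g z = c}"
proof -
  define M where "M = ball (0::complex) (1 / R)"
  have M: "norm (inverse w) > R" if "w \<in> M - {0}" for w
    using that R by (intro norm_inverse_gt) (auto simp: M_def)
  have an: "(\<lambda>w. g (inverse w)) analytic_on {w}" if "w \<in> M - {0}" for w
  proof -
    have "(g \<circ> inverse) analytic_on {w}"
      by (rule analytic_on_compose) (use that R(2)[OF M[OF that]] in \<open>auto intro!: analytic_intros\<close>)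
    thus ?thesis by (simp add: o_def)
  qed
  hence anM: "(\<lambda>w. g (inverse w)) analytic_on (M - {0})" by (subst analytic_on_analytic_at) blast
  have oM: "open M" "0 \<in> M" using R by (auto simp: M_def)
  have iso: "isolated_singularity_at (\<lambda>w. g (inverse w)) 0"
    unfolding isolated_singularity_at_def using anM R by (intro exI[of _ "1/R"]) (auto simp: M_def)
  have ess: "\<not> not_essential (\<lambda>w. g (inverse w)) 0"
    using not_transcendental[of g 1] t by auto
  have n1: "\<not> ((\<lambda>w. g (inverse w)) \<longlongrightarrow> l) (at 0)" for l using ess unfolding not_essential_def by blast
  show thesis
  proof (cases "\<exists>l. ((inverse \<circ> (\<lambda>w. g (inverse w))) \<longlongrightarrow> l) (at 0)")
    case False
    then obtain a where a: "\<And>c. c \<noteq> a \<Longrightarrow> infinite {x. x \<in> M - {0} \<and> g (inverse x) = c}"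
      using great_Picard_infinite[OF oM analytic_imp_holomorphic[OF anM] n1] by metis
    have inf: "infinite {x. x \<in> M - {0} \<and> g (inverse x) = a + 1}" by (rule a) simp
    have "inverse ` {x. x \<in> M - {0} \<and> g (inverse x) = a + 1} \<subseteq> {z. norm z > R \<and> g z = a + 1}"
      using M by auto
    moreover have "infinite (inverse ` {x. x \<in> M - {0} \<and> g (inverse x) = a + 1})"
      using inf by (subst finite_image_iff) (auto intro!: inj_onI)
    ultimately have "infinite {z. norm z > R \<and> g z = a + 1}" using finite_subset by blast
    thus thesis by (rule that)
  next
    case True
    then obtain l where l: "((\<lambda>w. inverse (g (inverse w))) \<longlongrightarrow> l) (at 0)" by (auto simp: o_def)
    show thesis
    proof (rule that[of 0], rule ccontr)
      assume "\<not> infinite {z. norm z > R \<and> g z = 0}"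
      hence fin: "finite (inverse ` {z. norm z > R \<and> g z = 0})" by simp
      have "eventually (\<lambda>w. w \<notin> inverse ` {z. norm z > R \<and> g z = 0}) (at 0)"
        using islimpt_finite[OF fin] unfolding islimpt_iff_eventually by blast
      moreover have "eventually (\<lambda>w. w \<in> M - {0}) (at 0)" using oM by (intro eventually_at_in_open)
      ultimately have nz: "eventually (\<lambda>w. g (inverse w) \<noteq> 0) (at 0)"
      proof eventually_elim
        case (elim w)
        show ?case
        proof
          assume "g (inverse w) = 0"
          hence "inverse (inverse w) \<in> inverse ` {z. norm z > R \<and> g z = 0}" using M[OF elim(2)] by (intro imageI) simp
          thus False using elim(1) by simp
        qed
      qed
      have "not_essential (\<lambda>w. g (inverse w)) 0"
      proof (cases "l = 0")
        case True
        have "filterlim (\<lambda>w. inverse (g (inverse w))) (at 0) (at 0)"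
          using l nz True by (intro filterlim_atI) (auto elim: eventually_mono)
        hence "filterlim (\<lambda>w. inverse (inverse (g (inverse w)))) at_infinity (at 0)"
          by (rule filterlim_compose[OF filterlim_inverse_at_infinity])
        hence "is_pole (\<lambda>w. g (inverse w)) 0" unfolding is_pole_def by simp
        thus ?thesis by (rule is_pole_imp_not_essential)
      next
        case False
        have "((\<lambda>w. inverse (inverse (g (inverse w)))) \<longlongrightarrow> inverse l) (at 0)" using l False by (rule tendsto_inverse)
        thus ?thesis unfolding not_essential_def by auto
      qed
      thus False using ess by blast
    qed
  qed
qed

text \<open>
  If \<open>g\<close> takes the value \<open>c\<close> infinitely often, any \<open>J\<close> of these points give \<open>N(r) \<ge> J ln r - O(1)\<close>, and Jensen's
  formula transfers this to \<open>prox r g\<close>. It gives the bound at good radii, and continuity of \<open>prox\<close> extends it to all radii.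
\<close>
lemma transcendental_superlogarithmic:
  assumes g: "admissible g" and t: "transcendental g"
    and r0: "r0 > 0" "\<And>z. norm z \<ge> r0 \<Longrightarrow> g analytic_on {z}"
  shows "eventually (\<lambda>r. K * ln r \<le> prox r g) at_top"
proof -
  obtain c where c: "infinite {z. norm z > r0 \<and> g z = c}"
    using transcendental_takes_values_infinitely_often[OF t r0(1)] r0(2) by force
  define X where "X z = poly [:- c, 1:] (g z)" for z
  have Xg: "X = (\<lambda>z. g z - c)" by (auto simp: X_def)
  have mX: "mero X" unfolding Xg by (rule mero_diff_const[OF g])
  have fX: "fin_sing X" unfolding Xg by (rule fin_sing_diff_const[OF admissible_fin_sing[OF g]])
  obtain q where q: "q \<ge> 0" "\<And>r. r \<ge> 1 \<Longrightarrow> Ncount (\<lambda>z. max 0 (- ord X z)) r \<le> q * ln r"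
    using Ncount_neg_part[OF mX fin_sing_neg_ord[OF mX fX]] by blast
  obtain J :: nat where J: "real J \<ge> q + \<bar>K\<bar> + 1" using real_arch_simple by blast
  obtain Z where Z: "Z \<subseteq> {z. norm z > r0 \<and> g z = c}" "finite Z" "card Z = J"
    using infinite_arbitrarily_large[OF c] by blast
  define k1 where "k1 z = (if z \<in> Z then 1 else 0 :: real)" for z
  define kp where "kp z = max 0 (- ord X z)" for z
  have fin1: "finite {z. k1 z \<noteq> 0}" using Z by (simp add: k1_def)
  have lkp: "locfin kp" unfolding kp_def[abs_def] by (rule locfin_comp[OF locfin_ord[OF mX]]) simp
  have ordX: "k1 z + (-1) * kp z \<le> ord X z" for z
  proof (cases "z \<in> Z")
    case True
    hence z: "norm z > r0" "g z = c" using Z by auto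
    have "X analytic_on {z}" unfolding Xg using r0(2)[of z] z by (intro analytic_intros) auto
    hence "zorder X z > 0" by (rule ord_pos[OF mX]) (simp add: Xg z)
    thus ?thesis using True by (simp add: k1_def kp_def)
  next
    case False thus ?thesis by (simp add: k1_def kp_def)
  qed
  define S where "S = (\<Sum>z\<in>Z. ln (max 1 (norm z)))"
  define r1 where "r1 = max (max 1 r0) (\<Sum>z\<in>Z. norm z + 1)"
  have Zr: "norm z < r1" if "z \<in> Z" for z
  proof -
    have "norm z + 1 \<le> (\<Sum>z\<in>Z. norm z + 1)"
      using Z(2) that by (intro member_le_sum[of z Z "\<lambda>z. norm z + 1"]) (auto intro: add_nonneg_nonneg)
    thus ?thesis by (simp add: r1_def)
  qed
  have lower: "Ncount (ord X) r \<ge> (\<bar>K\<bar> + 1) * ln r - S" if r: "r \<ge> r1" for r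
  proof -
    have r': "r \<ge> 1" using r by (simp add: r1_def)
    have "Ncount k1 r = (\<Sum>z\<in>Z. k1 z * ln (r / max 1 (norm z)))"
    proof (rule Ncount_eq)
      show "finite Z" by (rule Z(2))
      show "{z \<in> ball 0 r. k1 z \<noteq> 0} \<subseteq> Z" by (auto simp: k1_def split: if_splits)
      show "Z \<subseteq> ball 0 r"
      proof
        fix z assume "z \<in> Z"
        from Zr[OF this] r show "z \<in> ball 0 r" by simp
      qed
    qed
    also have "\<dots> = (\<Sum>z\<in>Z. ln r - ln (max 1 (norm z)))"
      using r' by (intro sum.cong) (auto simp: k1_def ln_div)
    also have "\<dots> = J * ln r - S" by (simp add: sum_subtractf S_def Z(3))
    finally have N1: "Ncount k1 r = J * ln r - S" .
    have "Ncount (\<lambda>z. k1 z + (-1) * kp z) r \<le> Ncount (ord X) r"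
      by (rule Ncount_mono[OF locfin_add[OF locfin_finite[OF fin1] locfin_cmult[OF lkp]] locfin_ord[OF mX] ordX r'])
    hence "J * ln r - S - Ncount kp r \<le> Ncount (ord X) r"
      unfolding Ncount_add[OF locfin_finite[OF fin1] locfin_cmult[OF lkp]] Ncount_cmult N1 by simp
    moreover have "Ncount kp r \<le> q * ln r" unfolding kp_def[abs_def] by (rule q(2)[OF r'])
    moreover have "(q + \<bar>K\<bar> + 1) * ln r \<le> J * ln r" using J r' by (intro mult_right_mono) auto
    ultimately show ?thesis by (simp add: algebra_simps)
  qed
  obtain C where C: "\<And>r. r \<ge> 1 \<Longrightarrow> good X r \<Longrightarrow> Ncount (ord X) r \<le> prox r X + C"
    using Ncount_ord_le_prox[OF mX] by blast
  define A where "A = [:- c, 1:]"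
  obtain D where D0: "D \<ge> 0" and D: "\<And>Y r. r \<ge> 0 \<Longrightarrow> good Y r \<Longrightarrow> good (\<lambda>z. poly A (Y z)) r \<Longrightarrow>
    prox r (\<lambda>z. poly A (Y z)) \<le> degree A * prox r Y + D"
    by (rule prox_poly_le[of A], rule that, assumption, simp only:)
  have good_bound: "(\<bar>K\<bar> + 1) * ln r - (S + C + D) \<le> prox r g" if r: "r \<ge> r1" "good X r" "good g r" for r
  proof -
    have r': "r \<ge> 1" using r by (simp add: r1_def)
    have XA: "X = (\<lambda>z. poly A (g z))" and dA: "degree A = 1" by (simp_all add: X_def[abs_def] A_def)
    have "0 \<le> r" using r' by simp
    from D[OF this r(3) r(2)[unfolded XA]] have "prox r X \<le> 1 * prox r g + D" unfolding XA[symmetric] dA by simp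
    thus ?thesis using C[OF r' r(2)] lower[OF r(1)] by simp
  qed
  have all_bound: "(\<bar>K\<bar> + 1) * ln r - (S + C + D) \<le> prox r g" if r: "r \<ge> r1" for r
  proof (rule ccontr)
    assume neg: "\<not> ?thesis"
    define h where "h s = prox s g - ((\<bar>K\<bar> + 1) * ln s - (S + C + D))" for s
    have r1': "r1 \<ge> r0" "r1 \<ge> 1" by (auto simp: r1_def)
    have "continuous_on {r1..} (\<lambda>s. prox s g)"
      by (rule continuous_on_subset[OF prox_continuous[OF r0(2) less_imp_le[OF r0(1)]]]) (use r1' in auto)
    hence "continuous_on {r1..} h" unfolding h_def using r1' by (intro continuous_intros) auto
    moreover have "r \<in> {r1..}" "0 < - h r" using r neg by (auto simp: h_def)
    ultimately obtain d where d: "d > 0" "\<And>s. s \<in> {r1..} \<Longrightarrow> dist s r < d \<Longrightarrow> dist (h s) (h r) < - h r"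
      unfolding continuous_on_iff by blast
    have cU: "countable {s. \<not> good g s}" by (rule countable_bad_radii[OF mero_admissible[OF g]])
    have "r < r + d" using d by simp
    from exists_good_radius[OF mX cU this] obtain s where s: "r < s" "s < r + d" "good X s" "good g s" by auto
    have "dist (h s) (h r) < - h r" using s r by (intro d) (auto simp: dist_real_def)
    hence "h s < 0" by (simp add: dist_real_def abs_less_iff)
    moreover have "h s \<ge> 0" using good_bound[of s] s r by (simp add: h_def)
    ultimately show False by simp
  qed
  have "eventually (\<lambda>r::real. S + C + D \<le> ln r) at_top"
    using ln_at_top unfolding filterlim_at_top by blast
  thus ?thesis using eventually_ge_at_top[of r1] eventually_ge_at_top[of 1]
  proof eventually_elim
    case (elim r)
    have "K * ln r \<le> \<bar>K\<bar> * ln r" using elim(3) by (intro mult_right_mono) auto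
    thus ?case using all_bound[OF elim(2)] elim(1) by (simp add: algebra_simps)
  qed
qed

text \<open>
  The radii start beyond all poles, where \<open>prox\<close> is continuous.
\<close>
lemma growth_of_pair:
  assumes f: "admissible f" and g: "admissible g" and t: "transcendental g"
  obtains r0 where "growth (\<lambda>r. prox r f + prox r g) r0"
proof -
  have fin: "finite ({z. is_pole f z} \<union> {z. is_pole g z})" using f g by (simp add: admissible_def)
  obtain R where R: "R > 0" "\<And>z. z \<in> {z. is_pole f z} \<union> {z. is_pole g z} \<Longrightarrow> norm z \<le> R"
    using finite_imp_bounded[OF fin] unfolding bounded_pos by blast
  define r0 where "r0 = R + 1"
  have af: "f analytic_on {z}" and ag: "g analytic_on {z}" if "norm z \<ge> r0" for z
  proof -
    have "z \<notin> {z. is_pole f z} \<union> {z. is_pole g z}" using R(2)[of z] that by (auto simp: r0_def)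
    thus "f analytic_on {z}" "g analytic_on {z}" using admissible_analytic f g by auto
  qed
  have r0: "r0 > 0" using R by (simp add: r0_def)
  show thesis
  proof (rule that, standard)
    show "continuous_on {r0..} (\<lambda>r. prox r f + prox r g)"
      using r0 by (intro continuous_on_add prox_continuous af ag) auto
    show "0 \<le> prox r f + prox r g" for r by (intro add_nonneg_nonneg prox_ge_0)
    fix K :: real
    have "eventually (\<lambda>r. K * ln r \<le> prox r g) at_top"
      by (rule transcendental_superlogarithmic[OF g t r0]) (rule ag)
    thus "eventually (\<lambda>r. K * ln r \<le> prox r f + prox r g) at_top"
    proof eventually_elim
      case (elim r)
      thus ?case using prox_ge_0[of r f] by linarith
    qed
  qed
qed

section \<open>Uniqueness\<close>

context range_polynomial
begin

text \<open>
  Points that are poles of \<open>f\<close> or \<open>g\<close> are exempt from the hypotheses, since finitely many points do not matter.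
  The weights \<open>2\<close> and \<open>1\<close> at the roots of \<open>Q\<close> correspond to \<open>\<kappa> = 0\<close> and \<open>\<kappa> = 1/2\<close>.
\<close>
theorem uniqueness:
  fixes \<kappa> :: real
  assumes f: "admissible f" and g: "admissible g" and t: "transcendental g" and gcd: "gcd n m = 1"
    and s1: "\<And>z. \<not> is_pole f z \<Longrightarrow> \<not> is_pole g z \<Longrightarrow> f z = \<alpha> \<longleftrightarrow> g z = \<alpha>"
    and s2: "\<And>z. \<not> is_pole f z \<Longrightarrow> \<not> is_pole g z \<Longrightarrow> poly Q (f z) = 0 \<longleftrightarrow> poly Q (g z) = 0"
    and s3: "\<And>z. \<not> is_pole f z \<Longrightarrow> \<not> is_pole g z \<Longrightarrow> poly Q (f z) = 0 \<Longrightarrow>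
        min (mult_at f z) 3 = min (mult_at g z) 3 \<or> \<kappa> = 1/2 \<and> min (mult_at f z) 2 = min (mult_at g z) 2"
    and \<kappa>: "\<kappa> \<ge> 0" and n: "real n > 2 * m + 4 + 2 * \<kappa>"
  shows "f = g"
proof -
  obtain r0 where gr: "growth (\<lambda>r. prox r f + prox r g) r0" using growth_of_pair[OF f g t] by blast
  interpret growth "\<lambda>r. prox r f + prox r g" r0 by (rule gr)
  have tf: "tame f" by (rule tame_of_prox_le[OF f]) (simp add: prox_ge_0)
  have tg: "tame g" by (rule tame_of_prox_le[OF g]) (simp add: prox_ge_0)
  define \<rho> where "\<rho> = (\<lambda>z. \<phi> f z / \<phi> g z)"
  have "\<not> mero (\<lambda>z. deriv \<rho> z / \<rho> z)"
    by (rule nondegenerate_impossible[OF gr refl f tf g tg s1 s2 s3 \<kappa> n \<rho>_def])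
  then obtain c d where cd: "c \<noteq> 0" "related c d f g"
    using degenerate_relation[OF f g \<rho>_def] by blast
  have "c = 1 \<and> d = 0" by (rule related_imp_trivial[OF gr refl f tf g tg cd])
  thus ?thesis using trivially_related_imp_eq[OF f g t _ gcd] cd(2) by simp
qed

end

section \<open>Weighted sharing\<close>

lemma mem_E_set:
  "(z, e) \<in> E_set f T k \<longleftrightarrow> \<not> is_pole f z \<and> f z \<in> T \<and> e = weighted_count k (nat (mult_at f z))"
  by (auto simp: E_set_def E_point_def value_point_def value_mult_def mult_at_def)

lemma shares_value_iff:
  assumes "shares f g T k" "\<not> is_pole f z" "\<not> is_pole g z"
  shows "f z \<in> T \<longleftrightarrow> g z \<in> T"
proof -
  have "(\<exists>e. (z, e) \<in> E_set f T k) \<longleftrightarrow> (\<exists>e. (z, e) \<in> E_set g T k)"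
    using assms(1) by (simp add: shares_def)
  thus ?thesis using assms(2,3) by (simp add: mem_E_set)
qed

lemma shares_weighted_count_eq:
  assumes "shares f g T k" "\<not> is_pole f z" "f z \<in> T"
  shows "weighted_count k (nat (mult_at f z)) = weighted_count k (nat (mult_at g z))"
proof -
  have "(z, weighted_count k (nat (mult_at f z))) \<in> E_set f T k" using assms by (simp add: mem_E_set)
  hence "(z, weighted_count k (nat (mult_at f z))) \<in> E_set g T k" using assms(1) by (simp add: shares_def)
  thus ?thesis by (simp add: mem_E_set)
qed

lemma weighted_count_enat: "weighted_count (enat l) p = enat (min p (Suc l))"
  by (auto simp: weighted_count_def min_def one_enat_def)

lemma shares_truncated_mult_eq:
  assumes "shares f g T (enat l)" "\<not> is_pole f z" "f z \<in> T" "mult_at f z \<ge> 1" "mult_at g z \<ge> 1"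
  shows "min (mult_at f z) (int (Suc l)) = min (mult_at g z) (int (Suc l))"
proof -
  have "min (nat (mult_at f z)) (Suc l) = min (nat (mult_at g z)) (Suc l)"
    using shares_weighted_count_eq[OF assms(1-3)] by (simp add: weighted_count_enat)
  thus ?thesis using assms(4,5) by linarith
qed

theorem theorem1p1:
  fixes n m :: nat and a b :: complex and P :: "complex poly" and S :: "complex set"
    and \<alpha> :: "nat \<Rightarrow> complex" and f L :: "complex \<Rightarrow> complex"
  assumes "n > 0" and "m > 0" and "gcd n m = 1"
    and "a \<noteq> 0" and "b \<noteq> 0"
    and "P = monom 1 n + monom a m + [:b:]"
    and "S = {w. poly P w = 0}"
    and "card S = n - 1"
    and "S = \<alpha> ` {1..n - 1}"
    and "order (\<alpha> 1) P > 1"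
    and "\<forall>j\<in>{2..n - 1}. order (\<alpha> j) P = 1"
    and "f nicely_meromorphic_on UNIV" and "\<not> f constant_on UNIV"
    and "finite {z. is_pole f z}"
    and "L_function L" and "\<not> L constant_on UNIV"
    and "(shares_restricted f L S 1 [({\<alpha> 1}, 1), (\<alpha> ` {2..n - 1}, 2)] \<and> n > 2 * m + 4) \<or>
         (shares_restricted f L S 0 [({\<alpha> 1}, 0), (\<alpha> ` {2..n - 1}, 1)] \<and> n > 2 * m + 5)"
  shows "f = L"
proof -
  define A where "A = \<alpha> ` {2..n - 1}"
  have n: "n > 2 * m + 4" using assms(17) by auto
  have inj: "inj_on \<alpha> {1..n - 1}"
    using assms(8,9) by (intro eq_card_imp_inj_on) auto
  have split: "{1..n - 1} = insert 1 {2..n - 1}" using n by auto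
  have S_eq: "S = insert (\<alpha> 1) A" unfolding assms(9) A_def by (subst split) simp
  have \<alpha>1: "\<alpha> 1 \<notin> A"
  proof
    assume "\<alpha> 1 \<in> A"
    then obtain j where j: "j \<in> {2..n - 1}" "\<alpha> 1 = \<alpha> j" by (auto simp: A_def)
    have "1 = j" by (rule inj_onD[OF inj j(2)]) (use j(1) in auto)
    thus False using j(1) by simp
  qed
  have deg: "degree P = n"
  proof -
    have "degree (monom a m + [:b:]) < n"
      using n by (intro degree_add_less) (auto intro: le_less_trans[OF degree_monom_le])
    thus ?thesis unfolding assms(6) add.assoc by (subst degree_add_eq_left) (simp_all add: degree_monom_eq)
  qed
  have P0: "P \<noteq> 0" using deg n by auto
  have cardA: "card A = n - 2"
    unfolding A_def by (subst card_image[OF inj_on_subset[OF inj]]) auto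
  have "(\<Sum>w\<in>S. order w P) = n" using sum_order_complex_poly[OF P0] assms(7) deg by simp
  \<comment> \<open>The orders add up to \<open>n\<close>, so the multiple root is a double root.\<close>
  moreover have "(\<Sum>w\<in>A. order w P) = n - 2"
    using assms(11) cardA by (subst sum.cong[OF refl, of A _ "\<lambda>_. 1"]) (auto simp: A_def)
  moreover have "finite A" by (simp add: A_def)
  ultimately have ord1: "order (\<alpha> 1) P = 2" using \<alpha>1 n by (simp add: S_eq)
  obtain Q where Q: "P = [:- \<alpha> 1, 1:] ^ 2 * Q" "\<not> [:- \<alpha> 1, 1:] dvd Q"
    using order_decomp[OF P0, of "\<alpha> 1"] unfolding ord1 by blast
  have Q\<alpha>: "poly Q (\<alpha> 1) \<noteq> 0" using Q(2) by (simp add: poly_eq_0_iff_dvd)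
  have Q_roots: "poly Q w = 0 \<longleftrightarrow> w \<in> A" for w
  proof -
    have "poly P w = 0 \<longleftrightarrow> w = \<alpha> 1 \<or> poly Q w = 0" by (simp add: Q(1))
    moreover have "poly P w = 0 \<longleftrightarrow> w = \<alpha> 1 \<or> w \<in> A" using assms(7) S_eq by blast
    ultimately show ?thesis using Q\<alpha> \<alpha>1 by metis
  qed
  interpret range_polynomial n m a b "\<alpha> 1" P Q
  proof
    show "order \<beta> P = 1" if "poly Q \<beta> = 0" for \<beta>
      using that assms(11) by (auto simp: Q_roots A_def)
    show "card {w. poly P w = 0} = n - 1" using assms(7,8) by simp
  qed (use assms n Q Q\<alpha> in simp_all)
  have f: "admissible f" using assms(12-14) by (simp add: admissible_def)
  have "finite {z. is_pole L z}" using L_function_poles(2)[OF assms(15)] by (rule finite_subset) simp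
  hence L: "admissible L" using L_function_poles(1)[OF assms(15)] assms(16) by (simp add: admissible_def)
  have t: "transcendental L" by (rule L_function_transcendental[OF assms(15,16)])
  have shared: "f = L"
    if k: "shares f L {\<alpha> 1} (enat k)" and l: "shares f L A (enat l)"
      and c: "\<kappa> \<ge> 0" "real n > 2 * m + 4 + 2 * \<kappa>" "l = 2 \<or> \<kappa> = 1/2 \<and> l = 1" for k l :: nat and \<kappa> :: real
  proof (rule uniqueness[OF f L t assms(3) _ _ _ c(1,2)])
    fix z assume z: "\<not> is_pole f z" "\<not> is_pole L z"
    show "f z = \<alpha> 1 \<longleftrightarrow> L z = \<alpha> 1" using shares_value_iff[OF k z] by simp
    show "poly Q (f z) = 0 \<longleftrightarrow> poly Q (L z) = 0" using shares_value_iff[OF l z] by (simp add: Q_roots)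
    assume "poly Q (f z) = 0"
    hence "f z \<in> A" by (simp add: Q_roots)
    from shares_truncated_mult_eq[OF l z(1) this mult_at_ge_1[OF f z(1)] mult_at_ge_1[OF L z(2)]]
    show "min (mult_at f z) 3 = min (mult_at L z) 3 \<or> \<kappa> = 1/2 \<and> min (mult_at f z) 2 = min (mult_at L z) 2"
      using c(3) by auto
  qed
  from assms(17) show ?thesis
  proof (elim disjE conjE)
    assume "shares_restricted f L S 1 [({\<alpha> 1}, 1), (\<alpha> ` {2..n - 1}, 2)]"
    hence "shares f L {\<alpha> 1} (enat 1)" "shares f L A (enat 2)"
      by (simp_all add: shares_restricted_def A_def one_enat_def numeral_eq_enat)
    thus ?thesis by (rule shared[where \<kappa> = 0]) (use n in auto)
  next
    assume "shares_restricted f L S 0 [({\<alpha> 1}, 0), (\<alpha> ` {2..n - 1}, 1)]" and n5: "n > 2 * m + 5"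
    hence "shares f L {\<alpha> 1} (enat 0)" "shares f L A (enat 1)"
      by (simp_all add: shares_restricted_def A_def one_enat_def zero_enat_def)
    thus ?thesis by (rule shared[where \<kappa> = "1/2"]) (use n5 in auto)
  qed
qed

end
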